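(* Let $F_2=\langle a,b\rangle$ be the free group of rank 2 and let $G=\langle a,b\mid uvu^{-1}v^{-1}\rangle$, where $u$ and $v$ are any elements of $F_2$ such that $uvu^{-1}v^{-1}$, when reduced and cyclically reduced, is not equal to $aba^{-1}b^{-1}$, $bab^{-1}a^{-1}$ or one of their cyclic conjugates. Then $G$ is large or $G$ is residually useless.
   Context: A finitely generated group $G$ is large if it has a finite index subgroup possessing a surjective homomorphism onto a non-abelian free group. A finitely generated group $G$ with commutator subgroup $G'$ is residually useless if $G$ is non-abelian and $G'$ equals the intersection of all finite index subgroups of $G$. *)

theory Defs
  imports "HOL-Algebra.Algebra"
begin

section \<open>Words, reduction and cyclic reduction\<close>

text \<open>The letter \<open>(x, True)\<close> stands for the generator \<open>x\<close> and \<open>(x, False)\<close> for its formal inverse.\<close>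

type_synonym 'a letter = "'a \<times> bool"
type_synonym 'a word = "'a letter list"

definition inv_letter :: "'a letter \<Rightarrow> 'a letter" where
  "inv_letter x = (fst x, \<not> snd x)"

definition inv_word :: "'a word \<Rightarrow> 'a word" where
  "inv_word w = map inv_letter (rev w)"

fun reduced :: "'a word \<Rightarrow> bool" where
  "reduced [] = True"
| "reduced [x] = True"
| "reduced (x # y # w) = (y \<noteq> inv_letter x \<and> reduced (y # w))"

fun cons_reduce :: "'a letter \<Rightarrow> 'a word \<Rightarrow> 'a word" where
  "cons_reduce x [] = [x]"
| "cons_reduce x (y # w) = (if y = inv_letter x then w else x # y # w)"

definition reduce :: "'a word \<Rightarrow> 'a word" where
  "reduce w = foldr cons_reduce w []"

text \<open>Applied to a reduced word, \<open>cyc_reduce\<close> strips mutually inverse first and last letters until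
  the word is cyclically reduced. A one-letter word is never stripped, since no letter equals its
  own inverse.\<close>

function cyc_reduce :: "'a word \<Rightarrow> 'a word" where
  "cyc_reduce w =
     (if w \<noteq> [] \<and> hd w = inv_letter (last w) then cyc_reduce (butlast (tl w)) else w)"
  by pat_completeness auto
termination
  by (relation "measure length") auto

declare cyc_reduce.simps [simp del]

definition cyclic_conjugates :: "'a word \<Rightarrow> 'a word set" where
  "cyclic_conjugates w = {rotate n w |n. True}"


section \<open>Free groups and group presentations\<close>

text \<open>The free group on \<open>S\<close>, with reduced words in the letters of \<open>S\<close> as elements.\<close>

definition free_group :: "'a set \<Rightarrow> 'a word monoid" where
  "free_group S =
     \<lparr>carrier = {w. reduced w \<and> fst ` set w \<subseteq> S}, monoid.mult = (\<lambda>u v. reduce (u @ v)), one = []\<rparr>"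

definition normal_closure :: "('a, 'b) monoid_scheme \<Rightarrow> 'a set \<Rightarrow> 'a set" where
  "normal_closure G R = \<Inter>{N. N \<lhd> G \<and> R \<subseteq> N}"

definition presented_group :: "'a set \<Rightarrow> 'a word set \<Rightarrow> 'a word set monoid" where
  "presented_group S R = free_group S Mod normal_closure (free_group S) R"

definition commutator :: "('a, 'b) monoid_scheme \<Rightarrow> 'a \<Rightarrow> 'a \<Rightarrow> 'a" where
  "commutator G x y = x \<otimes>\<^bsub>G\<^esub> y \<otimes>\<^bsub>G\<^esub> inv\<^bsub>G\<^esub> x \<otimes>\<^bsub>G\<^esub> inv\<^bsub>G\<^esub> y"


section \<open>Large and residually useless groups\<close>

definition finitely_generated :: "('a, 'b) monoid_scheme \<Rightarrow> bool" where
  "finitely_generated G \<longleftrightarrow>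
     group G \<and> (\<exists>S. finite S \<and> S \<subseteq> carrier G \<and> generate G S = carrier G)"

definition finite_index :: "('a, 'b) monoid_scheme \<Rightarrow> 'a set \<Rightarrow> bool" where
  "finite_index G H \<longleftrightarrow> subgroup H G \<and> finite (rcosets\<^bsub>G\<^esub> H)"

text \<open>A finite index subgroup of a finitely generated group is countable, hence so is any
  free group it maps onto; so it is no restriction to take the free basis inside \<open>nat\<close>.\<close>

definition large :: "('a, 'b) monoid_scheme \<Rightarrow> bool" where
  "large G \<longleftrightarrow> finitely_generated G \<and>
     (\<exists>H (S :: nat set) h. finite_index G H \<and> \<not> comm_group (free_group S) \<and>
        h \<in> hom (G\<lparr>carrier := H\<rparr>) (free_group S) \<and> h ` H = carrier (free_group S))"

definition residually_useless :: "('a, 'b) monoid_scheme \<Rightarrow> bool" where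
  "residually_useless G \<longleftrightarrow> finitely_generated G \<and> \<not> comm_group G \<and>
     derived G (carrier G) = \<Inter>{H. finite_index G H}"


section \<open>The free group of rank two\<close>

datatype gen2 = Gen_a | Gen_b

abbreviation F2 :: "gen2 word monoid" where
  "F2 \<equiv> free_group UNIV"

definition aba'b' :: "gen2 word" where
  "aba'b' = [(Gen_a, True), (Gen_b, True), (Gen_a, False), (Gen_b, False)]"

definition bab'a' :: "gen2 word" where
  "bab'a' = [(Gen_b, True), (Gen_a, True), (Gen_b, False), (Gen_a, False)]"


section \<open>Basic facts\<close>

lemma inv_letter_simps [simp]:
  "inv_letter (inv_letter x) = x" "fst (inv_letter x) = fst x"
  "inv_letter x \<noteq> x" "x \<noteq> inv_letter x" "inv_letter x = inv_letter y \<longleftrightarrow> x = y"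
  by (auto simp: inv_letter_def prod_eq_iff)

lemma reduced_ConsD: "reduced (x # w) \<Longrightarrow> reduced w"
  by (cases w) auto

lemma reduced_cons_reduce: "reduced w \<Longrightarrow> reduced (cons_reduce x w)"
  by (cases w) (auto dest: reduced_ConsD)

lemma reduced_foldr: "reduced w \<Longrightarrow> reduced (foldr cons_reduce u w)"
  by (induction u) (auto intro: reduced_cons_reduce)

lemma reduced_reduce [simp]: "reduced (reduce w)"
  by (simp add: reduce_def reduced_foldr)

lemma reduce_id: "reduced w \<Longrightarrow> reduce w = w"
proof (induction w)
  case (Cons x w)
  then have "reduce w = w" by (auto dest: reduced_ConsD)
  with Cons.prems show ?case by (cases w) (auto simp: reduce_def)
qed (simp add: reduce_def)

lemma cons_reduce_cancel:
  assumes "reduced w"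
  shows "cons_reduce x (cons_reduce (inv_letter x) w) = w"
proof (cases w)
  case (Cons y v)
  with assms show ?thesis by (cases v) auto
qed auto

lemma foldr_cons_reduce:
  assumes "reduced w"
  shows "foldr cons_reduce (reduce u) w = foldr cons_reduce u w"
proof (induction u)
  case (Cons x u)
  show ?case
  proof (cases "reduce u")
    case Nil
    with Cons show ?thesis by (simp add: reduce_def)
  next
    case (Cons y v)
    have eq: "foldr cons_reduce u w = cons_reduce y (foldr cons_reduce v w)"
      using Cons.IH Cons by simp
    have "reduce (x # u) = cons_reduce x (y # v)"
      using Cons by (simp add: reduce_def)
    moreover have "foldr cons_reduce v w = cons_reduce x (cons_reduce y (foldr cons_reduce v w))"
      if "y = inv_letter x"
      using cons_reduce_cancel[OF reduced_foldr[OF assms]] that by metis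
    ultimately show ?thesis using eq by auto
  qed
qed (simp add: reduce_def)

lemma reduce_append: "reduce (u @ v) = foldr cons_reduce u (reduce v)"
  by (simp add: reduce_def)

lemma reduce_append_reduce: "reduce (reduce u @ v) = reduce (u @ v)"
  by (simp add: reduce_append foldr_cons_reduce)

lemma reduce_append_reduce': "reduce (u @ reduce v) = reduce (u @ v)"
  by (simp add: reduce_append reduce_id)

lemma set_cons_reduce: "set (cons_reduce x w) \<subseteq> insert x (set w)"
  by (cases w) auto

lemma set_reduce: "set (reduce w) \<subseteq> set w"
proof (induction w)
  case (Cons x w)
  then show ?case using set_cons_reduce[of x "reduce w"] by (auto simp: reduce_def)
qed (simp add: reduce_def)

lemma reduce_letters: "fst ` set w \<subseteq> S \<Longrightarrow> fst ` set (reduce w) \<subseteq> S"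
  by (rule order_trans[OF image_mono[OF set_reduce]])

lemma fst_set_inv_word: "fst ` set (inv_word w) = fst ` set w"
  by (simp add: inv_word_def image_image)

lemma reduce_inv_word: "reduce (inv_word w @ w) = []"
proof (induction w)
  case (Cons x w)
  have "cons_reduce (inv_letter x) (cons_reduce x (reduce w)) = reduce w"
    using cons_reduce_cancel[of "reduce w" "inv_letter x"] by simp
  then have "reduce (inv_word (x # w) @ x # w) = foldr cons_reduce (inv_word w) (reduce w)"
    by (simp add: reduce_def inv_word_def)
  with Cons show ?case by (simp add: reduce_append)
qed (simp add: reduce_def inv_word_def)

lemma group_free_group: "group (free_group S)"
proof (rule groupI)
  fix x assume x: "x \<in> carrier (free_group S)"
  have "reduce (reduce (inv_word x) @ x) = []"
    by (simp add: reduce_append_reduce reduce_inv_word)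
  moreover have "fst ` set (reduce (inv_word x)) \<subseteq> S"
    using x by (intro reduce_letters) (simp add: free_group_def fst_set_inv_word)
  ultimately show "\<exists>y\<in>carrier (free_group S). y \<otimes>\<^bsub>free_group S\<^esub> x = \<one>\<^bsub>free_group S\<^esub>"
    by (intro bexI[of _ "reduce (inv_word x)"]) (auto simp: free_group_def)
next
  fix x y assume "x \<in> carrier (free_group S)" "y \<in> carrier (free_group S)"
  then show "x \<otimes>\<^bsub>free_group S\<^esub> y \<in> carrier (free_group S)"
    using reduce_letters[of "x @ y" S] by (simp add: free_group_def image_Un)
qed (auto simp: free_group_def reduce_append_reduce reduce_append_reduce' reduce_id)

lemma (in group) normal_closure_normal:
  assumes "R \<subseteq> carrier G"
  shows "normal_closure G R \<lhd> G"
proof -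
  have car: "carrier G \<lhd> G"
    by (simp add: normal_inv_iff subgroup_self)
  have "subgroup (normal_closure G R) G"
    unfolding normal_closure_def using car assms
    by (intro subgroups_Inter) (auto intro: normal_imp_subgroup)
  then show ?thesis
    unfolding normal_inv_iff by (auto simp: normal_closure_def normal_inv_iff)
qed

lemma group_presented_group:
  assumes "R \<subseteq> carrier (free_group S)"
  shows "group (presented_group S R)"
  unfolding presented_group_def
  by (intro normal.factorgroup_is_group group.normal_closure_normal group_free_group assms)

end

theory Submission
  imports Defs "HOL-Library.Countable_Set" "HOL-Library.Z2" Complex_Main
begin

text \<open>If every finite index subgroup of \<open>G\<close> contains \<open>G'\<close>, then \<open>G\<close> is residually useless once it is
  non-abelian. Were \<open>G\<close> abelian, the Freiheitssatz (by Magnus's induction, with groups replaced by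
  permutation actions) would force the grid path spelled by the cyclically reduced relator to stay
  within height one and width one, so that it runs around a unit square \<open>k\<close> times; reflections
  exclude \<open>k \<noteq> 1\<close>.

  Otherwise \<open>G\<close> has a finite non-abelian quotient, on which \<open>u\<close> and \<open>v\<close> have at least two orbits. On
  each orbit the relator cells cover a torus and hence satisfy one linear relation. This redundancy
  yields first an integral character vanishing on loops \<open>u\<^sup>p\<close> and \<open>v\<^sup>q\<close> at some vertex, and then, on the infinite
  cyclic cover, a non-trivial mod 2 cocycle of finite support. On a long finite cyclic cover,
  labelling the crossings of a cut far away from that support by one of two free generators,
  according to the sheet of the double cover, defines a homomorphism onto a free group of rank
  two, in the spirit of Howie and Baumslag--Pride.\<close>

section \<open>Words acting by permutations\<close>

text \<open>The counting is governed by Euler characteristic zero. A cover of degree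
  \<open>n\<close> has \<open>n\<close> vertices, \<open>2 * n\<close> edges and \<open>n\<close>
  relator cells, so cochains counted against relators and coboundaries leave a surplus of one, which
  is too small. Because the relator is a commutator, the values of a cochain on the cells over a
  piece invariant under \<open>u\<close> and \<open>v\<close> sum to zero. Two such pieces save two
  equations and raise the surplus to three; two units are spent on making the character vanish on a
  power of \<open>u\<close> and of \<open>v\<close>. This vanishing keeps one orbit of
  \<open>u\<close> and \<open>v\<close> finite in the infinite cyclic cover, where an equation is
  then saved at each level and the surplus grows with the length of a window: hence the class of
  finite support. Over a cut off that support the double cover splits into two sheets, which provide
  two free generators instead of one. Dimension counts appear as pigeonhole counts of cochains with
  finitely many values. On the other side, the intersection of the finite index subgroups always
  lies in \<open>G'\<close>, because the relator has exponent sums zero and the abelianization is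
  free abelian of rank two; only the reverse inclusion is at stake.\<close>

fun act :: "('a \<Rightarrow> 'x \<Rightarrow> 'x) \<Rightarrow> 'a word \<Rightarrow> 'x \<Rightarrow> 'x" where
  "act \<sigma> [] x = x"
| "act \<sigma> (l # w) x = (if snd l then \<sigma> (fst l) else inv_into UNIV (\<sigma> (fst l))) (act \<sigma> w x)"

text \<open>The sum of the labels met along the path that spells \<open>w\<close> from right to left, starting at \<open>x\<close>.\<close>

fun psum :: "('a \<Rightarrow> 'x \<Rightarrow> 'x) \<Rightarrow> ('a \<Rightarrow> 'x \<Rightarrow> 'm::group_add) \<Rightarrow> 'a word \<Rightarrow> 'x \<Rightarrow> 'm" where
  "psum \<sigma> c [] x = 0"
| "psum \<sigma> c (l # w) x =
     (if snd l then c (fst l) (act \<sigma> w x) else - c (fst l) (inv_into UNIV (\<sigma> (fst l)) (act \<sigma> w x)))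
     + psum \<sigma> c w x"

definition perms :: "('a \<Rightarrow> 'x \<Rightarrow> 'x) \<Rightarrow> bool" where
  "perms \<sigma> \<longleftrightarrow> (\<forall>s. bij (\<sigma> s))"

lemma perms_inv [simp]:
  assumes "perms \<sigma>"
  shows "inv_into UNIV (\<sigma> s) (\<sigma> s x) = x" "\<sigma> s (inv_into UNIV (\<sigma> s) x) = x"
  using assms by (auto simp: perms_def bij_def surj_f_inv_f)

lemma permsI: "(\<And>s x. \<tau> s (\<sigma> s x) = x) \<Longrightarrow> (\<And>s x. \<sigma> s (\<tau> s x) = x) \<Longrightarrow> perms \<sigma>"
  unfolding perms_def by (metis bijI')

lemma act_append: "act \<sigma> (u @ v) x = act \<sigma> u (act \<sigma> v x)"
  by (induction u) auto

lemma psum_append: "psum \<sigma> c (u @ v) x = psum \<sigma> c u (act \<sigma> v x) + psum \<sigma> c v x"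
  by (induction u) (auto simp: act_append add.assoc)

lemma act_cons_reduce: "perms \<sigma> \<Longrightarrow> act \<sigma> (cons_reduce l w) x = act \<sigma> (l # w) x"
  by (cases w) (auto simp: inv_letter_def)

lemma psum_cons_reduce: "perms \<sigma> \<Longrightarrow> psum \<sigma> c (cons_reduce l w) x = psum \<sigma> c (l # w) x"
  by (cases w) (auto simp: inv_letter_def add.assoc[symmetric])

lemma act_reduce: "perms \<sigma> \<Longrightarrow> act \<sigma> (reduce w) x = act \<sigma> w x"
  by (induction w) (auto simp: reduce_def act_cons_reduce)

text \<open>Backtracking contributes nothing, so the label sum depends only on the homotopy class of
  the path. The order of summation is kept throughout, as the labels may lie in a non-commutative
  group.\<close>

lemma psum_reduce: "perms \<sigma> \<Longrightarrow> psum \<sigma> c (reduce w) x = psum \<sigma> c w x"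
proof (induction w)
  case (Cons l w)
  then show ?case
    using act_reduce[OF Cons.prems, of w] by (simp add: reduce_def psum_cons_reduce)
qed (simp add: reduce_def)

lemma inv_word_Nil [simp]: "inv_word [] = []"
  by (simp add: inv_word_def)

lemma inv_word_Cons: "inv_word (l # w) = inv_word w @ [inv_letter l]"
  by (simp add: inv_word_def)

lemma inv_word_inv_word [simp]: "inv_word (inv_word w) = w"
  by (simp add: inv_word_def rev_map o_def)

lemma act_inv_word1: "perms \<sigma> \<Longrightarrow> act \<sigma> (inv_word w) (act \<sigma> w x) = x"
  by (induction w arbitrary: x) (auto simp: inv_word_Cons act_append inv_letter_def)

lemma act_inv_word2: "perms \<sigma> \<Longrightarrow> act \<sigma> w (act \<sigma> (inv_word w) x) = x"
  using act_inv_word1[of \<sigma> "inv_word w"] by simp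

lemma psum_inv_word:
  assumes "perms \<sigma>"
  shows "psum \<sigma> c (inv_word w) (act \<sigma> w x) = - psum \<sigma> c w x"
proof -
  have "psum \<sigma> c (inv_word w @ w) x = 0"
    using psum_reduce[OF assms, of c "inv_word w @ w" x] by (simp add: reduce_inv_word)
  then show ?thesis by (simp add: psum_append eq_neg_iff_add_eq_0)
qed

lemma act_inj: "perms \<sigma> \<Longrightarrow> act \<sigma> w x = act \<sigma> w y \<longleftrightarrow> x = y"
  by (metis act_inv_word1)

lemma act_commute:
  assumes "perms \<sigma>" and "\<And>s x. \<tau> (\<sigma> s x) = \<sigma> s (\<tau> x)"
  shows "act \<sigma> w (\<tau> x) = \<tau> (act \<sigma> w x)"
proof (induction w)
  case (Cons l w)
  have "inv_into UNIV (\<sigma> s) (\<tau> y) = \<tau> (inv_into UNIV (\<sigma> s) y)" for s y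
    by (metis assms perms_inv)
  with Cons show ?case by (simp add: assms(2))
qed simp

lemma psum_translate:
  assumes "perms \<sigma>" and "\<And>s x. \<tau> (\<sigma> s x) = \<sigma> s (\<tau> x)"
  shows "psum \<sigma> c w (\<tau> x) = psum \<sigma> (\<lambda>s x. c s (\<tau> x)) w x"
proof (induction w)
  case (Cons l w)
  have "inv_into UNIV (\<sigma> s) (\<tau> y) = \<tau> (inv_into UNIV (\<sigma> s) y)" for s y
    by (metis assms(1,2) perms_inv)
  with Cons show ?case by (simp add: act_commute[OF assms(1,2)])
qed simp

lemma psum_coboundary:
  assumes "perms \<sigma>" and "\<And>s x. c s x = f (\<sigma> s x) - f x"
  shows "psum \<sigma> c w x = f (act \<sigma> w x) - f x"
proof (induction w)
  case (Cons l w)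
  then show ?case using assms(1) by (simp add: assms(2) algebra_simps)
qed simp

lemma psum_diff:
  fixes c d :: "'a \<Rightarrow> 'x \<Rightarrow> 'm::ab_group_add"
  shows "psum \<sigma> (\<lambda>s x. c s x - d s x) w x = psum \<sigma> c w x - psum \<sigma> d w x"
  by (induction w) (auto simp: algebra_simps)

lemma psum_bound:
  fixes c :: "'a \<Rightarrow> 'x \<Rightarrow> int"
  assumes "\<And>s x. \<bar>c s x\<bar> \<le> D"
  shows "\<bar>psum \<sigma> c w x\<bar> \<le> int (length w) * D"
proof (induction w)
  case (Cons l w)
  have "\<bar>if snd l then c (fst l) (act \<sigma> w x) else - c (fst l) (inv_into UNIV (\<sigma> (fst l)) (act \<sigma> w x))\<bar> \<le> D"
    using assms by auto
  with Cons show ?case by (simp add: algebra_simps split del: if_split)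
qed simp

lemma psum_cong:
  assumes "\<And>l p q. w = p @ l # q \<Longrightarrow>
    (if snd l then c (fst l) (act \<sigma> q x) else - c (fst l) (inv_into UNIV (\<sigma> (fst l)) (act \<sigma> q x))) =
    (if snd l then d (fst l) (act \<sigma> q x) else - d (fst l) (inv_into UNIV (\<sigma> (fst l)) (act \<sigma> q x)))"
  shows "psum \<sigma> c w x = psum \<sigma> d w x"
  using assms
proof (induction w)
  case (Cons l w)
  have "psum \<sigma> c w x = psum \<sigma> d w x"
    by (rule Cons.IH) (use Cons.prems[of "l # _"] in simp)
  with Cons.prems[of "[]" l w] show ?case by (simp split del: if_split)
qed simp

text \<open>In each orbit a base point \<open>rep\<close> and a path \<open>W x\<close> from it to
  every point \<open>x\<close> are chosen, and \<open>f x\<close> is the label sum along that path.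
  An edge closed up by the chosen paths to its two ends is a loop, and its zero sum is the required
  identity.\<close>

lemma coboundary_exists:
  fixes c :: "'a \<Rightarrow> 'x \<Rightarrow> 'm::group_add"
  assumes "perms \<sigma>" and closed: "\<And>w x. act \<sigma> w x = x \<Longrightarrow> psum \<sigma> c w x = 0"
  shows "\<exists>f. \<forall>s x. c s x = f (\<sigma> s x) - f x"
proof -
  define rel where "rel x y \<longleftrightarrow> (\<exists>w. act \<sigma> w x = y)" for x y
  define rep where "rep x = (SOME y. rel y x)" for x
  have rel_refl: "rel x x" for x by (auto simp: rel_def intro!: exI[of _ "[]"])
  have rel_step: "rel x (\<sigma> s y) \<longleftrightarrow> rel x y" for x y s
  proof
    assume "rel x y"
    then obtain w where "act \<sigma> w x = y" by (auto simp: rel_def)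
    then have "act \<sigma> ((s, True) # w) x = \<sigma> s y" by simp
    then show "rel x (\<sigma> s y)" unfolding rel_def by blast
  next
    assume "rel x (\<sigma> s y)"
    then obtain w where "act \<sigma> w x = \<sigma> s y" by (auto simp: rel_def)
    then have "act \<sigma> ((s, False) # w) x = y" using assms(1) by simp
    then show "rel x y" unfolding rel_def by blast
  qed
  have rep_step: "rep (\<sigma> s x) = rep x" for s x
    by (simp add: rep_def rel_step)
  define W where "W x = (SOME w. act \<sigma> w (rep x) = x)" for x
  have W: "act \<sigma> (W x) (rep x) = x" for x
  proof -
    have "rel (rep x) x" unfolding rep_def by (rule someI[of _ x]) (rule rel_refl)
    then show ?thesis unfolding rel_def W_def by (rule someI_ex)
  qed
  define f where "f x = psum \<sigma> c (W x) (rep x)" for x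
  have "c s x = f (\<sigma> s x) - f x" for s x
  proof -
    let ?w = "inv_word (W (\<sigma> s x)) @ (s, True) # W x"
    have 1: "act \<sigma> (W (\<sigma> s x)) (rep x) = \<sigma> s x" using W[of "\<sigma> s x"] by (simp add: rep_step)
    have "act \<sigma> (inv_word (W (\<sigma> s x))) (\<sigma> s x) = rep x"
      using act_inv_word1[OF assms(1), of "W (\<sigma> s x)" "rep x"] by (simp only: 1)
    then have "act \<sigma> ?w (rep x) = rep x" by (simp add: act_append W)
    then have "psum \<sigma> c ?w (rep x) = 0" by (rule closed)
    moreover have "psum \<sigma> c (inv_word (W (\<sigma> s x))) (\<sigma> s x) = - f (\<sigma> s x)"
      using psum_inv_word[OF assms(1), of c "W (\<sigma> s x)" "rep x"] 1 by (simp add: f_def rep_step)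
    ultimately have "- f (\<sigma> s x) + (c s x + f x) = 0"
      by (simp add: psum_append W f_def)
    then have "c s x + f x = f (\<sigma> s x)"
      by (metis add.inverse_inverse add_eq_0_iff)
    then show ?thesis by (simp add: eq_diff_eq)
  qed
  then show ?thesis by blast
qed

lemma reduced_Cons_iff:
  "reduced (x # w) \<longleftrightarrow> reduced w \<and> (w = [] \<or> hd w \<noteq> inv_letter x)"
  by (cases w) auto

lemma reduced_append_iff:
  "reduced (u @ v) \<longleftrightarrow>
     reduced u \<and> reduced v \<and> (u = [] \<or> v = [] \<or> hd v \<noteq> inv_letter (last u))"
  by (induction u) (auto simp: reduced_Cons_iff hd_append)

lemma last_inv_word: "w \<noteq> [] \<Longrightarrow> last (inv_word w) = inv_letter (hd w)"
  by (cases w) (auto simp: inv_word_Cons)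

lemma reduced_inv_word: "reduced w \<Longrightarrow> reduced (inv_word w)"
proof (induction w)
  case (Cons l w)
  then show ?case
    using last_inv_word[of w] by (cases "w = []") (auto simp: inv_word_Cons reduced_append_iff reduced_Cons_iff)
qed simp

lemma reduced_map:
  assumes "inj f"
  shows "reduced (map (map_prod f id) w) \<longleftrightarrow> reduced w"
proof (induction w)
  case (Cons x w)
  then show ?case using assms
    by (cases w) (auto simp: reduced_Cons_iff inv_letter_def map_prod_def prod_eq_iff inj_eq split_beta)
qed simp

lemma act_map: "act \<sigma> (map (map_prod f id) w) x = act (\<lambda>s. \<sigma> (f s)) w x"
  by (induction w) auto

section \<open>The free group as an additive group\<close>

text \<open>Labels summed by \<open>psum\<close> must lie in a type of class
  \<open>group_add\<close>. This type allows labels in a free group, the target of the final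
  homomorphism, and also serves as the set on which \<open>magnus_single\<close> lets the generators
  act.\<close>

typedef 'a fgrp = "{w :: 'a word. reduced w}"
  by (rule exI[of _ "[]"]) simp

setup_lifting type_definition_fgrp

instantiation fgrp :: (type) group_add
begin

lift_definition zero_fgrp :: "'a fgrp" is "[]" by simp
lift_definition plus_fgrp :: "'a fgrp \<Rightarrow> 'a fgrp \<Rightarrow> 'a fgrp" is "\<lambda>u v. reduce (u @ v)" by simp
lift_definition uminus_fgrp :: "'a fgrp \<Rightarrow> 'a fgrp" is inv_word by (rule reduced_inv_word)
definition minus_fgrp :: "'a fgrp \<Rightarrow> 'a fgrp \<Rightarrow> 'a fgrp" where "minus_fgrp x y = x + - y"

instance
proof
  fix a b c :: "'a fgrp"
  show "a + b + c = a + (b + c)"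
    by transfer (simp add: reduce_append_reduce reduce_append_reduce')
  show "0 + a = a" "a + 0 = a" by (transfer, simp add: reduce_id)+
  show "- a + a = 0" by transfer (simp add: reduce_inv_word)
  show "a + - b = a - b" by (simp add: minus_fgrp_def)
qed

end

lift_definition fgrp_of :: "'a word \<Rightarrow> 'a fgrp" is reduce by simp

lemma fgrp_of_append: "fgrp_of (u @ v) = fgrp_of u + fgrp_of v"
  by transfer (simp add: reduce_append_reduce reduce_append_reduce')

lemma fgrp_of_Nil [simp]: "fgrp_of [] = 0"
  by transfer (simp add: reduce_def)

lemma fgrp_of_inv: "fgrp_of (inv_word w) = - fgrp_of w"
proof -
  have "fgrp_of (inv_word w) + fgrp_of w = 0"
    unfolding fgrp_of_append[symmetric] by transfer (simp add: reduce_inv_word)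
  then show ?thesis by (simp add: eq_neg_iff_add_eq_0)
qed

lemma fgrp_of_eq_0: "reduced w \<Longrightarrow> fgrp_of w = 0 \<longleftrightarrow> w = []"
  by transfer (simp add: reduce_id)

lemma reduced_eqI:
  assumes "reduced u" "reduced v" "reduce (inv_word v @ u) = []"
  shows "u = v"
proof -
  have "- fgrp_of v + fgrp_of u = 0"
    using assms(3) unfolding fgrp_of_inv[symmetric] fgrp_of_append[symmetric] by transfer simp
  then have "fgrp_of u = fgrp_of v" by (metis neg_eq_iff_add_eq_0 add.inverse_inverse)
  then show ?thesis using assms(1,2) by transfer (simp add: reduce_id)
qed

instance fgrp :: (countable) countable
  by (rule countable_classI[of "\<lambda>x. to_nat (Rep_fgrp x)"]) (simp add: Rep_fgrp_inject)


section \<open>Free actions and conjugating permutations\<close>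

text \<open>Stronger than faithfulness: no point at all is fixed by a non-trivial reduced word over
  \<open>A\<close>. Hence every orbit is a copy of the free group on \<open>A\<close>, which is what
  makes two such actions comparable.\<close>

definition free_on :: "('a \<Rightarrow> 'x \<Rightarrow> 'x) \<Rightarrow> 'a set \<Rightarrow> bool" where
  "free_on \<sigma> A \<longleftrightarrow>
     (\<forall>w x. reduced w \<longrightarrow> w \<noteq> [] \<longrightarrow> fst ` set w \<subseteq> A \<longrightarrow> act \<sigma> w x \<noteq> x)"

definition words_over :: "'a set \<Rightarrow> 'a word set" where
  "words_over A = {w. reduced w \<and> fst ` set w \<subseteq> A}"

lemma words_over_Nil [simp]: "[] \<in> words_over A"
  by (simp add: words_over_def)

lemma words_over_mult:
  "u \<in> words_over A \<Longrightarrow> v \<in> words_over A \<Longrightarrow> reduce (inv_word u @ v) \<in> words_over A"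
  using reduce_letters[of "inv_word u @ v" A] by (simp add: words_over_def image_Un fst_set_inv_word)

lemma words_over_mult':
  "u \<in> words_over A \<Longrightarrow> v \<in> words_over A \<Longrightarrow> reduce (u @ v) \<in> words_over A"
  using reduce_letters[of "u @ v" A] by (simp add: words_over_def image_Un)

lemma words_over_inv: "u \<in> words_over A \<Longrightarrow> inv_word u \<in> words_over A"
  by (simp add: words_over_def fst_set_inv_word reduced_inv_word)

lemma bij_map_prod: "bij f \<Longrightarrow> bij g \<Longrightarrow> bij (map_prod f g)"
  using bij_betw_map_prod[of f UNIV UNIV g UNIV UNIV] by simp

lemma act_map_prod: "perms \<sigma> \<Longrightarrow> perms \<tau> \<Longrightarrow>
   act (\<lambda>s. map_prod (\<sigma> s) (\<tau> s)) w p = (act \<sigma> w (fst p), act \<tau> w (snd p))"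
proof (induction w)
  case (Cons l w)
  have bij: "bij (map_prod (\<sigma> s) (\<tau> s))" for s
    using Cons.prems unfolding perms_def by (simp add: bij_map_prod)
  have "inv_into UNIV (map_prod (\<sigma> s) (\<tau> s)) (x, y) = (inv_into UNIV (\<sigma> s) x, inv_into UNIV (\<tau> s) y)" for s x y
    by (rule inv_f_eq) (use bij Cons.prems in \<open>auto simp: bij_def\<close>)
  with Cons show ?case by auto
qed simp

lemma perms_map_prod: "perms \<sigma> \<Longrightarrow> perms \<tau> \<Longrightarrow> perms (\<lambda>s. map_prod (\<sigma> s) (\<tau> s))"
  unfolding perms_def by (simp add: bij_map_prod)

lemma perms_id [simp]: "perms (\<lambda>s. id)"
  by (simp add: perms_def)

lemma act_id [simp]: "act (\<lambda>s. id) w x = x"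
  by (induction w) auto

lemma act_map_prod_id:
  "perms \<sigma> \<Longrightarrow> act (\<lambda>s. map_prod (\<sigma> s) id) w p = (act \<sigma> w (fst p), snd p)"
  using act_map_prod[of \<sigma> "\<lambda>_. id" w p] by simp

lemma free_on_map_prod:
  assumes "perms \<sigma>" "perms \<tau>" "free_on \<sigma> A \<or> free_on \<tau> A"
  shows "free_on (\<lambda>s. map_prod (\<sigma> s) (\<tau> s)) A"
  using assms unfolding free_on_def by (auto simp: act_map_prod)

lemma free_on_subset: "free_on \<sigma> A \<Longrightarrow> B \<subseteq> A \<Longrightarrow> free_on \<sigma> B"
  unfolding free_on_def by blast

text \<open>Each orbit of a free action is identified with the reduced words over \<open>A\<close>
  once a base point is chosen. The extra factor \<open>nat\<close> makes the number of orbits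
  countably infinite whatever the given action was.\<close>

lemma free_action_coordinates:
  fixes \<sigma> :: "'a \<Rightarrow> 'x::countable \<Rightarrow> 'x"
  assumes \<sigma>: "perms \<sigma>" and free: "free_on \<sigma> A"
  shows "\<exists>r :: nat \<Rightarrow> 'x \<times> nat.
    bij_betw (\<lambda>(w, n). map_prod (act \<sigma> w) id (r n)) (words_over A \<times> UNIV) UNIV"
proof -
  define rel where "rel x y \<longleftrightarrow> (\<exists>w\<in>words_over A. act \<sigma> w x = y)" for x y
  have refl: "rel x x" for x unfolding rel_def by (rule bexI[of _ "[]"]) auto
  have sym: "rel y x" if "rel x y" for x y
    using that act_inv_word1[OF \<sigma>] words_over_inv unfolding rel_def by metis
  have trans: "rel x z" if "rel x y" "rel y z" for x y z
  proof -
    obtain u v where "u \<in> words_over A" "v \<in> words_over A" "act \<sigma> u x = y" "act \<sigma> v y = z"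
      using \<open>rel x y\<close> \<open>rel y z\<close> by (auto simp: rel_def)
    then show ?thesis unfolding rel_def
      by (intro bexI[of _ "reduce (v @ u)"]) (auto simp: act_reduce[OF \<sigma>] act_append words_over_mult')
  qed
  define rep where "rep x = (SOME y. rel y x)" for x
  have rep: "rel (rep x) x" for x unfolding rep_def by (rule someI[of _ x]) (rule refl)
  have rep_eq: "rep x = rep y" if "rel x y" for x y
  proof -
    have "(\<lambda>z. rel z x) = (\<lambda>z. rel z y)" using that sym trans by blast
    then show ?thesis unfolding rep_def by simp
  qed
  define I where "I = range rep \<times> (UNIV :: nat set)"
  have "infinite I" unfolding I_def by (simp add: finite_cartesian_product_iff)
  then have bijI: "bij_betw (from_nat_into I) UNIV I"
    by (intro bij_betw_from_nat_into) auto
  define \<Phi> where "\<Phi> = (\<lambda>(w, i). map_prod (act \<sigma> w) (id :: nat \<Rightarrow> nat) i)"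
  have "inj_on \<Phi> (words_over A \<times> I)"
  proof (rule inj_onI)
    fix p p' assume p: "p \<in> words_over A \<times> I" "p' \<in> words_over A \<times> I" and "\<Phi> p = \<Phi> p'"
    obtain w x m w' x' m' where pp: "p = (w, x, m)" "p' = (w', x', m')"
      by (metis prod.collapse)
    from p \<open>\<Phi> p = \<Phi> p'\<close> have w: "w \<in> words_over A" "w' \<in> words_over A"
      and I: "(x, m) \<in> I" "(x', m') \<in> I" and eq: "\<Phi> (w, x, m) = \<Phi> (w', x', m')"
      by (simp_all add: pp)
    from eq have m: "m = m'" and a: "act \<sigma> w x = act \<sigma> w' x'" by (auto simp: \<Phi>_def)
    have idem: "rep y = y" if "y \<in> range rep" for y
      using that rep_eq[OF rep] by auto
    have r: "rel x (act \<sigma> w x)" "rel x' (act \<sigma> w x)" using w a by (auto simp: rel_def)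
    have "rel x x'" by (rule trans[OF r(1) sym[OF r(2)]])
    have "x \<in> range rep" "x' \<in> range rep" using I by (auto simp: I_def)
    then have "rep x = x" "rep x' = x'" by (auto intro: idem)
    then have x: "x = x'" using rep_eq[OF \<open>rel x x'\<close>] by metis
    have "act \<sigma> (reduce (inv_word w' @ w)) x = x"
      using a x by (simp add: act_reduce[OF \<sigma>] act_append act_inv_word1[OF \<sigma>])
    moreover have "reduce (inv_word w' @ w) \<in> words_over A" using w by (intro words_over_mult)
    ultimately have "reduce (inv_word w' @ w) = []"
      using free unfolding free_on_def words_over_def by (metis mem_Collect_eq)
    then have "w = w'" using w by (simp add: words_over_def reduced_eqI)
    with x m show "p = p'" by (simp add: pp)
  qed
  moreover have "p \<in> \<Phi> ` (words_over A \<times> I)" for p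
  proof -
    obtain w where "w \<in> words_over A" "act \<sigma> w (rep (fst p)) = fst p"
      using rep[of "fst p"] by (auto simp: rel_def)
    then show ?thesis
      by (intro image_eqI[of _ _ "(w, rep (fst p), snd p)"]) (auto simp: \<Phi>_def I_def)
  qed
  ultimately have "bij_betw \<Phi> (words_over A \<times> I) UNIV" by (auto simp: bij_betw_def)
  moreover have "bij_betw (map_prod id (from_nat_into I)) (words_over A \<times> UNIV) (words_over A \<times> I)"
    using bijI by (intro bij_betw_map_prod) auto
  ultimately have "bij_betw (\<Phi> \<circ> map_prod id (from_nat_into I)) (words_over A \<times> UNIV) UNIV"
    by (rule bij_betw_trans[rotated])
  moreover have "\<Phi> \<circ> map_prod id (from_nat_into I) =
      (\<lambda>(w, n). map_prod (act \<sigma> w) id (from_nat_into I n))"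
    by (simp add: fun_eq_iff \<Phi>_def)
  ultimately show ?thesis by auto
qed

lemma map_cons_reduce:
  assumes "inj f"
  shows "map (map_prod f id) (cons_reduce l w) = cons_reduce (map_prod f id l) (map (map_prod f id) w)"
  using assms by (cases w) (auto simp: inv_letter_def map_prod_def prod_eq_iff inj_eq split_beta)

lemma words_over_image:
  assumes "inj f"
  shows "bij_betw (map (map_prod f id)) (words_over A) (words_over (f ` A))"
proof (rule bij_betw_imageI)
  have "inj (map_prod f (id :: bool \<Rightarrow> bool))" using assms by (simp add: prod.inj_map)
  then show "inj_on (map (map_prod f id)) (words_over A)"
    by (intro inj_on_subset[OF list.inj_map]) auto
  show "map (map_prod f id) ` words_over A = words_over (f ` A)"
  proof safe
    fix w assume "w \<in> words_over A"
    then show "map (map_prod f id) w \<in> words_over (f ` A)"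
      by (auto simp: words_over_def reduced_map[OF assms] image_image)
  next
    fix w assume w: "w \<in> words_over (f ` A)"
    define v where "v = map (map_prod (inv_into A f) id) w"
    have "f (inv_into A f (fst l)) = fst l" if "l \<in> set w" for l
      using w that by (intro f_inv_into_f) (auto simp: words_over_def)
    then have "map (map_prod f id) v = w"
      unfolding v_def by (auto simp: map_prod_def split_beta o_def intro!: map_idI)
    moreover have "v \<in> words_over A"
    proof -
      have "reduced v" using w \<open>map (map_prod f id) v = w\<close> reduced_map[OF assms, of v]
        by (simp add: words_over_def)
      moreover have "fst l \<in> f ` A" if "l \<in> set w" for l
        using w that by (auto simp: words_over_def)
      then have "fst ` set v \<subseteq> A"
        unfolding v_def by (auto intro!: inv_into_into)
      ultimately show ?thesis by (simp add: words_over_def)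
    qed
    ultimately show "w \<in> map (map_prod f id) ` words_over A" by blast
  qed
qed

text \<open>Two free actions of the same free group with countably infinitely many orbits are isomorphic.
  This replaces the embedding of a group into its HNN extension.\<close>

lemma conjugating_permutation:
  fixes \<sigma> :: "'a \<Rightarrow> 'x::countable \<Rightarrow> 'x"
  assumes \<sigma>: "perms \<sigma>" and "inj f" and "free_on \<sigma> A" and "free_on \<sigma> (f ` A)"
  obtains z :: "'x \<times> nat \<Rightarrow> 'x \<times> nat" where "bij z"
    and "\<And>a p. a \<in> A \<Longrightarrow> z (map_prod (\<sigma> a) id p) = map_prod (\<sigma> (f a)) id (z p)"
proof -
  obtain r1 :: "nat \<Rightarrow> 'x \<times> nat" where
    r1: "bij_betw (\<lambda>(w, n). map_prod (act \<sigma> w) id (r1 n)) (words_over A \<times> UNIV) UNIV"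
    using free_action_coordinates[OF \<sigma> assms(3)] by blast
  obtain r2 :: "nat \<Rightarrow> 'x \<times> nat" where
    r2: "bij_betw (\<lambda>(w, n). map_prod (act \<sigma> w) id (r2 n)) (words_over (f ` A) \<times> UNIV) UNIV"
    using free_action_coordinates[OF \<sigma> assms(4)] by blast
  define \<Phi>1 where "\<Phi>1 = (\<lambda>(w, n). map_prod (act \<sigma> w) id (r1 n))"
  define \<Phi>2 where "\<Phi>2 = (\<lambda>(w, n). map_prod (act \<sigma> w) id (r2 n))"
  define h where "h = map_prod (map (map_prod f (id :: bool \<Rightarrow> bool))) (id :: nat \<Rightarrow> nat)"
  have b1: "bij_betw \<Phi>1 (words_over A \<times> UNIV) UNIV" using r1 by (simp add: \<Phi>1_def)
  have b2: "bij_betw \<Phi>2 (words_over (f ` A) \<times> UNIV) UNIV" using r2 by (simp add: \<Phi>2_def)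
  have bh: "bij_betw h (words_over A \<times> UNIV) (words_over (f ` A) \<times> UNIV)"
    unfolding h_def by (intro bij_betw_map_prod words_over_image assms(2)) auto
  \<comment> \<open>Coordinates with respect to \<open>A\<close> are taken, the letters are renamed
    along \<open>f\<close>, and the result is read in coordinates with respect to the image of
    \<open>A\<close>.\<close>
  define z where "z = \<Phi>2 \<circ> (h \<circ> inv_into (words_over A \<times> UNIV) \<Phi>1)"
  have "bij z" unfolding z_def
    by (intro bij_betw_trans[OF bij_betw_trans[OF bij_betw_inv_into[OF b1] bh] b2])
  moreover have z_\<Phi>: "z (\<Phi>1 (w, n)) = \<Phi>2 (map (map_prod f id) w, n)" if "w \<in> words_over A" for w n
    using that b1 unfolding z_def by (simp add: h_def bij_betw_def)
  have "z (map_prod (\<sigma> a) id p) = map_prod (\<sigma> (f a)) id (z p)" if "a \<in> A" for a p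
  proof -
    obtain w n where w: "w \<in> words_over A" and p: "p = \<Phi>1 (w, n)"
    proof -
      have "p \<in> \<Phi>1 ` (words_over A \<times> UNIV)" using b1 by (simp add: bij_betw_def)
      then show ?thesis using that by auto
    qed
    have w': "cons_reduce (a, True) w \<in> words_over A"
      using w \<open>a \<in> A\<close> set_cons_reduce[of "(a, True)" w]
      by (force simp: words_over_def reduced_cons_reduce)
    have e1: "map_prod (\<sigma> a) id p = \<Phi>1 (cons_reduce (a, True) w, n)"
      by (cases "r1 n") (simp add: p \<Phi>1_def act_cons_reduce[OF \<sigma>])
    have "z (map_prod (\<sigma> a) id p) = \<Phi>2 (map (map_prod f id) (cons_reduce (a, True) w), n)"
      by (simp only: e1 z_\<Phi>[OF w'])
    moreover have "z p = \<Phi>2 (map (map_prod f id) w, n)" by (simp only: p z_\<Phi>[OF w])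
    ultimately show ?thesis
      by (cases "r2 n") (simp add: \<Phi>2_def map_cons_reduce[OF assms(2)] act_cons_reduce[OF \<sigma>])
  qed
  ultimately show thesis by (rule that)
qed

section \<open>Rewriting along a stable letter\<close>

definition zpow :: "('x \<Rightarrow> 'x) \<Rightarrow> int \<Rightarrow> 'x \<Rightarrow> 'x" where
  "zpow z i = (if i \<ge> 0 then z ^^ nat i else inv_into UNIV z ^^ nat (- i))"

lemma zpow_0 [simp]: "zpow z 0 x = x"
  by (simp add: zpow_def)

lemma zpow_Suc:
  assumes "bij z"
  shows "zpow z (1 + i) x = z (zpow z i x)"
proof (cases "i \<ge> 0")
  case True
  then have "nat (1 + i) = Suc (nat i)" by simp
  with True show ?thesis by (simp add: zpow_def)
next
  case False
  then have "nat (- i) = Suc (nat (- (1 + i)))" by simp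
  moreover have "z (inv_into UNIV z y) = y" for y
    using assms by (simp add: bij_def surj_f_inv_f)
  moreover from False have "1 + i = 0 \<or> \<not> 1 + i \<ge> 0" by auto
  ultimately show ?thesis using False by (auto simp: zpow_def)
qed

lemma zpow_add:
  assumes "bij z"
  shows "zpow z (i + j) x = zpow z i (zpow z j x)"
proof (induction i rule: int_induct[of _ 0])
  case (step1 i)
  then show ?case
    using zpow_Suc[OF assms, of "i + j" x] zpow_Suc[OF assms, of i "zpow z j x"] by (simp add: algebra_simps)
next
  case (step2 i)
  have "z (zpow z (i - 1 + j) x) = z (zpow z (i - 1) (zpow z j x))"
    using step2 zpow_Suc[OF assms, of "i - 1 + j" x] zpow_Suc[OF assms, of "i - 1"] by (simp add: algebra_simps)
  then show ?case using assms by (simp add: bij_def inj_eq)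
qed simp

lemma zpow_minus [simp]:
  assumes "bij z"
  shows "zpow z (- i) (zpow z i x) = x" "zpow z i (zpow z (- i) x) = x"
  using zpow_add[OF assms, of "- i" i x] zpow_add[OF assms, of i "- i" x] by auto

lemma bij_zpow: "bij z \<Longrightarrow> bij (zpow z i)"
  by (rule o_bij[of "zpow z (- i)"]) (auto simp: fun_eq_iff)

lemma zpow_1: "bij z \<Longrightarrow> zpow z 1 x = z x"
  using zpow_Suc[of z 0 x] by simp

definition weight :: "('a \<Rightarrow> int) \<Rightarrow> 'a word \<Rightarrow> int" where
  "weight \<omega> w = (\<Sum>l\<leftarrow>w. if snd l then \<omega> (fst l) else - \<omega> (fst l))"

lemma weight_simps [simp]:
  "weight \<omega> [] = 0"
  "weight \<omega> (l # w) = (if snd l then \<omega> (fst l) else - \<omega> (fst l)) + weight \<omega> w"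
  "weight \<omega> (u @ v) = weight \<omega> u + weight \<omega> v"
  by (simp_all add: weight_def)

lemma weight_linear:
  "weight (\<lambda>s. a * f s + b * g s) w = a * weight f w + b * weight g w"
  by (induction w) (auto simp: algebra_simps)

lemma weight_inv_word: "weight f (inv_word w) = - weight f w"
  by (induction w) (auto simp: inv_word_Cons inv_letter_def)

text \<open>The letter \<open>(s, i)\<close> stands for the conjugate of \<open>s\<close> by the \<open>i\<close>-th power of a stable letter of
  which the generator \<open>t\<close> is a power; every generator \<open>s\<close> moves the level by \<open>\<omega> s\<close>.\<close>

fun rew :: "('a \<Rightarrow> int) \<Rightarrow> 'a \<Rightarrow> int \<Rightarrow> 'a word \<Rightarrow> ('a \<times> int) word" where
  "rew \<omega> t k [] = []"
| "rew \<omega> t k ((s, e) # w) =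
     (let k' = (if e then k + \<omega> s else k - \<omega> s) in
      if s = t then rew \<omega> t k' w else ((s, if e then k else k'), e) # rew \<omega> t k' w)"

lemma rew_append: "rew \<omega> t k (u @ v) = rew \<omega> t k u @ rew \<omega> t (k + weight \<omega> u) v"
  by (induction \<omega> t k u rule: rew.induct) (auto simp: Let_def algebra_simps)

lemma set_rew: "fst ` fst ` set (rew \<omega> t k w) = fst ` set w - {t}"
  by (induction \<omega> t k w rule: rew.induct) (auto simp: Let_def)

lemma length_rew: "length (rew \<omega> t k w) = length (filter (\<lambda>l. fst l \<noteq> t) w)"
  by (induction \<omega> t k w rule: rew.induct) (auto simp: Let_def)

lemma length_rew_less:
  assumes "t \<in> fst ` set w"
  shows "length (rew \<omega> t k w) < length w"
proof -
  obtain l where "l \<in> set w" "fst l = t" using assms by auto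
  then show ?thesis unfolding length_rew by (intro length_filter_less) auto
qed

text \<open>All powers of \<open>z\<close> are pushed to the right: a letter read at level
  \<open>k\<close> leaves a conjugate \<open>h\<close> behind and changes the level by its weight.
  For an inverse letter the power of \<open>z\<close> stands to the left of the inverse of
  \<open>\<tau> s\<close>, so the conjugate belongs to the new level \<open>k'\<close> of
  \<open>rew\<close>.\<close>

lemma act_rew:
  fixes z :: "'x \<Rightarrow> 'x"
  assumes z: "bij z" and \<tau>: "perms \<tau>" and
    \<rho>: "\<And>s x. \<rho> s x = (if s = t then zpow z (\<omega> t) x else \<tau> s (zpow z (\<omega> s) x))" and
    h: "\<And>s i x. h (s, i) x = zpow z i (\<tau> s (zpow z (- i) x))"
  shows "zpow z k (act \<rho> w x) = act h (rew \<omega> t k w) (zpow z (k + weight \<omega> w) x)"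
proof (induction w arbitrary: k)
  case (Cons l w)
  obtain s e where l: "l = (s, e)" by (cases l)
  have inv: "inv_into UNIV f y = x" if "bij f" "f x = y" for f :: "'x \<Rightarrow> 'x" and x y
    using that by (metis bij_inv_eq_iff)
  have bij\<tau>: "bij (\<tau> s)" for s using \<tau> by (simp add: perms_def)
  define y where "y = act \<rho> w x"
  note IH = Cons.IH[folded y_def]
  have add: "zpow z i (zpow z j q) = zpow z (i + j) q" for i j q
    by (simp add: zpow_add[OF z])
  have bijh: "bij (h (s, i))" for i
    by (rule o_bij[of "\<lambda>x. zpow z i (inv_into UNIV (\<tau> s) (zpow z (- i) x))"])
      (use \<tau> in \<open>auto simp: h fun_eq_iff z\<close>)
  have bij\<rho>: "bij (\<rho> s)"
    by (rule o_bij[of "\<lambda>x. if s = t then zpow z (- \<omega> t) x else zpow z (- \<omega> s) (inv_into UNIV (\<tau> s) x)"])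
      (use \<tau> in \<open>auto simp: \<rho> fun_eq_iff z\<close>)
  have e1: "act h (rew \<omega> t (k + i) w) (zpow z (k + (i + weight \<omega> w)) x) = zpow z (k + i) y" for i
    using IH[of "k + i"] by (simp add: add.assoc)
  have e2: "act h (rew \<omega> t (k - i) w) (zpow z (k + (weight \<omega> w - i)) x) = zpow z (k - i) y" for i
    using IH[of "k - i"] by (simp add: algebra_simps)
  have lhs: "act \<rho> (l # w) x = (if e then \<rho> s y else inv_into UNIV (\<rho> s) y)"
    by (simp add: l y_def)
  show ?case unfolding lhs
  proof (cases e)
    case True
    then show "zpow z k (if e then \<rho> s y else inv_into UNIV (\<rho> s) y) =
        act h (rew \<omega> t k (l # w)) (zpow z (k + weight \<omega> (l # w)) x)"
      by (simp add: l \<rho> h add e1 Let_def z)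
  next
    case False
    have "inv_into UNIV (\<rho> s) y = (if s = t then zpow z (- \<omega> t) y else zpow z (- \<omega> s) (inv_into UNIV (\<tau> s) y))"
      by (rule inv[OF bij\<rho>]) (use \<tau> in \<open>auto simp: \<rho> z\<close>)
    moreover have "inv_into UNIV (h (s, i)) (zpow z i y) = zpow z i (inv_into UNIV (\<tau> s) y)" for i
      by (rule inv[OF bijh]) (use \<tau> in \<open>auto simp: h z\<close>)
    ultimately show "zpow z k (if e then \<rho> s y else inv_into UNIV (\<rho> s) y) =
        act h (rew \<omega> t k (l # w)) (zpow z (k + weight \<omega> (l # w)) x)"
      using False by (simp add: l add e2 Let_def z)
  qed
qed simp

lemma reduced_single:
  assumes "reduced w" and "fst ` set w \<subseteq> {t}"
  shows "\<exists>e. w = replicate (length w) (t, e)"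
  using assms
proof (induction w)
  case (Cons l w)
  then obtain e where w: "w = replicate (length w) (t, e)" by (auto simp: reduced_Cons_iff)
  show ?case
  proof (cases "w = []")
    case False
    then have "hd w = (t, e)" using w by (metis hd_replicate length_0_conv)
    moreover have "hd w \<noteq> inv_letter l" using Cons.prems(1) False by (simp add: reduced_Cons_iff)
    ultimately have "l = (t, e)" using Cons.prems(2) by (cases l) (auto simp: inv_letter_def)
    then show ?thesis using w by (intro exI[of _ e]) simp
  qed (use Cons.prems in \<open>auto intro!: exI[of _ "snd l"]\<close>)
qed simp

lemma weight_replicate: "weight \<omega> (replicate n (t, e)) = int n * (if e then \<omega> t else - \<omega> t)"
  by (induction n) (auto simp: algebra_simps)

lemma weight_single:
  assumes "reduced w" and "fst ` set w \<subseteq> {t}" and "w \<noteq> []" and "\<omega> t \<noteq> 0"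
  shows "weight \<omega> w \<noteq> 0"
proof -
  obtain e where "w = replicate (length w) (t, e)" using reduced_single[OF assms(1,2)] by blast
  then have "weight \<omega> w = int (length w) * (if e then \<omega> t else - \<omega> t)"
    using weight_replicate[of \<omega> "length w" t e] by simp
  then show ?thesis using assms(3,4) by simp
qed

lemma rew_eq_Nil: "rew \<omega> t k w = [] \<longleftrightarrow> fst ` set w \<subseteq> {t}"
  using set_rew[of \<omega> t k w] by (metis Diff_eq_empty_iff image_is_empty set_empty)

text \<open>The last hypothesis says that the first surviving letter was read at level
  \<open>k\<close>, so the powers of \<open>t\<close> deleted before it have weight zero. As
  \<open>w\<close> is reduced and \<open>\<omega> t\<close> is non-zero, nothing was deleted
  there.\<close>

lemma rew_hd:
  assumes "reduced w" and "\<omega> t \<noteq> 0" and "rew \<omega> t k w = ((s, i), e) # v"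
    and "i + (if e then 0 else \<omega> s) = k"
  shows "\<exists>w'. w = (s, e) # w'"
proof -
  define p where "p = takeWhile (\<lambda>l. fst l = t) w"
  define q where "q = dropWhile (\<lambda>l. fst l = t) w"
  have w: "w = p @ q" by (simp add: p_def q_def)
  have pt: "fst ` set p \<subseteq> {t}" unfolding p_def by (auto dest: set_takeWhileD)
  then have p0: "rew \<omega> t k p = []" by (simp add: rew_eq_Nil)
  then have "q \<noteq> []" using assms(3) w by (auto simp: rew_append)
  moreover have "fst (hd q) \<noteq> t"
    using hd_dropWhile[of "\<lambda>l. fst l = t" w] \<open>q \<noteq> []\<close> by (simp add: q_def)
  ultimately obtain s' e' q' where q: "q = (s', e') # q'" "s' \<noteq> t"
    by (intro that[of "fst (hd q)" "snd (hd q)" "tl q"]) simp_all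
  then have eq: "s' = s" "e' = e" "i + (if e then 0 else \<omega> s) = k + weight \<omega> p"
    using assms(3) p0 by (auto simp: w rew_append Let_def split: if_splits)
  then have "weight \<omega> p = 0" using assms(4) by simp
  then have "p = []"
    using weight_single[OF _ pt, of \<omega>] assms(1,2) w by (auto simp: reduced_append_iff)
  then show ?thesis using w q eq by simp
qed

text \<open>A cancelling pair in the rewritten word would consist of letters at matching levels. By
  \<open>rew_hd\<close> no power of \<open>t\<close> lay between them, so they would already cancel
  in \<open>w\<close>.\<close>

lemma reduced_rew:
  assumes "reduced w" and "\<omega> t \<noteq> 0"
  shows "reduced (rew \<omega> t k w)"
  using assms
proof (induction w arbitrary: k)
  case (Cons l w)
  obtain s e where l: "l = (s, e)" by (cases l)
  have w: "reduced w" using Cons.prems(1) by (simp add: reduced_Cons_iff)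
  define k' where "k' = (if e then k + \<omega> s else k - \<omega> s)"
  have IH: "reduced (rew \<omega> t k' w)" using Cons w by blast
  show ?case
  proof (cases "s = t")
    case False
    have "hd (rew \<omega> t k' w) \<noteq> inv_letter ((s, if e then k else k'), e)" if ne: "rew \<omega> t k' w \<noteq> []"
    proof
      assume "hd (rew \<omega> t k' w) = inv_letter ((s, if e then k else k'), e)"
      then have eq: "rew \<omega> t k' w = ((s, if e then k else k'), \<not> e) # tl (rew \<omega> t k' w)"
        using ne by (cases "rew \<omega> t k' w") (auto simp: inv_letter_def)
      obtain w' where "w = (s, \<not> e) # w'"
        using rew_hd[OF w Cons.prems(2) eq] by (cases e) (auto simp: k'_def)
      then show False using Cons.prems(1) by (simp add: l inv_letter_def)
    qed
    moreover have "rew \<omega> t k (l # w) = ((s, if e then k else k'), e) # rew \<omega> t k' w"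
      using False by (simp add: l k'_def Let_def)
    ultimately show ?thesis using IH by (simp only: reduced_Cons_iff) blast
  qed (use IH in \<open>simp add: l k'_def split: if_splits\<close>)
qed simp

section \<open>The Freiheitssatz\<close>

lemma act_cong:
  assumes "\<And>s x. s \<in> fst ` set w \<Longrightarrow> \<sigma> s x = \<tau> s x"
  shows "act \<sigma> w x = act \<tau> w x"
  using assms
proof (induction w)
  case (Cons l w)
  have "\<sigma> (fst l) = \<tau> (fst l)" by (rule ext) (simp add: Cons.prems)
  with Cons show ?case by simp
qed simp

text \<open>An HNN extension in terms of permutations: \<open>z\<close> is the stable letter,
  raising levels by one. Only \<open>y\<close> has a bounded window of levels. Freeness off its top
  level and off its bottom level says that both associated subgroups are free on the evident
  letters, so a permutation conjugates one to the other.\<close>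

lemma level_extension:
  fixes \<sigma> :: "'s \<times> int \<Rightarrow> 'x::countable \<Rightarrow> 'x"
  assumes \<sigma>: "perms \<sigma>" and free: "free_on \<sigma> (- {(y, M)})" "free_on \<sigma> (- {(y, \<mu>)})"
  obtains z :: "'x \<times> nat \<Rightarrow> 'x \<times> nat" and \<tau> where "bij z" and "perms \<tau>" and
    "\<And>s i p. s \<noteq> y \<or> \<mu> \<le> i \<and> i \<le> M \<Longrightarrow>
       zpow z i (\<tau> s (zpow z (- i) p)) = map_prod (\<sigma> (s, i)) id p"
proof -
  define A where "A = {(s, i). s \<noteq> y \<or> \<mu> \<le> i \<and> i < M}"
  define f where "f = (\<lambda>(s :: 's, i :: int). (s, i + 1))"
  have "inj f" by (auto simp: inj_def f_def)
  have "free_on \<sigma> A" by (rule free_on_subset[OF free(1)]) (auto simp: A_def)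
  moreover have "free_on \<sigma> (f ` A)"
    by (rule free_on_subset[OF free(2)]) (auto simp: A_def f_def)
  ultimately obtain z :: "'x \<times> nat \<Rightarrow> 'x \<times> nat" where z: "bij z"
    and conj: "\<And>a p. a \<in> A \<Longrightarrow> z (map_prod (\<sigma> a) id p) = map_prod (\<sigma> (f a)) id (z p)"
    using conjugating_permutation[OF \<sigma> \<open>inj f\<close>] by blast
  define g where "g s i = map_prod (\<sigma> (s, i)) (id :: nat \<Rightarrow> nat)" for s i
  have step: "z (g s i p) = g s (i + 1) (z p)" if "s \<noteq> y \<or> \<mu> \<le> i \<and> i < M" for s i p
    using conj[of "(s, i)" p] that by (simp add: A_def g_def f_def)
  have bij_g: "bij (g s i)" for s i
    using \<sigma> unfolding g_def perms_def by (simp add: bij_map_prod)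
  have up: "zpow z (int n) (g s i (zpow z (- int n) p)) = g s (i + int n) p"
    if "s \<noteq> y \<or> \<mu> \<le> i \<and> i + int n \<le> M" for s i n p
    using that
  proof (induction n arbitrary: p)
    case (Suc n)
    have "zpow z (int (Suc n)) (g s i (zpow z (- int (Suc n)) p)) =
        z (zpow z (int n) (g s i (zpow z (- int n) (zpow z (- 1) p))))"
      using zpow_Suc[OF z, of "int n"] zpow_add[OF z, of "- int n" "- 1"] by (simp add: algebra_simps)
    also have "\<dots> = z (g s (i + int n) (zpow z (- 1) p))"
      by (subst Suc.IH) (use Suc.prems in auto)
    also have "\<dots> = g s (i + int n + 1) (z (zpow z (- 1) p))"
      using Suc.prems by (intro step) auto
    also have "z (zpow z (- 1) p) = p"
      using zpow_minus(2)[OF z, of 1] by (simp add: zpow_1[OF z])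
    finally show ?case by (simp add: add_ac)
  qed simp
  \<comment> \<open>Base levels: the lowest admissible one for \<open>y\<close>, and 0 for the other
    generators, all of whose levels are admissible.\<close>
  define b where "b s = (if s = y then \<mu> else 0)" for s
  define \<tau> where "\<tau> s p = zpow z (- b s) (g s (b s) (zpow z (b s) p))" for s p
  have "perms \<tau>" unfolding perms_def
  proof
    fix s
    have "\<tau> s = zpow z (- b s) \<circ> (g s (b s) \<circ> zpow z (b s))" by (simp add: fun_eq_iff \<tau>_def)
    then show "bij (\<tau> s)" by (simp only: bij_comp bij_zpow[OF z] bij_g)
  qed
  moreover have "zpow z i (\<tau> s (zpow z (- i) p)) = g s i p" if "s \<noteq> y \<or> \<mu> \<le> i \<and> i \<le> M" for s i p
  proof -
    have e: "zpow z i (\<tau> s (zpow z (- i) p)) = zpow z (i - b s) (g s (b s) (zpow z (- (i - b s)) p))"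
      using zpow_add[OF z, of i "- b s"] zpow_add[OF z, of "b s" "- i"] by (simp add: \<tau>_def)
    show ?thesis
    proof (cases "i \<ge> b s")
      case True
      then show ?thesis
        using up[of s "b s" "nat (i - b s)"] that unfolding e by (auto simp: b_def)
    next
      case False
      then have s: "s \<noteq> y" using that by (auto simp: b_def)
      define n where "n = nat (b s - i)"
      have n: "int n = b s - i" using False by (simp add: n_def)
      have "zpow z (int n) (g s i (zpow z (- int n) q)) = g s (b s) q" for q
        using up[of s i n q] s n by simp
      from this[of "zpow z (int n) p"] show ?thesis unfolding e
        using n z by (metis (no_types, lifting) minus_diff_eq zpow_minus(1))
    qed
  qed
  ultimately show thesis using that[OF z] by (simp add: g_def)
qed

text \<open>The Freiheitssatz in terms of actions: the relator acts trivially while the generators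
  other than \<open>x\<close> act freely. The set \<open>nat\<close> is fixed so that the property
  can be stated without quantifying over types; \<open>magnusI\<close> imports actions on any
  countably infinite set.\<close>

definition magnus :: "'a word \<Rightarrow> 'a \<Rightarrow> bool" where
  "magnus r x \<longleftrightarrow> (\<exists>\<sigma> :: 'a \<Rightarrow> nat \<Rightarrow> nat. perms \<sigma> \<and> (\<forall>n. act \<sigma> r n = n) \<and> free_on \<sigma> (- {x}))"

lemma act_conj:
  assumes "bij g" and "perms \<sigma>"
  shows "perms (\<lambda>s n. g (\<sigma> s (inv_into UNIV g n)))"
    and "act (\<lambda>s n. g (\<sigma> s (inv_into UNIV g n))) w (g x) = g (act \<sigma> w x)"
proof -
  have [simp]: "inv_into UNIV g (g x) = x" "g (inv_into UNIV g y) = y" for x y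
    using assms(1) by (auto simp: bij_def surj_f_inv_f)
  have o: "inv_into UNIV (\<lambda>n. g (\<sigma> s (inv_into UNIV g n))) = (\<lambda>n. g (inv_into UNIV (\<sigma> s) (inv_into UNIV g n)))" for s
    by (rule inv_unique_comp) (use assms(2) in \<open>auto simp: fun_eq_iff\<close>)
  show "perms (\<lambda>s n. g (\<sigma> s (inv_into UNIV g n)))"
    by (rule permsI[of "\<lambda>s n. g (inv_into UNIV (\<sigma> s) (inv_into UNIV g n))"])
      (use assms(2) in auto)
  show "act (\<lambda>s n. g (\<sigma> s (inv_into UNIV g n))) w (g x) = g (act \<sigma> w x)"
    by (induction w) (auto simp: o)
qed

lemma magnusI:
  fixes \<sigma> :: "'a \<Rightarrow> 'y::countable \<Rightarrow> 'y"
  assumes "infinite (UNIV :: 'y set)" and \<sigma>: "perms \<sigma>" and "\<And>p. act \<sigma> r p = p" and "free_on \<sigma> (- {x})"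
  shows "magnus r x"
proof -
  let ?g = "to_nat_on (UNIV :: 'y set)"
  have g: "bij ?g" using assms(1) by (intro to_nat_on_infinite) auto
  define \<sigma>' where "\<sigma>' = (\<lambda>s n. ?g (\<sigma> s (inv_into UNIV ?g n)))"
  have "\<exists>p. n = ?g p" for n using g by (metis bij_pointE)
  moreover have "act \<sigma>' w (?g p) = ?g (act \<sigma> w p)" for w p
    unfolding \<sigma>'_def by (rule act_conj(2)[OF g \<sigma>])
  moreover have "?g p = ?g q \<longleftrightarrow> p = q" for p q using g by (simp add: bij_def inj_eq)
  ultimately have "\<forall>n. act \<sigma>' r n = n" "free_on \<sigma>' (- {x})"
    using assms(3,4) unfolding free_on_def by metis+
  moreover have "perms \<sigma>'" unfolding \<sigma>'_def by (rule act_conj(1)[OF g \<sigma>])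
  ultimately show ?thesis unfolding magnus_def by blast
qed

lemma magnus_map:
  assumes "inj f" and "magnus (map (map_prod f id) r) (f x)"
  shows "magnus r x"
proof -
  obtain \<sigma> :: "_ \<Rightarrow> nat \<Rightarrow> nat" where \<sigma>: "perms \<sigma>" "\<And>n. act \<sigma> (map (map_prod f id) r) n = n"
    and free: "free_on \<sigma> (- {f x})" using assms(2) by (auto simp: magnus_def)
  have "free_on (\<lambda>s. \<sigma> (f s)) (- {x})" unfolding free_on_def
  proof (intro allI impI)
    fix w n assume w: "reduced w" "w \<noteq> []" "fst ` set w \<subseteq> - {x}"
    have "fst ` set (map (map_prod f id) w) \<subseteq> - {f x}"
      using w(3) \<open>inj f\<close> by (force simp: inj_eq)
    then show "act (\<lambda>s. \<sigma> (f s)) w n \<noteq> n"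
      using free w reduced_map[OF \<open>inj f\<close>] unfolding free_on_def act_map[symmetric] by blast
  qed
  then show ?thesis unfolding magnus_def
    using \<sigma> by (intro exI[of _ "\<lambda>s. \<sigma> (f s)"]) (auto simp: act_map perms_def)
qed

lemma magnus_conj:
  assumes "magnus (v @ u) x"
  shows "magnus (u @ v) x"
proof -
  obtain \<sigma> :: "_ \<Rightarrow> nat \<Rightarrow> nat" where \<sigma>: "perms \<sigma>" "\<And>n. act \<sigma> (v @ u) n = n"
    and free: "free_on \<sigma> (- {x})" using assms by (auto simp: magnus_def)
  have "act \<sigma> (u @ v) n = n" for n
    using \<sigma>(2)[of "act \<sigma> v n"] act_inj[OF \<sigma>(1), of v] by (simp add: act_append)
  then show ?thesis using \<sigma>(1) free unfolding magnus_def by blast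
qed

text \<open>Base case of the induction: \<open>x\<close> acts trivially, the other generators by
  left translation on a free group.\<close>

lemma magnus_single:
  fixes r :: "'a::countable word"
  assumes "fst ` set r \<subseteq> {x}"
  shows "magnus r x"
proof -
  define \<sigma> :: "'a \<Rightarrow> 'a fgrp \<Rightarrow> 'a fgrp" where "\<sigma> s g = (if s = x then g else fgrp_of [(s, True)] + g)" for s g
  have inv: "fgrp_of [(s, False)] = - fgrp_of [(s, True)]" for s :: 'a
    using fgrp_of_inv[of "[(s, True)]"] by (simp add: inv_word_def inv_letter_def)
  have \<sigma>: "perms \<sigma>"
    by (rule permsI[of "\<lambda>s g. if s = x then g else fgrp_of [(s, False)] + g"])
      (auto simp: \<sigma>_def inv add.assoc[symmetric])
  have x: "act \<sigma> w g = g" if "fst ` set w \<subseteq> {x}" for w g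
    using that
  proof (induction w)
    case (Cons l w)
    have "\<sigma> x = id" by (simp add: \<sigma>_def fun_eq_iff)
    with Cons show ?case by simp
  qed simp
  have "act \<sigma> w g = fgrp_of w + g" if "x \<notin> fst ` set w" for w g
    using that
  proof (induction w)
    case (Cons l w)
    have step: "\<sigma> s h = fgrp_of [(s, True)] + h" if "s \<noteq> x" for s h
      using that by (simp add: \<sigma>_def)
    have "inv_into UNIV (\<sigma> s) h = fgrp_of [(s, False)] + h" if "s \<noteq> x" for s h
      by (rule inv_f_eq) (use \<sigma> that in \<open>auto simp: perms_def bij_def \<sigma>_def inv add.assoc[symmetric]\<close>)
    then have "act \<sigma> (l # w) g = fgrp_of [l] + (fgrp_of w + g)"
      using Cons step by (cases l) auto
    then show ?case using fgrp_of_append[of "[l]" w] by (simp add: add.assoc)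
  qed simp
  then have free: "free_on \<sigma> (- {x})"
    unfolding free_on_def
  proof (intro allI impI)
    fix w g assume "reduced w" "w \<noteq> []" "fst ` set w \<subseteq> - {x}"
    moreover from this have "x \<notin> fst ` set w" by blast
    ultimately show "act \<sigma> w g \<noteq> g"
      using fgrp_of_eq_0[of w] \<open>\<And>w g. x \<notin> fst ` set w \<Longrightarrow> act \<sigma> w g = fgrp_of w + g\<close>
      by (metis add_0_left add_right_cancel)
  qed
  show ?thesis
  proof (rule magnusI)
    show "infinite (UNIV :: ('a fgrp \<times> nat) set)" by (simp add: finite_prod)
    show "perms (\<lambda>s. map_prod (\<sigma> s) id)" using perms_map_prod[OF \<sigma> perms_id] .
    show "act (\<lambda>s. map_prod (\<sigma> s) id) r p = p" for p
      by (simp add: act_map_prod_id[OF \<sigma>] x[OF assms])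
    show "free_on (\<lambda>s. map_prod (\<sigma> s) id) (- {x})"
      by (rule free_on_map_prod[OF \<sigma> perms_id]) (simp add: free)
  qed
qed

text \<open>Passage from an action for the rewritten relator to one for \<open>r\<close>. The last
  conclusion is the device for reading off freeness: on words of weight zero whose
  \<open>y\<close>-levels lie in the window, the new action is the old one applied to the rewritten
  word.\<close>

lemma stable_letter:
  fixes r :: "'a word" and \<sigma> :: "'a \<times> int \<Rightarrow> 'x::countable \<Rightarrow> 'x"
  assumes \<sigma>: "perms \<sigma>" and rel: "\<And>p. act \<sigma> (rew \<omega> t 0 r) p = p" and wr: "weight \<omega> r = 0"
    and free: "free_on \<sigma> (- {(y, M)})" "free_on \<sigma> (- {(y, \<mu>)})"
    and range: "\<And>i. (y, i) \<in> fst ` set (rew \<omega> t 0 r) \<Longrightarrow> \<mu> \<le> i \<and> i \<le> M"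
  obtains \<rho> :: "'a \<Rightarrow> 'x \<times> nat \<Rightarrow> 'x \<times> nat" where "perms \<rho>" and "\<And>p. act \<rho> r p = p"
    and "\<And>w p. weight \<omega> w = 0 \<Longrightarrow>
      (\<And>i. (y, i) \<in> fst ` set (rew \<omega> t 0 w) \<Longrightarrow> \<mu> \<le> i \<and> i \<le> M) \<Longrightarrow>
      act \<rho> w p = (act \<sigma> (rew \<omega> t 0 w) (fst p), snd p)"
proof -
  obtain z :: "'x \<times> nat \<Rightarrow> 'x \<times> nat" and \<tau> where z: "bij z" and \<tau>: "perms \<tau>" and
    ext: "\<And>s i p. s \<noteq> y \<or> \<mu> \<le> i \<and> i \<le> M \<Longrightarrow>
       zpow z i (\<tau> s (zpow z (- i) p)) = map_prod (\<sigma> (s, i)) id p"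
    using level_extension[OF \<sigma> free] by blast
  define \<rho> where "\<rho> s p = (if s = t then zpow z (\<omega> t) p else \<tau> s (zpow z (\<omega> s) p))" for s p
  define h where "h = (\<lambda>(s, i) p. zpow z i (\<tau> s (zpow z (- i) p)))"
  have \<rho>: "perms \<rho>"
    by (rule permsI[of "\<lambda>s p. if s = t then zpow z (- \<omega> t) p else zpow z (- \<omega> s) (inv_into UNIV (\<tau> s) p)"])
      (use \<tau> z in \<open>auto simp: \<rho>_def\<close>)
  have main: "act \<rho> w p = (act \<sigma> (rew \<omega> t 0 w) (fst p), snd p)"
    if "weight \<omega> w = 0" "\<And>i. (y, i) \<in> fst ` set (rew \<omega> t 0 w) \<Longrightarrow> \<mu> \<le> i \<and> i \<le> M" for w p
  proof -
    have "act \<rho> w p = act h (rew \<omega> t 0 w) p"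
      using act_rew[OF z \<tau>, of \<rho> t \<omega> h 0 w p] that(1) by (simp add: \<rho>_def h_def)
    also have "\<dots> = act (\<lambda>s. map_prod (\<sigma> s) id) (rew \<omega> t 0 w) p"
    proof (rule act_cong)
      fix s p assume s: "s \<in> fst ` set (rew \<omega> t 0 w)"
      obtain s' i where "s = (s', i)" by (cases s)
      then show "h s p = map_prod (\<sigma> s) id p"
        using that(2)[of i] s ext[of s' i p] by (cases "s' = y") (auto simp: h_def)
    qed
    finally show ?thesis by (simp add: act_map_prod_id[OF \<sigma>])
  qed
  have "act \<rho> r p = p" for p using main[OF wr range] rel by simp
  with \<rho> show thesis using main by (rule that)
qed

text \<open>In a product of two actions a word has no fixed point as soon as it has none in one
  factor, so a single action can serve both end levels of a generator.\<close>

lemma magnus_prod: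
  assumes "magnus r x" and "magnus r y"
  shows "\<exists>\<sigma> :: 'a \<Rightarrow> nat \<times> nat \<Rightarrow> nat \<times> nat.
    perms \<sigma> \<and> (\<forall>p. act \<sigma> r p = p) \<and> free_on \<sigma> (- {x}) \<and> free_on \<sigma> (- {y})"
proof -
  obtain \<sigma>1 \<sigma>2 :: "'a \<Rightarrow> nat \<Rightarrow> nat" where
    \<sigma>: "perms \<sigma>1" "\<forall>n. act \<sigma>1 r n = n" "free_on \<sigma>1 (- {x})"
      "perms \<sigma>2" "\<forall>n. act \<sigma>2 r n = n" "free_on \<sigma>2 (- {y})"
    using assms unfolding magnus_def by blast
  then show ?thesis
    by (intro exI[of _ "\<lambda>s. map_prod (\<sigma>1 s) (\<sigma>2 s)"])
      (simp add: perms_map_prod act_map_prod free_on_map_prod)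
qed

lemma level_bounds:
  fixes r :: "('a \<times> int) word"
  assumes "y \<in> fst ` fst ` set r"
  obtains \<mu> M where "(y, \<mu>) \<in> fst ` set r" "(y, M) \<in> fst ` set r"
    "\<And>i. (y, i) \<in> fst ` set r \<Longrightarrow> \<mu> \<le> i \<and> i \<le> M"
proof -
  define L where "L = {i. (y, i) \<in> fst ` set r}"
  have "L \<subseteq> snd ` fst ` set r"
  proof
    fix i assume "i \<in> L"
    then have "snd (y, i) \<in> snd ` fst ` set r" unfolding L_def by (intro imageI) simp
    then show "i \<in> snd ` fst ` set r" by simp
  qed
  then have fin: "finite L" by (rule finite_subset) simp
  obtain l where "l \<in> fst ` set r" "fst l = y" using assms by blast
  then have "snd l \<in> L" by (cases l) (simp add: L_def)
  then have ne: "L \<noteq> {}" by blast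
  have L: "(y, i) \<in> fst ` set r \<longleftrightarrow> i \<in> L" for i by (simp add: L_def)
  show thesis
    using that[of "Min L" "Max L"] Min_in[OF fin ne] Max_in[OF fin ne] Min_le[OF fin] Max_ge[OF fin]
    unfolding L by blast
qed

lemma reduced_rew_twice:
  assumes "reduced (r @ r)" and "\<omega> t \<noteq> 0" and "weight \<omega> r = 0"
  shows "reduced (rew \<omega> t 0 r @ rew \<omega> t 0 r)"
  using reduced_rew[of "r @ r" \<omega> t 0] assms by (simp add: rew_append)

text \<open>The stable letter is a root of \<open>t\<close>, and the omitted generator \<open>x\<close> is an ordinary letter.\<close>

lemma magnus_step_root:
  fixes r :: "'a::countable word"
  assumes red: "reduced (r @ r)" and x: "x \<in> fst ` set r" and "t \<noteq> x" and t: "\<omega> t \<noteq> 0"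
    and wr: "weight \<omega> r = 0"
    and zero: "\<And>s. s \<noteq> t \<Longrightarrow> s \<noteq> x \<Longrightarrow> \<omega> s = 0"
    and IH: "\<And>y. y \<in> fst ` set (rew \<omega> t 0 r) \<Longrightarrow> magnus (rew \<omega> t 0 r) y"
  shows "magnus r x"
proof -
  have "x \<in> fst ` fst ` set (rew \<omega> t 0 r)" using x \<open>t \<noteq> x\<close> by (simp add: set_rew)
  then obtain \<mu> M where \<mu>: "(x, \<mu>) \<in> fst ` set (rew \<omega> t 0 r)" and M: "(x, M) \<in> fst ` set (rew \<omega> t 0 r)"
    and range: "\<And>i. (x, i) \<in> fst ` set (rew \<omega> t 0 r) \<Longrightarrow> \<mu> \<le> i \<and> i \<le> M"
    by (rule level_bounds) blast
  obtain \<sigma> :: "'a \<times> int \<Rightarrow> nat \<times> nat \<Rightarrow> nat \<times> nat" where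
    \<sigma>: "perms \<sigma>" "\<And>p. act \<sigma> (rew \<omega> t 0 r) p = p" "free_on \<sigma> (- {(x, M)})" "free_on \<sigma> (- {(x, \<mu>)})"
    using magnus_prod[OF IH[OF M] IH[OF \<mu>]] by blast
  obtain \<rho> :: "'a \<Rightarrow> (nat \<times> nat) \<times> nat \<Rightarrow> (nat \<times> nat) \<times> nat" where
    \<rho>: "perms \<rho>" "\<And>p. act \<rho> r p = p" and
    tr: "\<And>w p. weight \<omega> w = 0 \<Longrightarrow>
      (\<And>i. (x, i) \<in> fst ` set (rew \<omega> t 0 w) \<Longrightarrow> \<mu> \<le> i \<and> i \<le> M) \<Longrightarrow>
      act \<rho> w p = (act \<sigma> (rew \<omega> t 0 w) (fst p), snd p)"
    using stable_letter[OF \<sigma>(1,2) wr \<sigma>(3,4) range] by blast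
  \<comment> \<open>A further coordinate records the weight. A fixed point of the product then
    forces weight zero, which makes the translation \<open>tr\<close> applicable.\<close>
  define \<zeta> where "\<zeta> s j = j + \<omega> s" for s and j :: int
  have \<zeta>: "perms \<zeta>" by (rule permsI[of "\<lambda>s j. j - \<omega> s"]) (auto simp: \<zeta>_def)
  have act_\<zeta>: "act \<zeta> w j = j + weight \<omega> w" for w j
  proof (induction w)
    case (Cons l w)
    have "inv_into UNIV (\<lambda>j. j + \<omega> s) i = i - \<omega> s" for s i
      by (rule inv_f_eq) (auto simp: inj_def)
    with Cons show ?case by (simp add: \<zeta>_def)
  qed simp
  show ?thesis
  proof (rule magnusI)
    show "infinite (UNIV :: (int \<times> (nat \<times> nat) \<times> nat) set)"
      by (simp add: finite_prod infinite_UNIV_int)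
    show "perms (\<lambda>s. map_prod (\<zeta> s) (\<rho> s))" by (rule perms_map_prod[OF \<zeta> \<rho>(1)])
    show "act (\<lambda>s. map_prod (\<zeta> s) (\<rho> s)) r p = p" for p
      by (simp add: act_map_prod[OF \<zeta> \<rho>(1)] act_\<zeta> wr \<rho>(2))
    show "free_on (\<lambda>s. map_prod (\<zeta> s) (\<rho> s)) (- {x})"
      unfolding free_on_def
    proof (intro allI impI notI)
      fix w p assume w: "reduced w" "w \<noteq> []" "fst ` set w \<subseteq> - {x}"
        and fix_p: "act (\<lambda>s. map_prod (\<zeta> s) (\<rho> s)) w p = p"
      have ww: "weight \<omega> w = 0" and "act \<rho> w (snd p) = snd p"
        using fix_p by (auto simp: act_map_prod[OF \<zeta> \<rho>(1)] act_\<zeta> prod_eq_iff)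
      have nox: "(x, i) \<notin> fst ` set (rew \<omega> t 0 w)" for i
        using w(3) set_rew[of \<omega> t 0 w] by (metis (no_types, lifting) Compl_iff DiffD1 fst_conv
            image_eqI insertI1 subsetD)
      then have "act \<sigma> (rew \<omega> t 0 w) (fst (snd p)) = fst (snd p)"
        using tr[OF ww, of "snd p"] \<open>act \<rho> w (snd p) = snd p\<close> by (metis fst_conv)
      moreover have "reduced (rew \<omega> t 0 w)" by (rule reduced_rew[of w \<omega> t 0, OF w(1) t])
      moreover have "rew \<omega> t 0 w \<noteq> []"
        using weight_single[OF w(1) _ w(2), of t \<omega>] t ww by (auto simp: rew_eq_Nil)
      moreover have "fst ` set (rew \<omega> t 0 w) \<subseteq> - {(x, M)}" using nox by auto
      ultimately show False using \<sigma>(3) unfolding free_on_def by blast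
    qed
  qed
qed

text \<open>The omitted generator \<open>x\<close> is itself the stable letter.\<close>

lemma magnus_step_stable:
  fixes r :: "'a::countable word"
  assumes red: "reduced (r @ r)" and r: "r = (x, d) # q" "q = q' @ [(y, e)]" and "y \<noteq> x"
    and \<omega>: "\<omega> = (\<lambda>s. if s = x then 1 else 0)" and wr: "weight \<omega> r = 0"
    and IH: "\<And>y. y \<in> fst ` set (rew \<omega> x 0 r) \<Longrightarrow> magnus (rew \<omega> x 0 r) y"
  shows "magnus r x"
proof -
  let ?r = "rew \<omega> x 0 r"
  have x1: "\<omega> x \<noteq> 0" by (simp add: \<omega>)
  have "weight \<omega> ((x, d) # q') = 0" using wr \<open>y \<noteq> x\<close> by (simp add: r \<omega> split: if_splits)
  then have "?r = rew \<omega> x 0 ((x, d) # q') @ [((y, 0), e)]"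
    using rew_append[of \<omega> x 0 "(x, d) # q'" "[(y, e)]"] \<open>y \<noteq> x\<close> by (simp add: r \<omega> Let_def)
  then have y0: "(y, 0) \<in> fst ` set ?r" by force
  then obtain s i e' v where hd: "?r = ((s, i), e') # v" by (cases ?r) auto
  have "reduced r" using red by (simp add: reduced_append_iff)
  have "s \<noteq> x" using set_rew[of \<omega> x 0 r] hd by force
  have "i \<noteq> 0"
  proof
    assume "i = 0"
    then have "i + (if e' then 0 else \<omega> s) = 0" using \<open>s \<noteq> x\<close> by (simp add: \<omega>)
    from rew_hd[OF \<open>reduced r\<close> x1 hd this] show False using \<open>s \<noteq> x\<close> by (auto simp: r)
  qed
  have si: "(s, i) \<in> fst ` set ?r" by (simp add: hd)
  have "y \<in> fst ` fst ` set ?r" using y0 by force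
  then obtain \<mu> M where \<mu>: "(y, \<mu>) \<in> fst ` set ?r" and M: "(y, M) \<in> fst ` set ?r"
    and range: "\<And>i. (y, i) \<in> fst ` set ?r \<Longrightarrow> \<mu> \<le> i \<and> i \<le> M"
    by (rule level_bounds) blast
  obtain \<sigma>1 :: "'a \<times> int \<Rightarrow> nat \<times> nat \<Rightarrow> nat \<times> nat" where
    \<sigma>1: "perms \<sigma>1" "\<And>p. act \<sigma>1 ?r p = p" "free_on \<sigma>1 (- {(y, M)})" "free_on \<sigma>1 (- {(y, \<mu>)})"
    using magnus_prod[OF IH[OF M] IH[OF \<mu>]] by blast
  obtain \<sigma>2 :: "'a \<times> int \<Rightarrow> nat \<Rightarrow> nat" where
    \<sigma>2: "perms \<sigma>2" "\<And>p. act \<sigma>2 ?r p = p" "free_on \<sigma>2 (- {(s, i)})"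
    using IH[OF si] unfolding magnus_def by blast
  \<comment> \<open>Three actions are combined: the two inside \<open>\<sigma>1\<close> control the
    top and bottom levels of \<open>y\<close>, as the conjugation needs, and
    \<open>\<sigma>2\<close> keeps all letters of level 0 free.\<close>
  define \<sigma> where "\<sigma> l = map_prod (\<sigma>1 l) (\<sigma>2 l)" for l
  have \<sigma>: "perms \<sigma>" "\<And>p. act \<sigma> ?r p = p"
    using \<sigma>1 \<sigma>2 unfolding \<sigma>_def by (simp_all add: perms_map_prod act_map_prod)
  have free: "free_on \<sigma> (- {(y, M)})" "free_on \<sigma> (- {(y, \<mu>)})" "free_on \<sigma> (- {(s, i)})"
    unfolding \<sigma>_def using \<sigma>1 \<sigma>2 by (simp_all add: free_on_map_prod)
  obtain \<rho> :: "'a \<Rightarrow> ((nat \<times> nat) \<times> nat) \<times> nat \<Rightarrow> ((nat \<times> nat) \<times> nat) \<times> nat" where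
    \<rho>: "perms \<rho>" "\<And>p. act \<rho> r p = p" and
    tr: "\<And>w p. weight \<omega> w = 0 \<Longrightarrow>
      (\<And>i. (y, i) \<in> fst ` set (rew \<omega> x 0 w) \<Longrightarrow> \<mu> \<le> i \<and> i \<le> M) \<Longrightarrow>
      act \<rho> w p = (act \<sigma> (rew \<omega> x 0 w) (fst p), snd p)"
    using stable_letter[OF \<sigma> wr free(1,2) range] by blast
  show ?thesis
  proof (rule magnusI)
    show "infinite (UNIV :: (((nat \<times> nat) \<times> nat) \<times> nat) set)"
      by (simp add: finite_prod)
    show "perms \<rho>" "\<And>p. act \<rho> r p = p" by fact+
    show "free_on \<rho> (- {x})"
      unfolding free_on_def
    proof (intro allI impI notI)
      fix w p assume w: "reduced w" "w \<noteq> []" "fst ` set w \<subseteq> - {x}" and fix_p: "act \<rho> w p = p"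
      have "weight \<omega> w = 0 \<and> (\<forall>l\<in>set (rew \<omega> x k w). snd (fst l) = k)" for k
        using w(3) by (induction w) (auto simp: \<omega> Let_def split: if_splits)
      then have ww: "weight \<omega> w = 0" and l0: "fst ` set (rew \<omega> x 0 w) \<subseteq> UNIV \<times> {0}"
        by (fastforce simp: mem_Times_iff)+
      have "act \<rho> w p = (act \<sigma> (rew \<omega> x 0 w) (fst p), snd p)"
        by (rule tr[OF ww]) (use l0 range[OF y0] in auto)
      then have "act \<sigma> (rew \<omega> x 0 w) (fst p) = fst p" using fix_p by (metis fst_conv)
      moreover have "reduced (rew \<omega> x 0 w)" by (rule reduced_rew[of w \<omega> x 0, OF w(1) x1])
      moreover have "rew \<omega> x 0 w \<noteq> []"
        using w(2,3) by (cases w) (auto simp: rew_eq_Nil)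
      moreover have "fst ` set (rew \<omega> x 0 w) \<subseteq> - {(s, i)}" using l0 \<open>i \<noteq> 0\<close> by auto
      ultimately show False using free(3) unfolding free_on_def by blast
    qed
  qed
qed

lemma reduced_rotate:
  assumes "reduced ((u @ v) @ u @ v)"
  shows "reduced ((v @ u) @ v @ u)"
  using assms by (cases "u = []"; cases "v = []") (auto simp: reduced_append_iff)

text \<open>Magnus's induction on the length: rewriting deletes every occurrence of the generator
  \<open>t\<close>, which does occur, so the relator gets shorter. Its letters then live over
  \<open>nat \<times> int\<close> and are renumbered by \<open>nat\<close>, to keep the induction
  within one type.\<close>

lemma freiheitssatz_nat:
  fixes r :: "nat word"
  assumes "reduced (r @ r)" and "x \<in> fst ` set r"
  shows "magnus r x"
  using assms
proof (induction "length r" arbitrary: r x rule: less_induct)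
  case less
  have IH: "magnus (rew \<omega> t 0 r') y"
    if "length r' = length r" "reduced (r' @ r')" "\<omega> t \<noteq> 0" "weight \<omega> r' = 0" "t \<in> fst ` set r'"
      "y \<in> fst ` set (rew \<omega> t 0 r')" for \<omega> t r' and y :: "nat \<times> int"
  proof (rule magnus_map[of "to_nat"])
    show "inj (to_nat :: nat \<times> int \<Rightarrow> nat)" by simp
    let ?r = "map (map_prod to_nat id) (rew \<omega> t 0 r') :: nat word"
    show "magnus ?r (to_nat y)"
    proof (rule less.hyps)
      show "length ?r < length r" using length_rew_less[OF that(5)] that(1) by simp
      have "reduced (map (map_prod (to_nat :: nat \<times> int \<Rightarrow> nat) id) (rew \<omega> t 0 r' @ rew \<omega> t 0 r'))"
        using reduced_rew_twice[of r' \<omega> t] that by (subst reduced_map) auto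
      then show "reduced (?r @ ?r)" by simp
      show "to_nat y \<in> fst ` set ?r" using that(6) by force
    qed
  qed
  show ?case
  proof (cases "fst ` set r \<subseteq> {x}")
    case True
    then show ?thesis by (rule magnus_single)
  next
    case False
    define \<chi> where "\<chi> s u = (if u = s then 1 else 0 :: int)" for s u :: nat
    show ?thesis
    proof (cases "weight (\<chi> x) r = 0")
      case True
      \<comment> \<open>With exponent sum zero \<open>x\<close> itself can be the stable letter. Two
        rotations bring the relator into a form that starts with \<open>x\<close> and ends with
        another generator.\<close>
      obtain l where l: "l \<in> set r" "fst l \<noteq> x" using False by auto
      then obtain A B where AB: "r = A @ l # B" by (meson split_list)
      let ?r1 = "l # B @ A"
      have "\<exists>l\<in>set ?r1. fst l = x" using less.prems(2) AB by auto
      then obtain C m D where CmD: "?r1 = C @ m # D" "fst m = x" "\<forall>l\<in>set C. fst l \<noteq> x"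
        by (rule split_list_first_propE) blast
      have "C \<noteq> []" using CmD l by (cases C) auto
      define r' where "r' = m # D @ C"
      have "reduced (?r1 @ ?r1)" using less.prems(1) reduced_rotate[of A "l # B"] AB by simp
      then have red: "reduced (r' @ r')"
        using reduced_rotate[of C "m # D"] by (simp add: CmD r'_def)
      have w: "weight (\<chi> x) r' = 0"
        using True arg_cong[OF CmD(1), of "weight (\<chi> x)"] by (simp add: r'_def AB)
      have len: "length r' = length r"
        using arg_cong[OF CmD(1), of length] by (simp add: r'_def AB)
      have "magnus r' x"
      proof (rule magnus_step_stable[OF red])
        show "r' = (x, snd m) # (D @ C)" using CmD(2) by (auto simp: r'_def)
        show "D @ C = (D @ butlast C) @ [(fst (last C), snd (last C))]" using \<open>C \<noteq> []\<close> by simp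
        show "fst (last C) \<noteq> x" using CmD(3) \<open>C \<noteq> []\<close> by auto
        show "\<chi> x = (\<lambda>s. if s = x then 1 else 0)" by (simp add: \<chi>_def fun_eq_iff)
        show "weight (\<chi> x) r' = 0" by (rule w)
        show "magnus (rew (\<chi> x) x 0 r') y" if "y \<in> fst ` set (rew (\<chi> x) x 0 r')" for y
          by (rule IH[OF len red _ w _ that]) (use CmD(2) in \<open>auto simp: \<chi>_def r'_def\<close>)
      qed
      then have "magnus (C @ m # D) x" using magnus_conj[of "m # D" C] by (simp add: r'_def)
      then have "magnus ((l # B) @ A) x" using CmD(1) by simp
      then show ?thesis using magnus_conj[of "l # B" A] by (simp add: AB)
    next
      case nz: False
      obtain t where t: "t \<in> fst ` set r" "t \<noteq> x" using False by auto
      \<comment> \<open>The weights of \<open>x\<close> and \<open>t\<close> are each other's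
        exponent sums up to sign, so the relator has weight zero. As \<open>\<omega> t\<close> is
        the non-zero exponent sum of \<open>x\<close>, the generator \<open>t\<close> becomes a
        proper or trivial power of a new stable letter.\<close>
      define \<omega> where "\<omega> s = weight (\<chi> x) r * \<chi> t s + (- weight (\<chi> t) r) * \<chi> x s" for s
      have w: "weight \<omega> r = 0"
        unfolding \<omega>_def weight_linear by simp
      have \<omega>t: "\<omega> t \<noteq> 0" using nz t(2) by (simp add: \<omega>_def \<chi>_def)
      show ?thesis
      proof (rule magnus_step_root[OF less.prems t(2) \<omega>t w])
        show "\<omega> s = 0" if "s \<noteq> t" "s \<noteq> x" for s using that by (simp add: \<omega>_def \<chi>_def)
        show "magnus (rew \<omega> t 0 r) y" if "y \<in> fst ` set (rew \<omega> t 0 r)" for y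
          by (rule IH[OF refl less.prems(1) \<omega>t w t(1) that])
      qed
    qed
  qed
qed

theorem freiheitssatz:
  fixes r :: "'a::countable word"
  assumes "reduced (r @ r)" and "x \<in> fst ` set r"
  shows "magnus r x"
proof (rule magnus_map[of "to_nat"])
  show "inj (to_nat :: 'a \<Rightarrow> nat)" by simp
  have "reduced (map (map_prod (to_nat :: 'a \<Rightarrow> nat) id) (r @ r))"
    using assms(1) by (subst reduced_map) auto
  then show "magnus (map (map_prod to_nat id) r) (to_nat x)"
    using assms(2) by (intro freiheitssatz_nat) (simp, force)
qed

section \<open>Words acting trivially modulo a relator\<close>

lemma carrier_free_group: "w \<in> carrier (free_group S) \<longleftrightarrow> reduced w \<and> fst ` set w \<subseteq> S"
  by (simp add: free_group_def)

lemma mult_free_group: "u \<otimes>\<^bsub>free_group S\<^esub> v = reduce (u @ v)"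
  by (simp add: free_group_def)

lemma one_free_group: "\<one>\<^bsub>free_group S\<^esub> = []"
  by (simp add: free_group_def)

lemma inv_free_group:
  assumes "w \<in> carrier (free_group S)"
  shows "inv\<^bsub>free_group S\<^esub> w = inv_word w"
proof -
  interpret group "free_group S" by (rule group_free_group)
  show ?thesis
    by (rule inv_equality)
      (use assms in \<open>auto simp: carrier_free_group mult_free_group one_free_group reduce_inv_word
        reduced_inv_word fst_set_inv_word\<close>)
qed

lemma commutator_free_group:
  assumes "u \<in> carrier (free_group S)" "v \<in> carrier (free_group S)"
  shows "commutator (free_group S) u v = reduce (u @ v @ inv_word u @ inv_word v)"
  using assms by (simp add: commutator_def inv_free_group mult_free_group reduce_append_reduce)

text \<open>These are the words acting trivially on the cover whose second coordinate accumulates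
  the labels \<open>c\<close>, hence the kernel of an action.\<close>

lemma normal_kernel:
  assumes \<sigma>: "perms \<sigma>"
  shows "{w \<in> carrier (free_group S). \<forall>x. act \<sigma> w x = x \<and> psum \<sigma> c w x = 0} \<lhd> free_group S"
    (is "?K \<lhd> _")
proof -
  interpret group "free_group S" by (rule group_free_group)
  have "psum \<sigma> c (inv_word w) x = 0" if "\<forall>x. act \<sigma> w x = x \<and> psum \<sigma> c w x = 0" for w x
    using psum_inv_word[OF \<sigma>, of c w x] that by simp
  moreover have "act \<sigma> (inv_word w) x = x" if "\<forall>x. act \<sigma> w x = x" for w x
    using act_inv_word1[OF \<sigma>, of w x] that by simp
  ultimately have inv: "inv\<^bsub>free_group S\<^esub> w \<in> ?K" if "w \<in> ?K" for w
    using that inv_closed[of w] by (simp add: inv_free_group)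
  have "subgroup ?K (free_group S)"
  proof (rule subgroupI)
    show "?K \<noteq> {}" using one_closed by (auto simp: one_free_group intro!: exI[of _ "[]"])
    show "u \<otimes>\<^bsub>free_group S\<^esub> w \<in> ?K" if "u \<in> ?K" "w \<in> ?K" for u w
      using that m_closed[of u w]
      by (simp add: mult_free_group act_reduce[OF \<sigma>] psum_reduce[OF \<sigma>] act_append psum_append)
  qed (use inv in auto)
  moreover have "u \<otimes>\<^bsub>free_group S\<^esub> w \<otimes>\<^bsub>free_group S\<^esub> inv\<^bsub>free_group S\<^esub> u \<in> ?K"
    if "u \<in> carrier (free_group S)" "w \<in> ?K" for u w
  proof -
    have "psum \<sigma> c u (act \<sigma> (inv_word u) x) + psum \<sigma> c (inv_word u) x = 0" for x
      using psum_append[of \<sigma> c u "inv_word u" x] psum_reduce[OF \<sigma>, of c "u @ inv_word u" x]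
        reduce_inv_word[of "inv_word u"] by simp
    moreover have "u \<otimes>\<^bsub>free_group S\<^esub> w \<otimes>\<^bsub>free_group S\<^esub> inv\<^bsub>free_group S\<^esub> u \<in> carrier (free_group S)"
      using that by simp
    ultimately show ?thesis
      using that
      by (auto simp: inv_free_group mult_free_group act_reduce[OF \<sigma>] psum_reduce[OF \<sigma>]
        act_append psum_append act_inv_word2[OF \<sigma>])
  qed
  ultimately show ?thesis by (simp add: normal_inv_iff)
qed

lemma closure_trivial:
  assumes "perms \<sigma>" and "r \<in> carrier (free_group S)"
    and "\<And>x. act \<sigma> r x = x" and "\<And>x. psum \<sigma> c r x = 0"
    and "w \<in> normal_closure (free_group S) {r}"
  shows "act \<sigma> w x = x" and "psum \<sigma> c w x = 0"
  using assms(5) normal_kernel[OF assms(1), of S c] assms(2-4) unfolding normal_closure_def by blast+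

lemma closure_act_trivial:
  assumes "perms \<sigma>" and "r \<in> carrier (free_group S)" and "\<And>x. act \<sigma> r x = x"
    and "w \<in> normal_closure (free_group S) {r}"
  shows "act \<sigma> w x = x"
proof -
  have "psum \<sigma> (\<lambda>s x. 0 :: int) r y = 0" for y by (induction r) auto
  then show ?thesis using closure_trivial(1)[OF assms(1-3) _ assms(4)] by blast
qed

text \<open>Cyclic reducedness is expressed by the square of the word being reduced, the form in
  which \<open>freiheitssatz\<close> takes its relator.\<close>

lemma cyc_reduce_conj:
  assumes "reduced w"
  shows "\<exists>g. w = g @ cyc_reduce w @ inv_word g \<and> reduced (cyc_reduce w @ cyc_reduce w)"
  using assms
proof (induction w rule: cyc_reduce.induct)
  case (1 w)
  show ?case
  proof (cases "w \<noteq> [] \<and> hd w = inv_letter (last w)")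
    case False
    then have "cyc_reduce w = w" by (subst cyc_reduce.simps) auto
    then show ?thesis using False 1(2) by (intro exI[of _ "[]"]) (auto simp: reduced_append_iff)
  next
    case True
    have "length w \<noteq> 1" using True by (cases w) auto
    then obtain v where w: "w = inv_letter (last w) # v @ [last w]"
      using True by (metis append_butlast_last_id hd_Cons_tl last_ConsL last_tl length_Cons list.size(3) One_nat_def
          butlast_tl)
    define l where "l = last w"
    have w: "w = inv_letter l # v @ [l]" using w by (simp add: l_def)
    have "reduced v" using 1(2) unfolding w by (simp add: reduced_Cons_iff reduced_append_iff)
    have c: "cyc_reduce w = cyc_reduce v" using True by (subst cyc_reduce.simps) (simp add: w)
    have "butlast (tl w) = v" by (simp add: w)
    then obtain g where "v = g @ cyc_reduce v @ inv_word g" "reduced (cyc_reduce v @ cyc_reduce v)"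
      using 1(1)[OF True] \<open>reduced v\<close> by auto
    then show ?thesis unfolding c
      by (intro exI[of _ "inv_letter l # g"]) (simp add: w inv_word_Cons)
  qed
qed

section \<open>Relators whose normal closure is the commutator subgroup\<close>

definition expo :: "'a \<Rightarrow> 'a \<Rightarrow> int" where
  "expo t s = (if s = t then 1 else 0)"

text \<open>If the levels of \<open>y\<close> in the relator spread over at least two units, the
  letters of levels \<open>\<mu>\<close> and \<open>\<mu> + 1\<close> both differ from that of the
  top level \<open>M\<close>, so they stay free. Their quotient is a conjugate of the commutator of
  \<open>y\<close> and \<open>t\<close>, which therefore survives modulo the relator.\<close>

lemma not_commuting_of_levels:
  fixes r :: "'a::countable word"
  assumes red: "reduced (r @ r)" and "y \<noteq> t" and w0: "weight (expo t) r = 0"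
    and lev: "(y, i) \<in> fst ` set (rew (expo t) t 0 r)" "(y, j) \<in> fst ` set (rew (expo t) t 0 r)" "i + 2 \<le> j"
  obtains \<rho> :: "'a \<Rightarrow> (nat \<times> nat) \<times> nat \<Rightarrow> (nat \<times> nat) \<times> nat" where
    "perms \<rho>" and "\<And>p. act \<rho> r p = p" and "\<exists>p. \<rho> y (\<rho> t p) \<noteq> \<rho> t (\<rho> y p)"
proof -
  let ?r = "rew (expo t) t 0 r"
  have t1: "expo t t \<noteq> 0" by (simp add: expo_def)
  have "y \<in> fst ` fst ` set ?r" using lev(1) by force
  then obtain \<mu> M where \<mu>: "(y, \<mu>) \<in> fst ` set ?r" and M: "(y, M) \<in> fst ` set ?r"
    and range: "\<And>i. (y, i) \<in> fst ` set ?r \<Longrightarrow> \<mu> \<le> i \<and> i \<le> M"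
    by (rule level_bounds) blast
  have M2: "\<mu> + 2 \<le> M" using range[OF lev(1)] range[OF lev(2)] lev(3) by linarith
  have rr: "reduced (?r @ ?r)" by (rule reduced_rew_twice[of r "expo t" t, OF red t1 w0])
  obtain \<sigma> :: "'a \<times> int \<Rightarrow> nat \<times> nat \<Rightarrow> nat \<times> nat" where
    \<sigma>: "perms \<sigma>" "\<And>p. act \<sigma> ?r p = p" "free_on \<sigma> (- {(y, M)})" "free_on \<sigma> (- {(y, \<mu>)})"
    using magnus_prod[OF freiheitssatz[OF rr M] freiheitssatz[OF rr \<mu>]] by blast
  obtain \<rho> :: "'a \<Rightarrow> (nat \<times> nat) \<times> nat \<Rightarrow> (nat \<times> nat) \<times> nat" where
    \<rho>: "perms \<rho>" "\<And>p. act \<rho> r p = p" and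
    tr: "\<And>w p. weight (expo t) w = 0 \<Longrightarrow>
      (\<And>i. (y, i) \<in> fst ` set (rew (expo t) t 0 w) \<Longrightarrow> \<mu> \<le> i \<and> i \<le> M) \<Longrightarrow>
      act \<rho> w p = (act \<sigma> (rew (expo t) t 0 w) (fst p), snd p)"
    using stable_letter[OF \<sigma>(1,2) w0 \<sigma>(3,4) range] by blast
  \<comment> \<open>A power of \<open>t\<close> of weight \<open>\<mu>\<close>: conjugation by it
    moves the commutator from level 0 to level \<open>\<mu>\<close>.\<close>
  define P where "P = replicate (nat \<bar>\<mu>\<bar>) (t, \<mu> \<ge> 0)"
  have P: "weight (expo t) P = \<mu>" by (auto simp: P_def weight_replicate expo_def)
  have Pn: "rew (expo t) t k P = []" "rew (expo t) t k (inv_word P) = []" for k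
    by (auto simp: rew_eq_Nil fst_set_inv_word P_def)
  define w where "w = P @ [(y, True), (t, True), (y, False), (t, False)] @ inv_word P"
  have w: "weight (expo t) w = 0" using P by (simp add: w_def weight_inv_word)
  have rw: "rew (expo t) t 0 w = [((y, \<mu>), True), ((y, \<mu> + 1), False)]"
    using \<open>y \<noteq> t\<close> by (simp add: w_def rew_append Pn P Let_def expo_def)
  have "act \<rho> w p = (act \<sigma> [((y, \<mu>), True), ((y, \<mu> + 1), False)] (fst p), snd p)" for p
    unfolding rw[symmetric] by (rule tr[OF w]) (use M2 in \<open>auto simp: rw\<close>)
  moreover have "reduced [((y, \<mu>), True), ((y, \<mu> + 1), False)]"
    "fst ` set [((y, \<mu>), True), ((y, \<mu> + 1), False)] \<subseteq> - {(y, M)}"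
    using M2 by (auto simp: inv_letter_def)
  then have "act \<sigma> [((y, \<mu>), True), ((y, \<mu> + 1), False)] q \<noteq> q" for q
    using \<sigma>(3) unfolding free_on_def by blast
  ultimately have ne: "act \<rho> w p \<noteq> p" for p by (metis fst_conv)
  have "\<exists>p. \<rho> y (\<rho> t p) \<noteq> \<rho> t (\<rho> y p)"
  proof (rule ccontr)
    assume "\<not> ?thesis"
    then have comm: "\<rho> y (\<rho> t p) = \<rho> t (\<rho> y p)" for p by blast
    have "act \<rho> [(y, True), (t, True), (y, False), (t, False)] p = p" for p
      using \<rho>(1) by (simp add: comm)
    then have "act \<rho> w p = p" for p
      by (simp only: w_def act_append act_inv_word2[OF \<rho>(1)])
    with ne show False by blast
  qed
  with \<rho> show thesis by (rule that)
qed

section \<open>Lattice paths confined to a unit square\<close>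

instance gen2 :: countable
  by countable_datatype

text \<open>Here \<open>w\<close> is a lattice path read from left to right. Only its edges are
  restricted: horizontal ones to two rows, vertical ones to two columns. The path may still run out
  of the square along a row or a column, which \<open>escape_a\<close> and \<open>escape_b\<close>
  deal with.\<close>

fun in_square :: "int \<Rightarrow> int \<Rightarrow> int \<Rightarrow> int \<Rightarrow> gen2 word \<Rightarrow> bool" where
  "in_square n m x y [] = True"
| "in_square n m x y ((Gen_a, e) # w) =
     (y \<in> {m, m + 1} \<and> in_square n m (if e then x + 1 else x - 1) y w)"
| "in_square n m x y ((Gen_b, e) # w) =
     (x \<in> {n, n + 1} \<and> in_square n m x (if e then y + 1 else y - 1) w)"

lemma in_square_of_levels:
  assumes "\<forall>l\<in>set (rew (expo Gen_b) Gen_b y w). snd (fst l) \<in> {m, m + 1}"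
    and "\<forall>l\<in>set (rew (expo Gen_a) Gen_a x w). snd (fst l) \<in> {n, n + 1}"
  shows "in_square n m x y w"
  using assms
  by (induction n m x y w rule: in_square.induct) (auto simp: expo_def Let_def split: if_splits)

lemma in_square_append:
  "in_square n m x y (u @ v) \<longleftrightarrow>
     in_square n m x y u \<and> in_square n m (x + weight (expo Gen_a) u) (y + weight (expo Gen_b) u) v"
  by (induction n m x y u rule: in_square.induct) (auto simp: expo_def algebra_simps)

lemma gen2_UNIV: "s \<noteq> Gen_a \<longleftrightarrow> s = Gen_b" "s \<noteq> Gen_b \<longleftrightarrow> s = Gen_a"
  by (cases s; simp)+

text \<open>Once the path has left the two columns along a row, no admissible vertical edge is
  available, and being reduced it cannot turn back.\<close>

lemma escape_a:
  assumes "reduced ((Gen_a, e) # w)" and "in_square n m x y ((Gen_a, e) # w)"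
    and "if e then x \<ge> n + 1 else x \<le> n"
  shows "fst ` set w \<subseteq> {Gen_a}"
  using assms
proof (induction w arbitrary: x)
  case (Cons l w)
  obtain s e' where l: "l = (s, e')" by (cases l)
  show ?case
  proof (cases s)
    case Gen_a
    then have "e' = e" using Cons.prems(1) by (simp add: l inv_letter_def)
    then show ?thesis
      using Cons.IH[of "if e then x + 1 else x - 1"] Cons.prems Gen_a by (auto simp: l split: if_splits)
  next
    case Gen_b
    then show ?thesis using Cons.prems by (auto simp: l split: if_splits)
  qed
qed simp

lemma escape_b:
  assumes "reduced ((Gen_b, e) # w)" and "in_square n m x y ((Gen_b, e) # w)"
    and "if e then y \<ge> m + 1 else y \<le> m"
  shows "fst ` set w \<subseteq> {Gen_b}"
  using assms
proof (induction w arbitrary: y)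
  case (Cons l w)
  obtain s e' where l: "l = (s, e')" by (cases l)
  show ?case
  proof (cases s)
    case Gen_b
    then have "e' = e" using Cons.prems(1) by (simp add: l inv_letter_def)
    then show ?thesis
      using Cons.IH[of "if e then y + 1 else y - 1"] Cons.prems Gen_b by (auto simp: l split: if_splits)
  next
    case Gen_a
    then show ?thesis using Cons.prems by (auto simp: l split: if_splits)
  qed
qed simp

text \<open>The flags \<open>hx\<close> and \<open>hy\<close> tell whether the walk stands at the
  right column and at the upper row. Each unit of \<open>k\<close> leads to the opposite corner,
  vertical edge first, so two units make one turn around the square.\<close>

fun corner_walk :: "nat \<Rightarrow> bool \<Rightarrow> bool \<Rightarrow> gen2 word" where
  "corner_walk 0 hx hy = []"
| "corner_walk (Suc k) hx hy = (Gen_b, Not hy) # (Gen_a, Not hx) # corner_walk k (Not hx) (Not hy)"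

text \<open>A vertical run out of the square is refuted by the horizontal last letter of
  \<open>w\<close>, a horizontal one by the appended vertical letter. At every corner the next edge
  is thereby forced.\<close>

lemma in_square_corner_walk:
  assumes "reduced (w @ [(Gen_b, d)])" and "in_square n m x y (w @ [(Gen_b, d)])"
    and "x \<in> {n, n + 1}" and "y \<in> {m, m + 1}"
    and "w \<noteq> [] \<Longrightarrow> fst (hd w) = Gen_b \<and> fst (last w) = Gen_a"
  shows "\<exists>k. w = corner_walk k (x = n + 1) (y = m + 1)"
  using assms
proof (induction "length w" arbitrary: w x y rule: less_induct)
  case less
  show ?case
  proof (cases w)
    case Nil
    then show ?thesis by (intro exI[of _ 0]) simp
  next
    case (Cons l1 w1)
    then obtain e where l1: "l1 = (Gen_b, e)" using less.prems(5) by (cases l1) auto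
    have la: "Gen_a \<in> fst ` set w1"
      using less.prems(5) last_in_set[of w1] unfolding Cons l1 by (cases w1) force+
    obtain l2 w2 where w1: "w1 = l2 # w2" using la by (cases w1) auto
    have e: "e \<longleftrightarrow> y = m"
    proof (rule ccontr)
      assume "\<not> ?thesis"
      then have "if e then y \<ge> m + 1 else y \<le> m" using less.prems(4) by (auto split: if_splits)
      from escape_b[of e "w1 @ [(Gen_b, d)]" n m x y] this have "fst ` set w1 \<subseteq> {Gen_b}"
        using less.prems(1,2) by (simp add: Cons l1)
      with la show False by auto
    qed
    define y' where "y' = (if e then y + 1 else y - 1)"
    have y': "y' \<in> {m, m + 1}" "(y' = m + 1) \<longleftrightarrow> \<not> (y = m + 1)" using e less.prems(4) by (auto simp: y'_def)
    have r1: "reduced (w1 @ [(Gen_b, d)])" "in_square n m x y' (w1 @ [(Gen_b, d)])"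
      using less.prems(1,2) by (auto simp: Cons l1 y'_def reduced_Cons_iff)
    obtain s2 e2 where l2: "l2 = (s2, e2)" by (cases l2)
    have s2: "s2 = Gen_a"
    proof (rule ccontr)
      assume "s2 \<noteq> Gen_a"
      then have s2: "s2 = Gen_b" by (simp add: gen2_UNIV)
      then have "e2 = e" using less.prems(1) by (simp add: Cons l1 w1 l2 inv_letter_def)
      then have "if e2 then y' \<ge> m + 1 else y' \<le> m" using e less.prems(4) by (auto simp: y'_def)
      from escape_b[of e2 "w2 @ [(Gen_b, d)]" n m x y'] this have "fst ` set w2 \<subseteq> {Gen_b}"
        using r1 by (simp add: w1 l2 s2)
      with la show False by (auto simp: w1 l2 s2)
    qed
    have e2: "e2 \<longleftrightarrow> x = n"
    proof (rule ccontr)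
      assume "\<not> ?thesis"
      then have "if e2 then x \<ge> n + 1 else x \<le> n" using less.prems(3) by (auto split: if_splits)
      from escape_a[of e2 "w2 @ [(Gen_b, d)]" n m x y'] this show False
        using r1 by (simp add: w1 l2 s2)
    qed
    define x' where "x' = (if e2 then x + 1 else x - 1)"
    have x': "x' \<in> {n, n + 1}" "(x' = n + 1) \<longleftrightarrow> \<not> (x = n + 1)" using e2 less.prems(3) by (auto simp: x'_def)
    have r2: "reduced (w2 @ [(Gen_b, d)])" "in_square n m x' y' (w2 @ [(Gen_b, d)])"
      using r1 by (auto simp: w1 l2 s2 x'_def reduced_Cons_iff)
    have "fst (hd w2) = Gen_b" if ne: "w2 \<noteq> []"
    proof (rule ccontr)
      assume "fst (hd w2) \<noteq> Gen_b"
      then obtain e3 w3 where w2: "w2 = (Gen_a, e3) # w3"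
        using ne by (cases w2) (auto simp: gen2_UNIV prod_eq_iff)
      have "e3 = e2" using r1(1) by (simp add: w1 l2 s2 w2 inv_letter_def)
      then have "if e3 then x' \<ge> n + 1 else x' \<le> n" using e2 less.prems(3) by (auto simp: x'_def)
      from escape_a[of e3 "w3 @ [(Gen_b, d)]" n m x' y'] this show False
        using r2 by (simp add: w2)
    qed
    moreover have "fst (last w2) = Gen_a" if "w2 \<noteq> []"
      using less.prems(5) that by (simp add: Cons w1)
    ultimately have "\<exists>k. w2 = corner_walk k (x' = n + 1) (y' = m + 1)"
      using less.hyps[of w2 x' y'] r2 x'(1) y'(1) by (simp add: Cons w1)
    then obtain k where "w2 = corner_walk k (x \<noteq> n + 1) (y \<noteq> m + 1)" using x' y' by auto
    then show ?thesis
      using e e2 less.prems(3,4) by (intro exI[of _ "Suc k"]) (auto simp: Cons l1 w1 l2 s2)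
  qed
qed

lemma corner_walk_even: "corner_walk (2 * j) hx hy = concat (replicate j (corner_walk 2 hx hy))"
  by (induction j) (auto simp: numeral_2_eq_2)

lemma corner_walk_weight: "weight (expo Gen_a) (corner_walk k hx hy) = 0 \<longleftrightarrow> even k"
proof -
  have "weight (expo Gen_a) (corner_walk k hx hy) = (if even k then 0 else if hx then - 1 else 1)"
    by (induction k arbitrary: hx hy) (auto simp: expo_def)
  then show ?thesis by simp
qed

lemma corner_walk_2:
  "corner_walk 2 hx hy \<in> cyclic_conjugates aba'b' \<union> cyclic_conjugates bab'a'"
proof -
  have "corner_walk 2 hx hy = (if hx = hy then
      if hx then rotate 2 bab'a' else rotate 0 bab'a' else
      if hx then rotate 1 aba'b' else rotate 3 aba'b')"
    by (auto simp: numeral_2_eq_2 numeral_3_eq_3 aba'b'_def bab'a'_def)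
  moreover have "rotate k w \<in> cyclic_conjugates w" for k and w :: "gen2 word"
    by (auto simp: cyclic_conjugates_def)
  ultimately show ?thesis by (metis UnI1 UnI2)
qed

lemma rotate_cyclic_conjugates: "v \<in> cyclic_conjugates w \<Longrightarrow> rotate n v \<in> cyclic_conjugates w"
  by (auto simp: cyclic_conjugates_def rotate_rotate)

text \<open>The generators act on the complex plane as two reflections.\<close>

lemma square_power_nontrivial:
  assumes "j \<noteq> (1 :: nat)"
  obtains \<rho> :: "gen2 \<Rightarrow> complex \<Rightarrow> complex" where "perms \<rho>"
    and "\<And>z. act \<rho> (concat (replicate j (corner_walk 2 hx hy))) z = z"
    and "\<exists>z. \<rho> Gen_a (\<rho> Gen_b z) \<noteq> \<rho> Gen_b (\<rho> Gen_a z)"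
proof -
  \<comment> \<open>One turn around the square acts as the rotation by \<open>2 * pi / n\<close>, so
    its \<open>j\<close>-th power is trivial for \<open>n = j\<close>. For \<open>j = 0\<close> the
    power is empty and 2 is just a value for which the reflections do not commute.\<close>
  define n where "n = (if j = 0 then 2 else j)"
  have n: "n \<ge> 2" using assms by (auto simp: n_def)
  define \<zeta> where "\<zeta> = cis (pi / n)"
  define \<rho> where "\<rho> s z = (case s of Gen_a \<Rightarrow> cnj z | Gen_b \<Rightarrow> \<zeta> * cnj z)" for s z
  have \<zeta>: "\<zeta> * cnj \<zeta> = 1" by (simp add: \<zeta>_def cis_cnj cis_mult)
  have invol: "\<rho> s (\<rho> s z) = z" for s z
    using \<zeta> by (cases s) (simp_all add: \<rho>_def mult.assoc[symmetric])
  have \<rho>: "perms \<rho>" by (rule permsI[of \<rho>]) (simp_all add: invol)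
  have inv: "inv_into UNIV (\<rho> s) z = \<rho> s z" for s z
    by (rule inv_f_eq) (use \<rho> invol in \<open>auto simp: perms_def bij_def\<close>)
  have walk: "act \<rho> (corner_walk 2 hx hy) z = \<zeta>\<^sup>2 * z" for z
    by (simp add: numeral_2_eq_2 inv) (simp add: \<rho>_def)
  have "act \<rho> (concat (replicate k (corner_walk 2 hx hy))) z = (\<zeta>\<^sup>2) ^ k * z" for k z
    by (induction k) (simp_all add: act_append walk)
  moreover have "(\<zeta>\<^sup>2) ^ j = 1"
    using n by (auto simp: \<zeta>_def DeMoivre n_def power_mult[symmetric])
  moreover have "\<exists>z. \<rho> Gen_a (\<rho> Gen_b z) \<noteq> \<rho> Gen_b (\<rho> Gen_a z)"
  proof (intro exI notI)
    assume "\<rho> Gen_a (\<rho> Gen_b 1) = \<rho> Gen_b (\<rho> Gen_a 1)"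
    then have "Im \<zeta> = 0" by (simp add: \<rho>_def complex_eq_iff)
    moreover have "sin (pi / n) > 0" using n by (intro sin_gt_zero) (auto simp: field_simps)
    ultimately show False by (simp add: \<zeta>_def)
  qed
  ultimately show thesis using \<rho> by (intro that[of \<rho>]) auto
qed

lemma act_rotate_trivial:
  assumes "perms \<rho>" and "\<And>p. act \<rho> (rotate n w) p = p"
  shows "act \<rho> w p = p"
proof -
  define m where "m = n mod length w"
  have "act \<rho> (drop m w) (act \<rho> (take m w) q) = q" for q
    using assms(2)[of q] by (simp add: rotate_drop_take m_def act_append)
  then have "act \<rho> (take m w) (act \<rho> (drop m w) p) = p"
    using act_inj[OF assms(1), of "drop m w"] by metis
  then show ?thesis using act_append[of \<rho> "take m w" "drop m w" p] by simp
qed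

text \<open>Meant for contradiction: an action that kills a rotation of the reduced relator, but has
  non-commuting generators, shows that the quotient is not abelian.\<close>

lemma closure_not_commuting:
  assumes "r \<in> carrier F2" and "aba'b' \<in> normal_closure F2 {r}"
    and "perms \<rho>" and "\<And>p. act \<rho> (rotate n (cyc_reduce r)) p = p"
  shows "\<rho> Gen_a (\<rho> Gen_b p) = \<rho> Gen_b (\<rho> Gen_a p)"
proof -
  obtain g where g: "r = g @ cyc_reduce r @ inv_word g"
    using cyc_reduce_conj[of r] assms(1) by (auto simp: carrier_free_group)
  have "act \<rho> r p = p" for p
    by (subst g) (simp add: act_append act_rotate_trivial[OF assms(3,4)] act_inv_word2[OF assms(3)])
  then have "act \<rho> aba'b' q = q" for q
    using closure_act_trivial[OF assms(3,1) _ assms(2)] by blast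
  from this[of "\<rho> Gen_b (\<rho> Gen_a p)"] show ?thesis using assms(3) by (simp add: aba'b'_def)
qed

text \<open>Each other shape of the relator is refuted by an action with non-commuting generators:
  reflections for the empty word and for powers of the square loop, Magnus actions for paths wider
  or higher than one unit.\<close>

lemma relator_of_abelian_quotient:
  assumes r: "r \<in> carrier F2" and wa: "weight (expo Gen_a) r = 0" and wb: "weight (expo Gen_b) r = 0"
    and ab: "aba'b' \<in> normal_closure F2 {r}"
  shows "cyc_reduce r \<in> cyclic_conjugates aba'b' \<union> cyclic_conjugates bab'a'"
proof -
  define c where "c = cyc_reduce r"
  obtain g where g: "r = g @ c @ inv_word g" and cc: "reduced (c @ c)"
    using cyc_reduce_conj[of r] r by (auto simp: carrier_free_group c_def)
  have wc: "weight (expo s) c = 0" for s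
    using wa wb arg_cong[OF g, of "weight (expo s)"] by (cases s) (simp_all add: weight_inv_word)
  note comm = closure_not_commuting[OF r ab, folded c_def]
  have "c \<noteq> []"
  proof
    assume "c = []"
    obtain \<rho> :: "gen2 \<Rightarrow> complex \<Rightarrow> complex" where "perms \<rho>"
      and "\<exists>z. \<rho> Gen_a (\<rho> Gen_b z) \<noteq> \<rho> Gen_b (\<rho> Gen_a z)"
      by (rule square_power_nontrivial[of 0]) auto
    with comm[of \<rho> 0] \<open>c = []\<close> show False by simp
  qed
  have both: "s \<in> fst ` set c" for s
  proof (rule ccontr)
    assume "s \<notin> fst ` set c"
    have "fst ` set c \<subseteq> {if s = Gen_a then Gen_b else Gen_a}"
    proof
      fix x assume "x \<in> fst ` set c"
      then have "x \<noteq> s" using \<open>s \<notin> fst ` set c\<close> by metis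
      then show "x \<in> {if s = Gen_a then Gen_b else Gen_a}" by (cases x; cases s) simp_all
    qed
    from weight_single[OF _ this \<open>c \<noteq> []\<close>, of "expo (if s = Gen_a then Gen_b else Gen_a)"]
    show False using cc wc by (simp add: reduced_append_iff expo_def)
  qed
  obtain A l B where AB: "c = A @ l # B" and "fst l = Gen_a"
    using both[of Gen_a] by (auto dest: split_list)
  have "Gen_b \<in> fst ` set (l # B @ A)" using both[of Gen_b] by (auto simp add: AB image_Un)
  then have "\<exists>m\<in>set (l # B @ A). fst m = Gen_b" by (metis imageE)
  then obtain C m D where CmD: "l # B @ A = C @ m # D" "fst m = Gen_b" "\<forall>x\<in>set C. fst x \<noteq> Gen_b"
    by (rule split_list_first_propE) blast
  have "C \<noteq> []" using CmD \<open>fst l = Gen_a\<close> by (cases C) auto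
  \<comment> \<open>This rotation starts with a vertical and ends with a horizontal letter, as
    \<open>in_square_corner_walk\<close> requires.\<close>
  define c' where "c' = m # D @ C"
  have rot1: "l # B @ A = rotate (length A) c" using rotate_append[of A "l # B"] by (simp add: AB)
  have rot2: "c' = rotate (length C) (l # B @ A)"
    using rotate_append[of C "m # D"] CmD(1) by (simp add: c'_def)
  have rot3: "C @ m # D = rotate (length (m # D)) c'"
    using rotate_append[of "m # D" C] by (simp add: c'_def)
  have rot4: "c = rotate (length (l # B)) (l # B @ A)"
    using rotate_append[of "l # B" A] by (simp add: AB)
  have "reduced ((l # B @ A) @ l # B @ A)" using cc reduced_rotate[of A "l # B"] by (simp add: AB)
  then have red: "reduced (c' @ c')"
    using reduced_rotate[of C "m # D"] by (simp only: CmD c'_def append_assoc append_Cons)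
  have w': "weight (expo s) c' = 0" for s
    using wc[of s] arg_cong[OF CmD(1), of "weight (expo s)"] by (simp add: c'_def AB)
  have c': "c' = rotate (length C + length A) c" by (simp only: rot2 rot1 rotate_rotate)
  note comm' = comm[where n = "length C + length A", folded c']
  have levels: "\<exists>\<mu>. \<forall>x\<in>set (rew (expo t) t 0 c'). snd (fst x) \<in> {\<mu>, \<mu> + 1}" if "s \<noteq> t" for s t :: gen2
  proof -
    have l1: "fst (fst x) = s" if "x \<in> set (rew (expo t) t 0 c')" for x
    proof -
      have "fst (fst x) \<in> fst ` fst ` set (rew (expo t) t 0 c')" using that by blast
      then have "fst (fst x) \<noteq> t" by (simp add: set_rew)
      then show ?thesis using \<open>s \<noteq> t\<close> by (cases "fst (fst x)"; cases s; cases t) simp_all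
    qed
    have "set c' = set (C @ m # D)" by (auto simp: c'_def)
    also have "\<dots> = set c" unfolding CmD(1)[symmetric] by (auto simp: AB)
    finally have "s \<in> fst ` set c'" using both[of s] by simp
    then have "s \<in> fst ` fst ` set (rew (expo t) t 0 c')"
      using \<open>s \<noteq> t\<close> by (simp add: set_rew)
    then obtain \<mu> M where \<mu>: "(s, \<mu>) \<in> fst ` set (rew (expo t) t 0 c')"
      "(s, M) \<in> fst ` set (rew (expo t) t 0 c')"
      and range: "\<And>i. (s, i) \<in> fst ` set (rew (expo t) t 0 c') \<Longrightarrow> \<mu> \<le> i \<and> i \<le> M"
      by (rule level_bounds) blast
    have "M \<le> \<mu> + 1"
    proof (rule ccontr)
      assume "\<not> ?thesis"
      then have "\<mu> + 2 \<le> M" by simp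
      then obtain \<rho> :: "gen2 \<Rightarrow> (nat \<times> nat) \<times> nat \<Rightarrow> (nat \<times> nat) \<times> nat" where
        \<rho>: "perms \<rho>" "\<And>p. act \<rho> c' p = p" "\<exists>p. \<rho> s (\<rho> t p) \<noteq> \<rho> t (\<rho> s p)"
        using not_commuting_of_levels[OF red \<open>s \<noteq> t\<close> w'[of t] \<mu>] by blast
      then show False using comm'[OF \<rho>(1,2)] \<open>s \<noteq> t\<close>
        by (cases s; cases t) auto
    qed
    moreover have "\<mu> \<le> snd (fst x) \<and> snd (fst x) \<le> M" if "x \<in> set (rew (expo t) t 0 c')" for x
      using range[of "snd (fst x)"] l1[OF that] that by (metis image_eqI prod.collapse)
    ultimately show ?thesis by (intro exI[of _ \<mu>]) force
  qed
  obtain m0 where m0: "\<forall>x\<in>set (rew (expo Gen_b) Gen_b 0 c'). snd (fst x) \<in> {m0, m0 + 1}"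
    using levels[of Gen_a Gen_b] by auto
  obtain n0 where n0: "\<forall>x\<in>set (rew (expo Gen_a) Gen_a 0 c'). snd (fst x) \<in> {n0, n0 + 1}"
    using levels[of Gen_b Gen_a] by auto
  have sq: "in_square n0 m0 0 0 c'" by (rule in_square_of_levels[OF m0 n0])
  obtain d where m: "m = (Gen_b, d)" using CmD(2) by (cases m) auto
  have lastC: "fst (last C) = Gen_a" using CmD(3) \<open>C \<noteq> []\<close> last_in_set gen2_UNIV(2) by blast
  have sq': "in_square n0 m0 0 0 (c' @ [(Gen_b, d)])"
    unfolding in_square_append w' using sq by (simp add: c'_def m)
  have "0 \<in> {n0, n0 + 1}" using sq by (simp add: c'_def m)
  \<comment> \<open>Height 0 is one of the two rows because the closed path ends with a horizontal
    letter, traversed at height 0.\<close>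
  moreover have "0 \<in> {m0, m0 + 1}"
  proof -
    define u where "u = m # D @ butlast C"
    obtain e where e: "last C = (Gen_a, e)" using lastC by (cases "last C") auto
    have cu: "c' = u @ [(Gen_a, e)]"
      using append_butlast_last_id[OF \<open>C \<noteq> []\<close>] by (simp add: c'_def u_def e)
    have "weight (expo Gen_b) u = 0" using w'[of Gen_b] by (simp add: cu expo_def split: if_splits)
    then show ?thesis using sq by (simp add: cu in_square_append)
  qed
  moreover have "reduced (c' @ [(Gen_b, d)])"
  proof -
    have "c' @ c' = (c' @ [(Gen_b, d)]) @ D @ C" by (simp add: c'_def m)
    then show ?thesis using red reduced_append_iff by metis
  qed
  moreover have "fst (hd c') = Gen_b \<and> fst (last c') = Gen_a"
    using lastC \<open>C \<noteq> []\<close> by (simp add: c'_def m)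
  ultimately obtain k where k: "c' = corner_walk k (0 = n0 + 1) (0 = m0 + 1)"
    using in_square_corner_walk[OF _ sq'] by blast
  then have "even k" using w'[of Gen_a] corner_walk_weight by metis
  then obtain j where j: "k = 2 * j" by (rule evenE)
  have cj: "c' = concat (replicate j (corner_walk 2 (0 = n0 + 1) (0 = m0 + 1)))"
    using k corner_walk_even by (simp add: j)
  have "j = 1"
  proof (rule ccontr)
    assume "j \<noteq> 1"
    then obtain \<rho> :: "gen2 \<Rightarrow> complex \<Rightarrow> complex" where
      \<rho>: "perms \<rho>" "\<And>z. act \<rho> c' z = z" "\<exists>z. \<rho> Gen_a (\<rho> Gen_b z) \<noteq> \<rho> Gen_b (\<rho> Gen_a z)"
      using square_power_nontrivial[of j] unfolding cj by blast
    then show False using comm'[OF \<rho>(1,2)] by blast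
  qed
  then have "c' \<in> cyclic_conjugates aba'b' \<union> cyclic_conjugates bab'a'"
    using cj corner_walk_2 by simp
  then have "rotate n c' \<in> cyclic_conjugates aba'b' \<union> cyclic_conjugates bab'a'" for n
    using rotate_cyclic_conjugates by blast
  moreover have "c = rotate (length (l # B) + length (m # D)) c'"
    using rot4 rot3 CmD(1) by (metis rotate_rotate)
  ultimately show ?thesis unfolding c_def[symmetric] by (metis Un_iff)
qed

section \<open>Cochains on a finite quotient\<close>

definition wpow :: "'a word \<Rightarrow> nat \<Rightarrow> 'a word" where
  "wpow w n = concat (replicate n w)"

lemma wpow_simps [simp]: "wpow w 0 = []" "wpow w (Suc n) = w @ wpow w n"
  by (simp_all add: wpow_def)

lemma wpow_add: "wpow w (m + n) = wpow w m @ wpow w n"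
  by (induction m) auto

text \<open>As \<open>O1\<close> is invariant, the contributions of \<open>u\<close> and of its
  inverse are summed over the same set and cancel, and likewise for \<open>v\<close>. When
  \<open>u\<close> and \<open>v\<close> commute on a finite \<open>O1\<close>, the relator cells
  over it tile tori.\<close>

lemma torus_sum:
  fixes c :: "'a \<Rightarrow> 'x \<Rightarrow> 'm::ab_group_add"
  assumes \<rho>: "perms \<rho>" and u: "act \<rho> u ` O1 = O1" and v: "act \<rho> v ` O1 = O1"
  shows "(\<Sum>x\<in>O1. psum \<rho> c (u @ v @ inv_word u @ inv_word v) x) = 0"
proof -
  have re: "(\<Sum>x\<in>O1. g (act \<rho> w x)) = sum g O1" if "act \<rho> w ` O1 = O1" for g :: "'x \<Rightarrow> 'm" and w
    using that act_inj[OF \<rho>] by (subst sum.reindex_cong[of "act \<rho> w" O1 O1 g "\<lambda>x. g (act \<rho> w x)"])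
      (auto simp: inj_on_def)
  have inv_im: "act \<rho> (inv_word w) ` O1 = O1" if "act \<rho> w ` O1 = O1" for w
    by (subst that[symmetric]) (simp add: image_image act_inv_word1[OF \<rho>])
  have neg: "(\<Sum>x\<in>O1. psum \<rho> c (inv_word w) x) = - (\<Sum>x\<in>O1. psum \<rho> c w x)" if "act \<rho> w ` O1 = O1" for w
    by (subst re[OF that, symmetric]) (simp add: psum_inv_word[OF \<rho>] sum_negf)
  have im: "act \<rho> (w @ w') ` P = act \<rho> w ` act \<rho> w' ` P" for w w' P
    by (simp add: image_image act_append)
  have iuv: "act \<rho> (v @ inv_word u @ inv_word v) ` O1 = O1" "act \<rho> (inv_word u @ inv_word v) ` O1 = O1"
    using inv_im[OF u] inv_im[OF v] u v by (simp_all only: im)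
  show ?thesis
    using re[OF iuv(1), of "psum \<rho> c u"] re[OF iuv(2), of "psum \<rho> c v"]
      re[OF inv_im[OF v], of "psum \<rho> c (inv_word u)"] neg[OF u] neg[OF v]
    by (simp add: psum_append sum.distrib)
qed

lemma large_fibre:
  assumes "finite S" and "finite T" and "f \<in> S \<rightarrow> T" and "card T * b < card S"
  shows "\<exists>y\<in>T. b < card {x \<in> S. f x = y}"
proof (rule ccontr)
  assume "\<not> ?thesis"
  then have le: "card {x \<in> S. f x = y} \<le> b" if "y \<in> T" for y using that by force
  have "S = (\<Union>y\<in>T. {x \<in> S. f x = y})" using assms(3) by auto
  then have "card S \<le> (\<Sum>y\<in>T. card {x \<in> S. f x = y})"
    using card_UN_le[OF assms(2), of "\<lambda>y. {x \<in> S. f x = y}"] by simp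
  also have "\<dots> \<le> card T * b" using sum_bounded_above[of T _ b, OF le] by simp
  finally show False using assms(4) by simp
qed

text \<open>A pigeonhole argument: \<open>C\<close> collects the constraints to be met, and \<open>N f\<close> the values of a
  potential \<open>f\<close> that determine its coboundary on the edges \<open>E\<close>.\<close>

lemma noncoboundary_exists:
  fixes \<rho> :: "'a \<Rightarrow> 'x \<Rightarrow> 'x" and C :: "('a \<Rightarrow> 'x \<Rightarrow> 'm::ab_group_add) \<Rightarrow> 'c" and N :: "('x \<Rightarrow> 'm) \<Rightarrow> 'd"
  defines "S V E \<equiv> {c. (\<forall>a x. (a, x) \<in> E \<longrightarrow> c a x \<in> V) \<and> (\<forall>a x. (a, x) \<notin> E \<longrightarrow> c a x = 0)}"
  assumes \<rho>: "perms \<rho>" and fin: "finite E" "finite V" "finite TC" "finite TF"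
    and C: "\<And>c. c \<in> S V E \<Longrightarrow> C c \<in> TC"
    and N1: "\<And>c d f. c \<in> S V E \<Longrightarrow> d \<in> S V E \<Longrightarrow> (\<And>a x. c a x - d a x = f (\<rho> a x) - f x) \<Longrightarrow> N f \<in> TF"
    and N2: "\<And>f g a x. N f = N g \<Longrightarrow> (a, x) \<in> E \<Longrightarrow> f (\<rho> a x) - f x = g (\<rho> a x) - g x"
    and card: "card TC * card TF < card V ^ card E"
  obtains c d w x where "c \<in> S V E" "d \<in> S V E" "C c = C d" "act \<rho> w x = x"
    "psum \<rho> (\<lambda>a x. c a x - d a x) w x \<noteq> 0"
proof -
  define P where "P = (PiE E (\<lambda>_. V))"
  define G where "G g a x = (if (a, x) \<in> E then g (a, x) else 0)" for g :: "'a \<times> 'x \<Rightarrow> 'm" and a x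
  have GS: "G g \<in> S V E" if "g \<in> P" for g
    using that by (auto simp: S_def G_def P_def)
  have injG: "g = h" if "g \<in> P" "h \<in> P" "\<And>a x. (a, x) \<in> E \<Longrightarrow> G g a x = G h a x" for g h
  proof
    fix p
    show "g p = h p"
      using that PiE_arb[of g E "\<lambda>_. V" p] PiE_arb[of h E "\<lambda>_. V" p]
      by (cases p; cases "p \<in> E") (auto simp: G_def P_def)
  qed
  have finP: "finite P" using fin by (simp add: P_def finite_PiE)
  have cardP: "card P = card V ^ card E" using fin by (simp add: P_def card_PiE)
  \<comment> \<open>More than \<open>card TF\<close> cochains share their constraint values.
    Relative to one of them, \<open>h\<close>, they give too many differences for all to be
    coboundaries, since on \<open>E\<close> a coboundary is determined by an element of
    \<open>TF\<close>.\<close>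
  obtain y where y: "card TF < card {g \<in> P. C (G g) = y}"
    using large_fibre[OF finP fin(3), of "\<lambda>g. C (G g)" "card TF"] C GS card cardP by auto
  define Q where "Q = {g \<in> P. C (G g) = y}"
  have "Q \<noteq> {}" using y unfolding Q_def by (metis card.empty not_less0)
  then obtain h where h: "h \<in> Q" by blast
  have "\<exists>g\<in>Q. \<exists>w x. act \<rho> w x = x \<and> psum \<rho> (\<lambda>a x. G g a x - G h a x) w x \<noteq> 0"
  proof (rule ccontr)
    assume none: "\<not> ?thesis"
    have "\<exists>f. \<forall>a x. G g a x - G h a x = f (\<rho> a x) - f x" if "g \<in> Q" for g
      using coboundary_exists[OF \<rho>, of "\<lambda>a x. G g a x - G h a x"] none that by blast
    then obtain F where F: "\<And>g a x. g \<in> Q \<Longrightarrow> G g a x - G h a x = F g (\<rho> a x) - F g x" by metis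
    have "inj_on (\<lambda>g. N (F g)) Q"
    proof (rule inj_onI)
      fix g1 g2 assume g: "g1 \<in> Q" "g2 \<in> Q" "N (F g1) = N (F g2)"
      show "g1 = g2"
      proof (rule injG)
        fix a x assume "(a, x) \<in> E"
        then have "G g1 a x - G h a x = G g2 a x - G h a x"
          unfolding F[OF g(1)] F[OF g(2)] by (rule N2[OF g(3)])
        then show "G g1 a x = G g2 a x" by simp
      qed (use g in \<open>auto simp: Q_def\<close>)
    qed
    moreover have "(\<lambda>g. N (F g)) ` Q \<subseteq> TF"
    proof safe
      fix g assume g: "g \<in> Q"
      show "N (F g) \<in> TF"
        by (rule N1[of "G g" "G h"]) (use g h F[OF g] GS in \<open>auto simp: Q_def\<close>)
    qed
    ultimately have "card Q \<le> card TF" using fin(4) card_inj_on_le by blast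
    with y show False by (simp add: Q_def)
  qed
  then obtain g w x where "g \<in> Q" "act \<rho> w x = x" "psum \<rho> (\<lambda>a x. G g a x - G h a x) w x \<noteq> 0"
    by blast
  then show thesis using that[of "G g" "G h" w x] GS h by (auto simp: Q_def)
qed

section \<open>Finite permutation quotients and integral characters\<close>

lemma finite_gen2 [simp]: "finite (UNIV :: gen2 set)" and card_gen2: "card (UNIV :: gen2 set) = 2"
proof -
  have *: "UNIV = {Gen_a, Gen_b}" using gen2.exhaust by auto
  show "finite (UNIV :: gen2 set)" "card (UNIV :: gen2 set) = 2" by (simp_all only: *) simp_all
qed

text \<open>The Cayley or Schreier graph of a finite quotient, encoded by permutations of
  \<open>nat\<close> that preserve the numbers below \<open>n\<close>, so that no type depends on
  the group. \<open>A\<close> and its complement below \<open>n\<close> are the two pieces invariant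
  under \<open>u\<close> and \<open>v\<close>; \<open>j1\<close> and \<open>j2\<close> mark the
  relator cell that becomes redundant in each.\<close>

locale finite_quotient =
  fixes \<sigma> :: "gen2 \<Rightarrow> nat \<Rightarrow> nat" and n :: nat and u v :: "gen2 word"
    and A :: "nat set" and j1 j2 :: nat
  assumes \<sigma>: "perms \<sigma>" and range: "\<And>s j. j < n \<longleftrightarrow> \<sigma> s j < n"
    and transitive: "\<And>j k. j < n \<Longrightarrow> k < n \<Longrightarrow> \<exists>w. act \<sigma> w j = k"
    and relator: "\<And>j. act \<sigma> (u @ v @ inv_word u @ inv_word v) j = j"
    and A: "act \<sigma> u ` A = A" "act \<sigma> v ` A = A" "A \<subseteq> {..<n}"
    and j1: "j1 \<in> A" and j2: "j2 < n" "j2 \<notin> A"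
begin

definition rel :: "gen2 word" where
  "rel = u @ v @ inv_word u @ inv_word v"

lemma j1_less: "j1 < n"
  using j1 A(3) by auto

lemma n_ge_2: "n \<ge> 2"
proof -
  have "j1 \<noteq> j2" using j1 j2 by auto
  then show ?thesis using j1_less j2(1) by linarith
qed

lemma inv_range: "inv_into UNIV (\<sigma> s) j < n \<longleftrightarrow> j < n"
  using range[of "inv_into UNIV (\<sigma> s) j" s] \<sigma> by simp

lemma act_range: "act \<sigma> w j < n \<longleftrightarrow> j < n"
proof (induction w)
  case (Cons l w)
  then show ?case using range[of "act \<sigma> w j" "fst l"] inv_range by auto
qed simp

lemma psum_outside:
  assumes "\<And>s j. j \<ge> n \<Longrightarrow> c s j = 0" and "j \<ge> n"
  shows "psum \<sigma> c w j = (0 :: 'm::group_add)"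
proof (induction w)
  case (Cons l w)
  have "\<not> act \<sigma> w j < n" using assms(2) by (simp add: act_range)
  then have "act \<sigma> w j \<ge> n" "inv_into UNIV (\<sigma> (fst l)) (act \<sigma> w j) \<ge> n"
    using inv_range by (meson leI)+
  with Cons show ?case by (simp add: assms(1))
qed simp

lemma act_wpow_return: "\<exists>p>0. act \<sigma> (wpow w p) j1 = j1"
proof -
  have "(\<lambda>k. act \<sigma> (wpow w k) j1) ` UNIV \<subseteq> {..<n}" using j1_less by (auto simp: act_range)
  then have "finite (range (\<lambda>k. act \<sigma> (wpow w k) j1))" by (rule finite_subset) simp
  then have "\<not> inj (\<lambda>k. act \<sigma> (wpow w k) j1)" using finite_imageD by blast
  then obtain k l where kl: "k < l" "act \<sigma> (wpow w k) j1 = act \<sigma> (wpow w l) j1"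
    unfolding inj_def by (metis linorder_neqE_nat)
  have "act \<sigma> (wpow w k) (act \<sigma> (wpow w (l - k)) j1) = act \<sigma> (wpow w k) j1"
    using kl wpow_add[of w k "l - k"] by (simp add: act_append[symmetric])
  then show ?thesis using kl(1) by (intro exI[of _ "l - k"]) (simp add: act_inj[OF \<sigma>])
qed

lemma complement_invariant:
  assumes "act \<sigma> w ` A = A"
  shows "act \<sigma> w ` ({..<n} - A) = {..<n} - A"
proof -
  have "act \<sigma> w ` {..<n} = {..<n}"
    by (rule endo_inj_surj) (auto simp: act_range inj_on_def act_inj[OF \<sigma>])
  then show ?thesis
    using assms A(3) by (subst inj_on_image_set_diff[of _ UNIV]) (auto simp: inj_on_def act_inj[OF \<sigma>])
qed

text \<open>By \<open>torus_sum\<close> over \<open>A\<close> and over its complement, the relator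
  values at \<open>j1\<close> and \<open>j2\<close> are determined by the others.\<close>

lemma relator_sums:
  fixes c :: "gen2 \<Rightarrow> nat \<Rightarrow> 'm::ab_group_add"
  assumes c0: "\<And>s j. j \<ge> n \<Longrightarrow> c s j = 0"
    and "\<And>j. j < n \<Longrightarrow> j \<noteq> j1 \<Longrightarrow> j \<noteq> j2 \<Longrightarrow> psum \<sigma> c rel j = 0"
  shows "psum \<sigma> c rel j = 0"
proof -
  have fin: "finite A" using A(3) finite_subset by blast
  have s1: "psum \<sigma> c rel j1 = 0"
  proof -
    have "(\<Sum>j\<in>A. psum \<sigma> c rel j) = psum \<sigma> c rel j1 + (\<Sum>j\<in>A - {j1}. psum \<sigma> c rel j)"
      using fin j1 by (rule sum.remove)
    moreover have "(\<Sum>j\<in>A - {j1}. psum \<sigma> c rel j) = 0"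
      using assms(2) A(3) j2(2) by (intro sum.neutral) auto
    ultimately show ?thesis using torus_sum[OF \<sigma> A(1,2), of c] by (simp add: rel_def)
  qed
  have s2: "psum \<sigma> c rel j2 = 0"
  proof -
    let ?B = "{..<n} - A"
    have "(\<Sum>j\<in>?B. psum \<sigma> c rel j) = psum \<sigma> c rel j2 + (\<Sum>j\<in>?B - {j2}. psum \<sigma> c rel j)"
      using j2 by (intro sum.remove) auto
    moreover have "(\<Sum>j\<in>?B - {j2}. psum \<sigma> c rel j) = 0"
      using assms(2) j1 by (intro sum.neutral) auto
    ultimately show ?thesis
      using torus_sum[OF \<sigma> complement_invariant[OF A(1)] complement_invariant[OF A(2)], of c]
      by (simp add: rel_def)
  qed
  show ?thesis using assms(2)[of j] s1 s2 psum_outside[of c j, OF c0] by (cases "j < n") auto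
qed

text \<open>Degrees of freedom: \<open>2 * n\<close> edges, against \<open>n - 2\<close> relators
  left after dropping those at \<open>j1\<close> and \<open>j2\<close>, two conditions for the
  powers of \<open>u\<close> and \<open>v\<close>, and \<open>n - 1\<close> values of a potential up
  to a constant. One degree remains. As in Siegel's lemma, integer cochains with entries below a
  large \<open>m\<close> are counted instead.\<close>

lemma character_exists:
  obtains \<chi> :: "gen2 \<Rightarrow> nat \<Rightarrow> int" and p q w j where
    "\<And>s j. j \<ge> n \<Longrightarrow> \<chi> s j = 0" and "\<And>j. psum \<sigma> \<chi> rel j = 0"
    and "p > 0" "act \<sigma> (wpow u p) j1 = j1" "psum \<sigma> \<chi> (wpow u p) j1 = 0"
    and "q > 0" "act \<sigma> (wpow v q) j1 = j1" "psum \<sigma> \<chi> (wpow v q) j1 = 0"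
    and "act \<sigma> w j = j" "psum \<sigma> \<chi> w j \<noteq> 0"
proof -
  obtain p where p: "p > 0" "act \<sigma> (wpow u p) j1 = j1" using act_wpow_return by blast
  obtain q where q: "q > 0" "act \<sigma> (wpow v q) j1 = j1" using act_wpow_return by blast
  obtain W where W: "\<And>j. j < n \<Longrightarrow> act \<sigma> (W j) j1 = j" using transitive[OF j1_less] by metis
  \<comment> \<open>\<open>b\<close> bounds the length of every word summed along, so the sums have
    size at most \<open>b * m\<close>. With \<open>m\<close> above
    \<open>(2 * b + 1) ^ (2 * n - 1)\<close>, the choices for \<open>2 * n\<close> entries outnumber
    those for \<open>2 * n - 1\<close> such sums.\<close>
  define b where "b = length rel + length (wpow u p) + length (wpow v q) + (\<Sum>j<n. length (W j))"
  have bW: "length (W j) \<le> b" if "j < n" for j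
    using member_le_sum[of j "{..<n}" "\<lambda>j. length (W j)"] that by (simp add: b_def)
  define m where "m = (2 * b + 1) ^ (2 * n - 1) + 1"
  define K where "K = int (b * m)"
  define E where "E = (UNIV :: gen2 set) \<times> {..<n}"
  define V where "V = {0..<int m}"
  define T where "T = {- K..K}"
  define J where "J = {..<n} - {j1, j2}"
  define C where "C c = (restrict (psum \<sigma> c rel) J, psum \<sigma> c (wpow u p) j1, psum \<sigma> c (wpow v q) j1)"
    for c :: "gen2 \<Rightarrow> nat \<Rightarrow> int"
  \<comment> \<open>A potential matters only up to a constant, so it is normalised at
    \<open>j1\<close>.\<close>
  define N where "N f = restrict (\<lambda>j. f j - f j1) ({..<n} - {j1})" for f :: "nat \<Rightarrow> int"
  let ?S = "{c. (\<forall>a x. (a, x) \<in> E \<longrightarrow> c a x \<in> V) \<and> (\<forall>a x. (a, x) \<notin> E \<longrightarrow> c a x = 0)}"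
  have bound: "\<bar>psum \<sigma> c w j\<bar> \<le> K" if "\<And>a x. \<bar>c a x\<bar> \<le> int m" "length w \<le> b" for c w j
  proof -
    have "\<bar>psum \<sigma> c w j\<bar> \<le> int (length w) * int m" by (rule psum_bound[OF that(1)])
    moreover have "int (length w) * int m \<le> K"
      using that(2) unfolding K_def by (simp add: mult_right_mono flip: of_nat_mult)
    ultimately show ?thesis by linarith
  qed
  have S_bound: "\<bar>c a x\<bar> \<le> int m" if "c \<in> ?S" for c a x
  proof (cases "(a, x) \<in> E")
    case True
    then have "c a x \<in> V" using that by blast
    then show ?thesis by (simp add: V_def)
  next
    case False
    then have "c a x = 0" using that by blast
    then show ?thesis by simp
  qed
  have "j1 \<noteq> j2" using j1 j2 by auto
  then have cardJ: "card J = n - 2"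
    using j1_less j2 by (simp add: J_def card_Diff_subset)
  have card: "card (PiE J (\<lambda>_. T) \<times> T \<times> T) * card (PiE ({..<n} - {j1}) (\<lambda>_. T)) < card V ^ card E"
  proof -
    have cT: "card T = 2 * (b * m) + 1" by (simp add: T_def K_def nat_add_distrib nat_mult_distrib)
    have "card (PiE J (\<lambda>_. T) \<times> T \<times> T) * card (PiE ({..<n} - {j1}) (\<lambda>_. T)) =
        card T ^ (n - 2) * (card T * card T) * card T ^ (n - 1)"
      using j1_less by (simp add: card_cartesian_product card_PiE J_def cardJ[unfolded J_def])
    also have "\<dots> = card T ^ (n - 2 + 2 + (n - 1))"
      by (simp only: power_add power2_eq_square)
    also have "n - 2 + 2 + (n - 1) = 2 * n - 1" using n_ge_2 by simp
    also have "card T ^ (2 * n - 1) \<le> ((2 * b + 1) * m) ^ (2 * n - 1)"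
      unfolding cT by (intro power_mono) (auto simp: m_def algebra_simps)
    also have "\<dots> = (2 * b + 1) ^ (2 * n - 1) * m ^ (2 * n - 1)" by (simp only: power_mult_distrib)
    also have "\<dots> < m * m ^ (2 * n - 1)" by (intro mult_strict_right_mono) (auto simp: m_def)
    also have "\<dots> = m ^ (2 * n)" using n_ge_2 by (simp flip: power_Suc)
    finally show ?thesis by (simp add: V_def E_def card_cartesian_product card_gen2)
  qed
  obtain c d w j where c: "c \<in> ?S" and d: "d \<in> ?S" and CC: "C c = C d" and w: "act \<sigma> w j = j"
    "psum \<sigma> (\<lambda>a x. c a x - d a x) w j \<noteq> 0"
  proof (rule noncoboundary_exists[OF \<sigma>, of E V "PiE J (\<lambda>_. T) \<times> T \<times> T" "PiE ({..<n} - {j1}) (\<lambda>_. T)" C N])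
    show "finite E" "finite V" "finite (PiE J (\<lambda>_. T) \<times> T \<times> T)" "finite (PiE ({..<n} - {j1}) (\<lambda>_. T))"
      by (auto simp: E_def V_def J_def T_def intro!: finite_PiE)
    show "C c \<in> PiE J (\<lambda>_. T) \<times> T \<times> T" if "c \<in> ?S" for c
    proof -
      have "\<bar>psum \<sigma> c w j\<bar> \<le> K" if "w \<in> {rel, wpow u p, wpow v q}" for w j
        using that by (intro bound S_bound[OF \<open>c \<in> ?S\<close>]) (auto simp: b_def)
      then show ?thesis unfolding C_def T_def by (auto simp: abs_le_iff minus_le_iff)
    qed
    show "N f \<in> PiE ({..<n} - {j1}) (\<lambda>_. T)"
      if "c \<in> ?S" "d \<in> ?S" "\<And>a x. c a x - d a x = f (\<sigma> a x) - f x" for c d f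
    proof -
      have "f j - f j1 \<in> T" if "j < n" for j
      proof -
        \<comment> \<open>By transitivity the normalised potential at \<open>j\<close> is a label
          sum along the fixed path \<open>W j\<close>, hence bounded.\<close>
        have "psum \<sigma> (\<lambda>a x. c a x - d a x) (W j) j1 = f j - f j1"
          using psum_coboundary[OF \<sigma>, of "\<lambda>a x. c a x - d a x" f "W j" j1] W[OF that]
          by (simp add: \<open>\<And>a x. c a x - d a x = f (\<sigma> a x) - f x\<close>)
        moreover have "\<bar>c a x - d a x\<bar> \<le> int m" for a x
        proof (cases "(a, x) \<in> E")
          case True
          then have "c a x \<in> V" "d a x \<in> V" using \<open>c \<in> ?S\<close> \<open>d \<in> ?S\<close> by blast+
          then show ?thesis by (auto simp: V_def)
        next
          case False
          then have "c a x = 0" "d a x = 0" using \<open>c \<in> ?S\<close> \<open>d \<in> ?S\<close> by blast+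
          then show ?thesis by simp
        qed
        ultimately have "\<bar>f j - f j1\<bar> \<le> K" using bound[of "\<lambda>a x. c a x - d a x" "W j" j1] bW[OF that] by simp
        then show ?thesis by (auto simp: T_def)
      qed
      then show ?thesis by (auto simp: N_def)
    qed
    show "f (\<sigma> a x) - f x = g (\<sigma> a x) - g x" if "N f = N g" "(a, x) \<in> E" for f g a x
    proof -
      have "f y - f j1 = g y - g j1" if "y < n" for y
        using fun_cong[OF \<open>N f = N g\<close>, of y] that by (cases "y = j1") (auto simp: N_def)
      from this[of x] this[of "\<sigma> a x"] show ?thesis using that(2) range[of x a] by (auto simp: E_def)
    qed
  qed (use card in auto)
  define \<chi> where "\<chi> a x = c a x - d a x" for a x
  have \<chi>0: "\<chi> a x = 0" if "x \<ge> n" for a x using c d that by (auto simp: \<chi>_def E_def)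
  have psum_\<chi>: "psum \<sigma> \<chi> w j = psum \<sigma> c w j - psum \<sigma> d w j" for w j
    unfolding \<chi>_def by (rule psum_diff)
  have rel': "psum \<sigma> \<chi> rel j = 0" if "j < n" "j \<noteq> j1" "j \<noteq> j2" for j
  proof -
    have "restrict (psum \<sigma> c rel) J j = restrict (psum \<sigma> d rel) J j" using CC by (simp add: C_def)
    then show ?thesis using that by (simp add: psum_\<chi> J_def)
  qed
  have "psum \<sigma> \<chi> rel j = 0" for j
    by (rule relator_sums) (use \<chi>0 rel' in auto)
  moreover have "psum \<sigma> \<chi> (wpow u p) j1 = 0" "psum \<sigma> \<chi> (wpow v q) j1 = 0"
    using CC by (auto simp: psum_\<chi> C_def)
  moreover have "psum \<sigma> \<chi> w j \<noteq> 0" using w(2) unfolding \<chi>_def .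
  ultimately show thesis using that[of \<chi> p q w j] \<chi>0 p q w(1) by blast
qed

end

section \<open>The infinite cyclic cover and a mod 2 cocycle of finite support\<close>

definition cover :: "('a \<Rightarrow> 'x \<Rightarrow> 'x) \<Rightarrow> ('a \<Rightarrow> 'x \<Rightarrow> 'm::group_add) \<Rightarrow> 'a \<Rightarrow> 'x \<times> 'm \<Rightarrow> 'x \<times> 'm" where
  "cover \<sigma> c s y = (\<sigma> s (fst y), c s (fst y) + snd y)"

lemma inv_cover:
  assumes "perms \<sigma>"
  shows "perms (cover \<sigma> c)"
    and "inv_into UNIV (cover \<sigma> c s) y =
      (inv_into UNIV (\<sigma> s) (fst y), - c s (inv_into UNIV (\<sigma> s) (fst y)) + snd y)"
proof -
  let ?g = "\<lambda>s y. (inv_into UNIV (\<sigma> s) (fst y), - c s (inv_into UNIV (\<sigma> s) (fst y)) + snd y)"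
  show p: "perms (cover \<sigma> c)"
    by (rule permsI[of ?g]) (auto simp: cover_def assms add.assoc[symmetric])
  have "cover \<sigma> c s (?g s y) = y" by (simp add: cover_def assms add.assoc[symmetric])
  then show "inv_into UNIV (cover \<sigma> c s) y = ?g s y"
    using p unfolding perms_def by (metis bij_inv_eq_iff)
qed

text \<open>The skew product lifts a path by recording its label sum. It is used for the infinite
  cyclic cover given by \<open>\<chi>\<close> and again for the double cover given by a mod 2
  cocycle.\<close>

lemma act_cover:
  "perms \<sigma> \<Longrightarrow> act (cover \<sigma> c) w y = (act \<sigma> w (fst y), psum \<sigma> c w (fst y) + snd y)"
  by (induction w) (simp_all add: inv_cover(2) add.assoc, simp_all add: cover_def add.assoc)

lemma psum_eq_0:
  assumes "\<And>p q s. w = p @ (s, True) # q \<Longrightarrow> c s (act \<sigma> q x) = 0"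
    and "\<And>p q s. w = p @ (s, False) # q \<Longrightarrow> c s (act \<sigma> ((s, False) # q) x) = 0"
  shows "psum \<sigma> c w x = (0 :: 'm::group_add)"
  using assms
proof (induction w)
  case (Cons l w)
  have "psum \<sigma> c w x = 0"
    by (rule Cons.IH) (use Cons.prems(1)[of "l # _"] Cons.prems(2)[of "l # _"] in simp_all)
  moreover have "(if snd l then c (fst l) (act \<sigma> w x) else - c (fst l) (inv_into UNIV (\<sigma> (fst l)) (act \<sigma> w x))) = 0"
    using Cons.prems(1)[of "[]" "fst l" w] Cons.prems(2)[of "[]" "fst l" w] by (cases l) simp
  ultimately show ?case by simp
qed simp

context finite_quotient
begin

text \<open>Since \<open>\<chi>\<close> vanishes on the relator, \<open>u\<close> and
  \<open>v\<close> still commute on the cover, and since it vanishes on their powers at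
  \<open>j1\<close>, the point \<open>(j1, 0)\<close> has a finite orbit under them. Every translate
  of this orbit saves the relator at its point above \<open>j1\<close>. A window of length
  \<open>L\<close> then has \<open>2 * n * L\<close> edges against about \<open>(n - 1) * L\<close>
  relators and \<open>n * L\<close> potential values, which leaves a non-trivial class for large
  \<open>L\<close>.\<close>

lemma flow_exists:
  assumes \<chi>0: "\<And>s j. j \<ge> n \<Longrightarrow> \<chi> s j = 0" and \<chi>rel: "\<And>j. psum \<sigma> \<chi> rel j = 0"
    and p: "p > 0" "act \<sigma> (wpow u p) j1 = j1" "psum \<sigma> \<chi> (wpow u p) j1 = 0"
    and q: "q > 0" "act \<sigma> (wpow v q) j1 = j1" "psum \<sigma> \<chi> (wpow v q) j1 = 0"
    and D: "\<And>s j. \<bar>\<chi> s j\<bar> \<le> int D"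
  obtains \<xi> :: "gen2 \<Rightarrow> nat \<times> int \<Rightarrow> bit" and L w y where
    "\<And>s j k. \<xi> s (j, k) \<noteq> 0 \<Longrightarrow> j < n \<and> 0 \<le> k \<and> k < int L"
    "\<And>y. psum (cover \<sigma> \<chi>) \<xi> rel y = 0"
    "act (cover \<sigma> \<chi>) w y = y" "psum (cover \<sigma> \<chi>) \<xi> w y \<noteq> 0"
proof -
  let ?c = "cover \<sigma> \<chi>"
  note pc = inv_cover(1)[OF \<sigma>, of \<chi>]
  have ac: "act ?c w y = (act \<sigma> w (fst y), snd y + psum \<sigma> \<chi> w (fst y))" for w y
    by (simp add: act_cover[OF \<sigma>])
  have act_rel: "act ?c rel y = y" for y
    by (cases y) (simp add: ac \<chi>rel relator[folded rel_def])
  have comm: "act ?c u (act ?c v y) = act ?c v (act ?c u y)" for y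
  proof -
    have "act ?c rel (act ?c v (act ?c u y)) = act ?c u (act ?c v y)"
      by (simp add: rel_def act_append act_inv_word1[OF pc])
    then show ?thesis by (simp only: act_rel)
  qed
  define U where "U a y = act ?c (wpow u a) y" for a y
  define W where "W b y = act ?c (wpow v b) y" for b y
  have U: "U 0 y = y" "U (Suc a) y = act ?c u (U a y)" for a y
    by (simp_all add: U_def act_append)
  have W: "W 0 y = y" "W (Suc b) y = act ?c v (W b y)" for b y
    by (simp_all add: W_def act_append)
  have uU: "U a (act ?c u y) = act ?c u (U a y)" for a y by (induction a) (simp_all add: U)
  have vW: "W b (act ?c v y) = act ?c v (W b y)" for b y by (induction b) (simp_all add: W)
  have vU: "act ?c v (U a y) = U a (act ?c v y)" for a y by (induction a) (simp_all add: U comm[symmetric])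
  have uW: "act ?c u (W b y) = W b (act ?c u y)" for b y by (induction b) (simp_all add: W comm)
  have UW: "U a (W b y) = W b (U a y)" for a b y by (induction b) (simp_all add: W vU[symmetric])
  define z where "z = (j1, 0 :: int)"
  have Up: "U p z = z" and Wq: "W q z = z" using p q by (simp_all add: U_def W_def ac z_def)
  \<comment> \<open>A rectangle of \<open>p\<close> by \<open>q\<close> steps already exhausts the
    orbit of \<open>z\<close>.\<close>
  define O1 where "O1 = (\<lambda>(a, b). U a (W b z)) ` ({..<p} \<times> {..<q})"
  have fin: "finite O1" by (simp add: O1_def)
  have z_O: "z \<in> O1" unfolding O1_def using p(1) q(1) by (intro image_eqI[of _ _ "(0, 0)"]) (auto simp: U W)
  have inO: "U a (W b z) \<in> O1" if "a \<le> p" "b \<le> q" for a b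
  proof -
    have 1: "U a (W b z) = U (if a = p then 0 else a) (W b z)" for b
    proof (cases "a = p")
      case True
      then show ?thesis using UW[of p b z] by (simp add: Up U)
    qed simp
    have 2: "W b z = W (if b = q then 0 else b) z" by (simp add: Wq W)
    show ?thesis
      unfolding 1 using that p(1) q(1)
      by (subst 2) (auto simp: O1_def intro!: image_eqI[of _ _ "(if a = p then 0 else a, if b = q then 0 else b)"])
  qed
  have endo: "act ?c w ` O1 = O1" if "\<And>y. y \<in> O1 \<Longrightarrow> act ?c w y \<in> O1" for w
    by (rule endo_inj_surj[OF fin]) (use that in \<open>auto simp: inj_on_def act_inj[OF pc]\<close>)
  have uO: "act ?c u y \<in> O1" if "y \<in> O1" for y
  proof -
    from that obtain a b where "y = U a (W b z)" "a < p" "b < q" by (auto simp: O1_def)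
    then show ?thesis using inO[of "Suc a" b] by (simp add: U)
  qed
  have vO: "act ?c v y \<in> O1" if "y \<in> O1" for y
  proof -
    from that obtain a b where "y = U a (W b z)" "a < p" "b < q" by (auto simp: O1_def)
    then show ?thesis using inO[of a "Suc b"] by (simp add: W vU)
  qed
  have sh: "act ?c w (j, k + l) = (fst (act ?c w (j, k)), snd (act ?c w (j, k)) + l)" for w j k l
    by (simp add: ac)
  \<comment> \<open>A word carrying \<open>(j1, 0)\<close> to a different height over
    \<open>j1\<close> could be iterated, and the orbit would contain infinitely many
    heights.\<close>
  have single: "l = 0" if "(j1, l) \<in> O1" for l
  proof (rule ccontr)
    assume "l \<noteq> 0"
    from that obtain a b where ab: "U a (W b z) = (j1, l)" by (auto simp: O1_def)
    define g where "g = wpow u a @ wpow v b"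
    have g: "act ?c g (j1, 0) = (j1, l)" using ab by (simp add: g_def act_append U_def W_def z_def)
    have "U a y \<in> O1" if "y \<in> O1" for a y using that uO by (induction a) (simp_all add: U)
    moreover have "W b y \<in> O1" if "y \<in> O1" for b y using that vO by (induction b) (simp_all add: W)
    ultimately have gO: "act ?c g y \<in> O1" if "y \<in> O1" for y
      using that by (simp add: g_def act_append U_def W_def)
    have "(j1, int t * l) \<in> O1" for t
    proof (induction t)
      case 0
      then show ?case using z_O by (simp add: z_def)
    next
      case (Suc t)
      have "act ?c g (j1, int t * l) = (j1, int (Suc t) * l)"
        using sh[of g j1 0 "int t * l"] g by (simp add: algebra_simps)
      then show ?case using gO[OF Suc] by simp
    qed
    then have "range (\<lambda>t. (j1, int t * l)) \<subseteq> O1" by auto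
    then have "finite (range (\<lambda>t. (j1, int t * l)))" using fin by (rule finite_subset)
    moreover have "inj (\<lambda>t. (j1, int t * l))" using \<open>l \<noteq> 0\<close> by (auto simp: inj_def)
    ultimately show False using finite_imageD by blast
  qed
  \<comment> \<open>The orbit translated by \<open>l\<close> has exactly one point over
    \<open>j1\<close>, so \<open>torus_sum\<close> determines the relator value there from values
    over other vertices.\<close>
  have redundant: "psum ?c f rel (j1, l) = 0"
    if "\<And>j k. j \<noteq> j1 \<Longrightarrow> psum ?c f rel (j, k) = 0" for f :: "gen2 \<Rightarrow> nat \<times> int \<Rightarrow> bit" and l
  proof -
    define \<tau> where "\<tau> y = (fst y, snd y + l)" for y :: "nat \<times> int"
    have inj: "inj \<tau>" by (auto simp: inj_def \<tau>_def prod_eq_iff)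
    have com: "act ?c w (\<tau> y) = \<tau> (act ?c w y)" for w y
      by (simp add: \<tau>_def ac)
    have im: "act ?c w ` \<tau> ` O1 = \<tau> ` O1" if "act ?c w ` O1 = O1" for w
      by (subst (2) that[symmetric]) (simp add: image_image com)
    have "(\<Sum>y\<in>\<tau> ` O1. psum ?c f rel y) = 0"
      unfolding rel_def by (rule torus_sum[OF pc]) (use im endo uO vO in blast)+
    moreover have "(\<Sum>y\<in>\<tau> ` O1. psum ?c f rel y) =
        psum ?c f rel (\<tau> z) + (\<Sum>y\<in>\<tau> ` O1 - {\<tau> z}. psum ?c f rel y)"
      using fin z_O by (intro sum.remove) auto
    moreover have "(\<Sum>y\<in>\<tau> ` O1 - {\<tau> z}. psum ?c f rel y) = 0"
    proof (rule sum.neutral, rule ballI)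
      fix y assume "y \<in> \<tau> ` O1 - {\<tau> z}"
      then obtain x where x: "x \<in> O1" "y = \<tau> x" "x \<noteq> z" by auto
      then have "fst x \<noteq> j1" using single[of "snd x"] by (cases x) (auto simp: z_def)
      then show "psum ?c f rel y = 0" using that x(2) by (simp add: \<tau>_def)
    qed
    ultimately show ?thesis by (simp add: \<tau>_def z_def)
  qed
  \<comment> \<open>A relator path changes height by at most \<open>D1\<close>, so relators based
    farther than that from the window do not meet it. The value of \<open>L\<close> exceeds the
    boundary terms \<open>2 * (n - 1) * D1 + 2 * n * D\<close> of the count.\<close>
  define D1 where "D1 = length rel * D"
  define L where "L = 2 * n * D1 + 2 * n * D + 1"
  define E where "E = (UNIV :: gen2 set) \<times> ({..<n} \<times> {0..<int L})"
  define J where "J = ({..<n} - {j1}) \<times> {- int D1..<int L + int D1}"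
  \<comment> \<open>A generator changes the height by at most \<open>D\<close>, so \<open>F\<close>
    contains both ends of every edge of the window.\<close>
  define F where "F = {..<n} \<times> {- int D..<int L + int D}"
  define C where "C f = restrict (psum ?c f rel) J" for f :: "gen2 \<Rightarrow> nat \<times> int \<Rightarrow> bit"
  define N where "N f = restrict f F" for f :: "nat \<times> int \<Rightarrow> bit"
  let ?V = "UNIV :: bit set"
  let ?S = "{c. (\<forall>a x. (a, x) \<in> E \<longrightarrow> c a x \<in> ?V) \<and> (\<forall>a x. (a, x) \<notin> E \<longrightarrow> c a x = 0)}"
  have Vbit: "?V = {0, 1}" using bit_not_zero_iff by auto
  have fV: "finite ?V" and cV: "card ?V = 2" unfolding Vbit by simp_all
  have card: "card (PiE J (\<lambda>_. ?V)) * card (PiE F (\<lambda>_. ?V)) < card ?V ^ card E"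
  proof -
    have "card {- int d..<int L + int d} = L + 2 * d" for d
      by (simp add: nat_add_distrib nat_mult_distrib)
    then have "card J = (n - 1) * (L + 2 * D1)" "card F = n * (L + 2 * D)"
      using j1_less by (simp_all add: J_def F_def card_cartesian_product)
    moreover have "card E = 2 * (n * L)" by (simp add: E_def card_cartesian_product card_gen2)
    moreover have "(n - 1) * (L + 2 * D1) + n * (L + 2 * D) < 2 * (n * L)"
    proof -
      obtain n' where n': "n = Suc n'" using n_ge_2 by (cases n) auto
      show ?thesis unfolding n' L_def by (simp add: algebra_simps)
    qed
    moreover have "finite J" "finite F" by (simp_all add: J_def F_def)
    then have "card (PiE J (\<lambda>_. ?V)) = 2 ^ card J" "card (PiE F (\<lambda>_. ?V)) = 2 ^ card F"
      by (simp_all add: card_PiE cV)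
    ultimately show ?thesis by (simp add: cV flip: power_add)
  qed
  obtain c d w y where c: "c \<in> ?S" and d: "d \<in> ?S" and CC: "C c = C d" and w: "act ?c w y = y"
    "psum ?c (\<lambda>a x. c a x - d a x) w y \<noteq> 0"
  proof (rule noncoboundary_exists[OF pc, of E ?V "PiE J (\<lambda>_. ?V)" "PiE F (\<lambda>_. ?V)" C N])
    show "finite E" "finite ?V" "finite (PiE J (\<lambda>_. ?V))" "finite (PiE F (\<lambda>_. ?V))"
      by (auto simp: E_def J_def F_def fV intro!: finite_PiE)
    show "f (?c a x) - f x = g (?c a x) - g x" if "N f = N g" "(a, x) \<in> E" for f g a x
    proof -
      have eq: "f y = g y" if "y \<in> F" for y
        using fun_cong[OF \<open>N f = N g\<close>, of y] that by (simp add: N_def)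
      obtain j k where x: "x = (j, k)" by (cases x)
      have "x \<in> F" using that(2) by (auto simp: E_def F_def x)
      moreover have "?c a x \<in> F"
        using that(2) range[of j a] D[of a j] by (auto simp: E_def F_def x cover_def)
      ultimately show ?thesis by (simp add: eq)
    qed
  qed (use card in \<open>auto simp: C_def N_def\<close>)
  define \<xi> where "\<xi> a x = c a x - d a x" for a x
  have \<xi>0: "j < n \<and> 0 \<le> k \<and> k < int L" if "\<xi> a (j, k) \<noteq> 0" for a j k
  proof (rule ccontr)
    assume "\<not> ?thesis"
    then have "(a, j, k) \<notin> E" by (auto simp: E_def)
    then show False using c d that by (simp add: \<xi>_def)
  qed
  have psum_\<xi>: "psum ?c \<xi> w j = psum ?c c w j - psum ?c d w j" for w j
    unfolding \<xi>_def by (rule psum_diff)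
  have rel_J: "psum ?c \<xi> rel y = 0" if "y \<in> J" for y
  proof -
    have "restrict (psum ?c c rel) J y = restrict (psum ?c d rel) J y" using CC by (simp add: C_def)
    then show ?thesis using that by (simp add: psum_\<xi>)
  qed
  have far: "psum ?c \<xi> rel (j, k) = 0" if "\<not> (j < n \<and> - int D1 \<le> k \<and> k < int L + int D1)" for j k
  proof -
    have 0: "\<xi> s (act ?c q (j, k)) = 0" if q: "rel = p @ q" for p q s
    proof (rule ccontr)
      assume "\<xi> s (act ?c q (j, k)) \<noteq> 0"
      then have "act \<sigma> q j < n" "0 \<le> k + psum \<sigma> \<chi> q j" "k + psum \<sigma> \<chi> q j < int L"
        using \<xi>0[of s "act \<sigma> q j" "k + psum \<sigma> \<chi> q j"] by (auto simp: ac)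
      moreover have "\<bar>psum \<sigma> \<chi> q j\<bar> \<le> int (length q) * int D" by (rule psum_bound[OF D])
      moreover have "int (length q) * int D \<le> int D1"
        using q by (simp add: D1_def mult_right_mono flip: of_nat_mult)
      ultimately show False using \<open>\<not> (j < n \<and> - int D1 \<le> k \<and> k < int L + int D1)\<close>
        by (auto simp: act_range)
    qed
    show ?thesis
    proof (rule psum_eq_0)
      show "\<xi> s (act ?c q (j, k)) = 0" if "rel = p @ (s, True) # q" for p q s
        using 0[of "p @ [(s, True)]" q s] that by simp
      show "\<xi> s (act ?c ((s, False) # q) (j, k)) = 0" if "rel = p @ (s, False) # q" for p q s
        by (rule 0[OF that])
    qed
  qed
  have "psum ?c \<xi> rel (j, k) = 0" if "j \<noteq> j1" for j k
    using rel_J[of "(j, k)"] far[of j k] that by (auto simp: J_def)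
  then have "psum ?c \<xi> rel (j, k) = 0" for j k
    using redundant[of \<xi> k] by (cases "j = j1") auto
  then have "psum ?c \<xi> rel y = 0" for y by (cases y) simp
  moreover have "psum ?c \<xi> w y \<noteq> 0" using w(2) unfolding \<xi>_def .
  ultimately show thesis using that[of \<xi> L w y] \<xi>0 w(1) by blast
qed

end

section \<open>The labelled double cover of a long cyclic cover\<close>

definition zmult :: "int \<Rightarrow> 'm::group_add \<Rightarrow> 'm" where
  "zmult k g = zpow ((+) g) k 0"

lemma bij_plus_left: "bij ((+) (g :: 'm::group_add))"
  by (rule o_bij[of "(+) (- g)"]) (auto simp: fun_eq_iff add.assoc[symmetric])

lemma zpow_plus_left: "zpow ((+) (g :: 'm::group_add)) k h = zmult k g + h"
proof (induction k rule: int_induct[of _ 0])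
  case base
  then show ?case by (simp add: zmult_def)
next
  case (step1 i)
  then show ?case
    using zpow_Suc[OF bij_plus_left, of g i] by (simp add: zmult_def add.commute[of i 1] add.assoc)
next
  case (step2 i)
  have "g + zpow ((+) g) (i - 1) h = g + (zmult (i - 1) g + h)"
    using step2 zpow_Suc[OF bij_plus_left, of g "i - 1"] by (simp add: zmult_def add.assoc[symmetric])
  then show ?case by simp
qed

lemma zmult_add: "zmult (k + l) g = zmult k g + zmult l g"
  by (metis zmult_def zpow_add[OF bij_plus_left] zpow_plus_left)

lemma zmult_0 [simp]: "zmult 0 g = 0" and zmult_1 [simp]: "zmult 1 g = g"
  by (simp_all add: zmult_def zpow_1[OF bij_plus_left])

lemma zmult_minus: "zmult (- k) g = - zmult k g"
  using zmult_add[of "- k" k g] by (simp add: eq_neg_iff_add_eq_0)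

definition shift :: "int \<Rightarrow> ('x \<times> int) \<times> 'y \<Rightarrow> ('x \<times> int) \<times> 'y" where
  "shift k x = ((fst (fst x), snd (fst x) + k), snd x)"

text \<open>The labels \<open>c\<close> are periodic, so they define a homomorphism from the stabilizer of the class of
  \<open>z\<close> modulo shifts by multiples of \<open>M\<close> to the free group of rank two.\<close>

definition virtual_surjection ::
  "gen2 word \<Rightarrow> nat \<Rightarrow> int \<Rightarrow> (gen2 \<Rightarrow> (nat \<times> int) \<times> bit \<Rightarrow> (nat \<times> int) \<times> bit) \<Rightarrow>
    (gen2 \<Rightarrow> (nat \<times> int) \<times> bit \<Rightarrow> gen2 fgrp) \<Rightarrow> (nat \<times> int) \<times> bit \<Rightarrow> bool" where
  "virtual_surjection r n M \<Sigma> c z \<longleftrightarrow> M > 0 \<and> perms \<Sigma> \<and>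
     (\<forall>x. act \<Sigma> r x = x \<and> psum \<Sigma> c r x = 0) \<and>
     (\<forall>w m x. act \<Sigma> w (shift (m * M) x) = shift (m * M) (act \<Sigma> w x)) \<and>
     (\<forall>w m x. psum \<Sigma> c w (shift (m * M) x) = psum \<Sigma> c w x) \<and>
     (\<forall>w. fst (fst (act \<Sigma> w z)) < n) \<and>
     (\<forall>s. \<exists>w m. act \<Sigma> w z = shift (m * M) z \<and> psum \<Sigma> c w z = fgrp_of [(s, True)])"

lemma div_mod_block:
  fixes l m N :: int
  assumes "m * N \<le> l" and "l < (m + 1) * N"
  shows "l div N = m" and "l mod N = l - m * N"
proof -
  show "l div N = m"
    by (rule int_div_pos_eq[of l N m "l - m * N"]) (use assms in \<open>auto simp: algebra_simps\<close>)
  then show "l mod N = l - m * N" by (simp add: minus_div_mult_eq_mod[symmetric])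
qed

context finite_quotient
begin

lemma psum_wpow:
  assumes "act \<sigma> w j = j"
  shows "act \<sigma> (wpow w t) j = j" and "psum \<sigma> \<chi> (wpow w t) j = int t * psum \<sigma> \<chi> w j"
proof -
  show a: "act \<sigma> (wpow w t) j = j" for t by (induction t) (simp_all add: act_append assms)
  show "psum \<sigma> \<chi> (wpow w t) j = int t * psum \<sigma> \<chi> w j"
    by (induction t) (simp_all add: psum_append a algebra_simps)
qed

text \<open>Words act from right to left, so suffixes are initial stretches of the path. Completed
  turns only add height, and the current turn deviates by a bounded amount; the slack is therefore
  the same for all \<open>t\<close>.\<close>

lemma psum_suffix_wpow:
  assumes w: "act \<sigma> w j = j" "psum \<sigma> \<chi> w j \<ge> 0" and D: "\<And>s j. \<bar>\<chi> s j\<bar> \<le> int D"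
    and "wpow w t = p @ q"
  shows "- (int (length w) * int D) \<le> psum \<sigma> \<chi> q j \<and>
    psum \<sigma> \<chi> q j \<le> int t * psum \<sigma> \<chi> w j + int (length w) * int D"
  using assms(4)
proof (induction t arbitrary: p)
  case (Suc t)
  from Suc.prems consider p' where "wpow w t = p' @ q" | q' where "w = p @ q'" "q = q' @ wpow w t"
    by (auto simp: append_eq_append_conv2)
  then show ?case
  proof cases
    case 1
    then show ?thesis using Suc.IH[OF 1] w(2) by (auto simp: algebra_simps)
  next
    case 2
    have "\<bar>psum \<sigma> \<chi> q' j\<bar> \<le> int (length q') * int D" by (rule psum_bound[OF D])
    moreover have "int (length q') * int D \<le> int (length w) * int D"
      using 2(1) by (simp add: mult_right_mono)
    ultimately have "\<bar>psum \<sigma> \<chi> q' j\<bar> \<le> int (length w) * int D" by linarith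
    moreover have "psum \<sigma> \<chi> q j = psum \<sigma> \<chi> q' j + int t * psum \<sigma> \<chi> w j"
      by (simp add: 2(2) psum_append psum_wpow[OF w(1)])
    moreover have "int t * psum \<sigma> \<chi> w j \<ge> 0" using w(2) by simp
    moreover have "int (Suc t) * psum \<sigma> \<chi> w j = int t * psum \<sigma> \<chi> w j + psum \<sigma> \<chi> w j"
      by (simp add: algebra_simps)
    ultimately show ?thesis using w(2) by linarith
  qed
qed simp

text \<open>Copies of \<open>\<xi>\<close> are placed at heights \<open>H + m * N\<close> and cuts
  at the multiples of \<open>N\<close>, so far apart that no relator path meets both. A relator path
  clear of the copies stays on one sheet and crosses the cuts with total zero, as
  \<open>\<chi>\<close> vanishes on it. One that comes near a copy crosses no cut and sees only
  \<open>\<xi>\<close>, which vanishes on relators.\<close>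

lemma virtual_surjection_exists: "\<exists>M \<Sigma> c z. virtual_surjection rel n M \<Sigma> c z"
proof -
  obtain \<chi> :: "gen2 \<Rightarrow> nat \<Rightarrow> int" and p q w0 j0 where
    \<chi>0: "\<And>s j. j \<ge> n \<Longrightarrow> \<chi> s j = 0" and \<chi>rel: "\<And>j. psum \<sigma> \<chi> rel j = 0"
    and p: "p > 0" "act \<sigma> (wpow u p) j1 = j1" "psum \<sigma> \<chi> (wpow u p) j1 = 0"
    and q: "q > 0" "act \<sigma> (wpow v q) j1 = j1" "psum \<sigma> \<chi> (wpow v q) j1 = 0"
    and w0: "act \<sigma> w0 j0 = j0" "psum \<sigma> \<chi> w0 j0 \<noteq> 0"
    using character_exists by metis
  define D where "D = (\<Sum>x\<in>UNIV \<times> {..<n}. nat \<bar>\<chi> (fst x) (snd x)\<bar>)"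
  have D: "\<bar>\<chi> s j\<bar> \<le> int D" for s j
  proof (cases "j < n")
    case True
    then have "nat \<bar>\<chi> s j\<bar> \<le> D"
      using member_le_sum[of "(s, j)" "UNIV \<times> {..<n}" "\<lambda>x. nat \<bar>\<chi> (fst x) (snd x)\<bar>"] by (simp add: D_def)
    then show ?thesis by linarith
  qed (simp add: \<chi>0)
  let ?Y = "cover \<sigma> \<chi>"
  note pY = inv_cover(1)[OF \<sigma>, of \<chi>]
  have aY: "act ?Y w y = (act \<sigma> w (fst y), snd y + psum \<sigma> \<chi> w (fst y))" for w y
    by (simp add: act_cover[OF \<sigma>])
  obtain \<xi> :: "gen2 \<Rightarrow> nat \<times> int \<Rightarrow> bit" and L w\<xi> y1 where
    \<xi>0: "\<And>s j k. \<xi> s (j, k) \<noteq> 0 \<Longrightarrow> j < n \<and> 0 \<le> k \<and> k < int L"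
    and \<xi>rel: "\<And>y. psum ?Y \<xi> rel y = 0"
    and w\<xi>: "act ?Y w\<xi> y1 = y1" "psum ?Y \<xi> w\<xi> y1 \<noteq> 0"
    using flow_exists[OF \<chi>0 \<chi>rel p q D] by metis
  obtain jx k1 where y1: "y1 = (jx, k1)" by (cases y1)
  have jx: "jx < n"
  proof (rule ccontr)
    assume "\<not> jx < n"
    then have "\<xi> s (act ?Y w y1) = 0" for s w
      using \<xi>0[of s "act \<sigma> w jx" "k1 + psum \<sigma> \<chi> w jx"] act_range[of w jx]
      unfolding y1 aY fst_conv snd_conv by blast
    then have "psum ?Y \<xi> w\<xi> y1 = 0" by (intro psum_eq_0) (simp_all del: act.simps)
    with w\<xi>(2) show False by simp
  qed
  have w\<xi>': "act \<sigma> w\<xi> jx = jx" "psum \<sigma> \<chi> w\<xi> jx = 0" using w\<xi>(1) by (auto simp: y1 aY)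
  have "j0 < n" using psum_outside[of \<chi> j0 w0, OF \<chi>0] w0(2) by (meson leI)
  then obtain g where g: "act \<sigma> g jx = j0" using transitive[OF jx] by blast
  \<comment> \<open>Conjugating \<open>w0\<close> gives a loop at \<open>jx\<close> with non-zero
    height gain; \<open>w'\<close> is the orientation that climbs.\<close>
  define w1 where "w1 = inv_word g @ w0 @ g"
  have w1: "act \<sigma> w1 jx = jx" "psum \<sigma> \<chi> w1 jx = psum \<sigma> \<chi> w0 j0"
    using act_inv_word1[OF \<sigma>, of g jx] psum_inv_word[OF \<sigma>, of \<chi> g jx] w0(1)
    by (simp_all add: w1_def act_append psum_append g)
  define w' where "w' = (if psum \<sigma> \<chi> w1 jx > 0 then w1 else inv_word w1)"
  define c where "c = psum \<sigma> \<chi> w' jx"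
  have w': "act \<sigma> w' jx = jx" "c > 0"
    using w1 w0(2) act_inv_word1[OF \<sigma>, of w1 jx] psum_inv_word[OF \<sigma>, of \<chi> w1 jx]
    by (auto simp: w'_def c_def)
  define Ew where "Ew = int (length w') * int D"
  \<comment> \<open>\<open>B\<close> dominates all excursions: relator paths, the sheet-changing
    loop together with its base height, and a turn of \<open>w'\<close> together with its gain
    \<open>c\<close>. Margins of \<open>3 * B\<close> on either side separate the copies of
    \<open>\<xi>\<close> from the cuts.\<close>
  define B where "B = int D * int (length rel) + int D * int (length w\<xi>) + Ew + \<bar>k1\<bar> + c + 1"
  have Ew0: "Ew \<ge> 0" by (simp add: Ew_def)
  have "int D * int (length rel) \<ge> 0" "int D * int (length w\<xi>) \<ge> 0" by simp_all
  then have B: "int (length rel) * int D \<le> B" "int (length w\<xi>) * int D + \<bar>k1\<bar> \<le> B"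
    "Ew + \<bar>k1\<bar> + c + 1 \<le> B" "k1 \<le> B" "- B \<le> k1"
    using Ew0 w'(2) unfolding B_def mult.commute[of _ "int D"] by linarith+
  define H where "H = 3 * B"
  define T where "T = int L + 6 * B"
  \<comment> \<open>The period is a multiple of \<open>c\<close>, so \<open>T\<close> turns of
    \<open>w'\<close> climb by exactly one period.\<close>
  define N where "N = c * T"
  have T0: "T \<ge> 0" "T \<le> N"
  proof -
    show "T \<ge> 0" using B(3) Ew0 w'(2) by (simp add: T_def)
    then show "T \<le> N" using w'(2) mult_right_mono[of 1 c T] by (simp add: N_def)
  qed
  have N: "N \<ge> int L + 6 * B" using T0(2) by (simp add: T_def)
  have B1: "B \<ge> 1" using B(3) Ew0 w'(2) by linarith
  have Npos: "N > 0" using N B1 by linarith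
  define P where "P b = fgrp_of [(if b = 0 then Gen_a else Gen_b, True)]" for b :: bit
  define \<xi>' where "\<xi>' s y = \<xi> s (fst y, snd y mod N - H)" for s and y :: "nat \<times> int"
  define \<Sigma> where "\<Sigma> = cover ?Y \<xi>'"
  \<comment> \<open>The label of an edge is the signed number of cuts it crosses, as a multiple of
    the free generator \<open>P\<close> attached to the sheet on which the edge starts.\<close>
  define lam where "lam s x = zmult (snd (?Y s (fst x)) div N - snd (fst x) div N) (P (snd x))"
    for s and x :: "(nat \<times> int) \<times> bit"
  have p\<Sigma>: "perms \<Sigma>" unfolding \<Sigma>_def by (rule inv_cover(1)[OF pY])
  have a\<Sigma>: "act \<Sigma> w (y, b) = (act ?Y w y, psum ?Y \<xi>' w y + b)" for w y b
    by (simp add: \<Sigma>_def act_cover[OF pY])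
  have \<Sigma>_eq: "\<Sigma> s (y, b) = (?Y s y, \<xi>' s y + b)" for s y b by (simp add: \<Sigma>_def cover_def)
  \<comment> \<open>Heights off all copies of \<open>\<xi>\<close>, where edges do not change the
    sheet.\<close>
  define free where "free k \<longleftrightarrow> \<not> (H \<le> k mod N \<and> k mod N < H + int L)" for k
  have free_\<xi>': "\<xi>' s (j, k) = 0" if "free k" for s j k
  proof (rule ccontr)
    assume "\<xi>' s (j, k) \<noteq> 0"
    then have "0 \<le> k mod N - H \<and> k mod N - H < int L"
      using \<xi>0[of s j "k mod N - H"] unfolding \<xi>'_def fst_conv snd_conv by blast
    with that show False by (simp add: free_def)
  qed
  have free_bit: "psum ?Y \<xi>' w (j, k) = 0"
    if "\<And>p q. w = p @ q \<Longrightarrow> free (k + psum \<sigma> \<chi> q j)" for w j k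
  proof (rule psum_eq_0)
    show "\<xi>' s (act ?Y q (j, k)) = 0" if "w = p @ (s, True) # q" for p q s
      using \<open>\<And>p q. w = p @ q \<Longrightarrow> free (k + psum \<sigma> \<chi> q j)\<close>[of "p @ [(s, True)]" q] that
      by (simp add: aY free_\<xi>')
    show "\<xi>' s (act ?Y ((s, False) # q) (j, k)) = 0" if "w = p @ (s, False) # q" for p q s
      unfolding aY fst_conv snd_conv
      by (rule free_\<xi>') (rule \<open>\<And>p q. w = p @ q \<Longrightarrow> free (k + psum \<sigma> \<chi> q j)\<close>[OF that])
  qed
  have free_lam: "psum \<Sigma> lam w ((j, k), b) = zmult ((k + psum \<sigma> \<chi> w j) div N - k div N) (P b)"
    if "\<And>p q. w = p @ q \<Longrightarrow> free (k + psum \<sigma> \<chi> q j)" for w j k b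
    using that
  proof (induction w)
    case (Cons l w)
    have pre: "free (k + psum \<sigma> \<chi> q j)" if "w = p @ q" for p q
      by (rule Cons.prems[of "l # p"]) (simp add: that)
    have IH: "psum \<Sigma> lam w ((j, k), b) = zmult ((k + psum \<sigma> \<chi> w j) div N - k div N) (P b)"
      by (rule Cons.IH[OF pre])
    have at: "act \<Sigma> w ((j, k), b) = (act ?Y w (j, k), b)"
      by (simp add: a\<Sigma> free_bit[OF pre])
    have at': "act \<Sigma> (l # w) ((j, k), b) = (act ?Y (l # w) (j, k), b)"
      unfolding a\<Sigma> by (subst free_bit[OF Cons.prems]) simp_all
    have step: "(if snd l then lam (fst l) (act \<Sigma> w ((j, k), b))
        else - lam (fst l) (inv_into UNIV (\<Sigma> (fst l)) (act \<Sigma> w ((j, k), b)))) =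
      zmult ((k + psum \<sigma> \<chi> (l # w) j) div N - (k + psum \<sigma> \<chi> w j) div N) (P b)"
    proof (cases "snd l")
      case True
      have "snd (?Y (fst l) (act ?Y w (j, k))) = k + psum \<sigma> \<chi> (l # w) j"
        using True by (simp add: aY cover_def)
      then show ?thesis using True by (simp add: at lam_def) (simp add: aY)
    next
      case False
      have "inv_into UNIV (\<Sigma> (fst l)) (act \<Sigma> w ((j, k), b)) = (act ?Y (l # w) (j, k), b)"
        using at' False by simp
      moreover have "?Y (fst l) (act ?Y (l # w) (j, k)) = act ?Y w (j, k)"
        using False pY by simp
      ultimately have "lam (fst l) (inv_into UNIV (\<Sigma> (fst l)) (act \<Sigma> w ((j, k), b))) =
          zmult ((k + psum \<sigma> \<chi> w j) div N - (k + psum \<sigma> \<chi> (l # w) j) div N) (P b)"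
        unfolding lam_def by (simp only: fst_conv snd_conv aY)
      then show ?thesis using False by (simp only: if_False zmult_minus[symmetric] minus_diff_eq)
    qed
    have "psum \<Sigma> lam (l # w) ((j, k), b) =
      zmult ((k + psum \<sigma> \<chi> (l # w) j) div N - (k + psum \<sigma> \<chi> w j) div N) (P b)
      + zmult ((k + psum \<sigma> \<chi> w j) div N - k div N) (P b)"
      unfolding psum.simps(2)[of \<Sigma>] step IH ..
    then show ?case by (simp only: zmult_add[symmetric]) (simp only: diff_add_cancel diff_add_eq add_diff_eq)
  qed simp
  have block_lam: "psum \<Sigma> lam w ((j, k), b) = 0"
    if blk: "\<And>p q. w = p @ q \<Longrightarrow> (k + psum \<sigma> \<chi> q j) div N = m" for w j k b m
  proof (rule psum_eq_0)
    show "lam s (act \<Sigma> q ((j, k), b)) = 0" if "w = p @ (s, True) # q" for p q s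
    proof -
      have "snd (?Y s (act ?Y q (j, k))) = k + psum \<sigma> \<chi> ((s, True) # q) j" by (simp add: aY cover_def)
      then show ?thesis using blk[OF that] blk[of "p @ [(s, True)]" q] that
        by (simp add: lam_def a\<Sigma> aY)
    qed
    show "lam s (act \<Sigma> ((s, False) # q) ((j, k), b)) = 0" if "w = p @ (s, False) # q" for p q s
    proof -
      have "?Y s (act ?Y ((s, False) # q) (j, k)) = act ?Y q (j, k)" using pY by simp
      moreover have "(k + psum \<sigma> \<chi> ((s, False) # q) j) div N = m" by (rule blk[OF that])
      moreover have "(k + psum \<sigma> \<chi> q j) div N = m" by (rule blk[of "p @ [(s, False)]"]) (simp add: that)
      ultimately show ?thesis unfolding lam_def a\<Sigma> by (simp only: fst_conv snd_conv aY) simp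
    qed
  qed
  have block_\<xi>': "psum ?Y \<xi>' w (j, k) = psum ?Y \<xi> w (j, k - m * N - H)"
    if blk: "\<And>p q. w = p @ q \<Longrightarrow> (k + psum \<sigma> \<chi> q j) div N = m" for w j k m
  proof -
    define \<tau> where "\<tau> y = (fst y, snd y - m * N - H)" for y :: "nat \<times> int"
    have eq: "\<xi>' s (act ?Y q (j, k)) = \<xi> s (\<tau> (act ?Y q (j, k)))" if "w = p @ q" for p q s
    proof -
      have "(k + psum \<sigma> \<chi> q j) mod N = k + psum \<sigma> \<chi> q j - m * N"
        using blk[OF that] minus_div_mult_eq_mod[of "k + psum \<sigma> \<chi> q j" N] by simp
      then show ?thesis by (simp add: \<xi>'_def \<tau>_def aY)
    qed
    have "psum ?Y \<xi>' w (j, k) = psum ?Y (\<lambda>s y. \<xi> s (\<tau> y)) w (j, k)"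
    proof (rule psum_cong)
      fix l p q assume w: "w = p @ l # q"
      show "(if snd l then \<xi>' (fst l) (act ?Y q (j, k)) else - \<xi>' (fst l) (inv_into UNIV (?Y (fst l)) (act ?Y q (j, k)))) =
        (if snd l then \<xi> (fst l) (\<tau> (act ?Y q (j, k))) else - \<xi> (fst l) (\<tau> (inv_into UNIV (?Y (fst l)) (act ?Y q (j, k)))))"
        using eq[of "p @ [l]" q "fst l"] eq[of p "l # q" "fst l"] w by (simp split: if_splits)
    qed
    also have "\<dots> = psum ?Y \<xi> w (\<tau> (j, k))"
      by (rule psum_translate[OF pY, symmetric]) (simp add: \<tau>_def cover_def)
    finally show ?thesis by (simp add: \<tau>_def)
  qed
  have near: "\<bar>psum \<sigma> \<chi> q j\<bar> \<le> int (length w) * int D" if "w = p @ q" for w p q j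
  proof -
    have "\<bar>psum \<sigma> \<chi> q j\<bar> \<le> int (length q) * int D" by (rule psum_bound[OF D])
    moreover have "int (length q) * int D \<le> int (length w) * int D"
      using that by (simp add: mult_right_mono)
    ultimately show ?thesis by linarith
  qed
  have rel_both: "psum ?Y \<xi>' rel (j, k) = 0 \<and> psum \<Sigma> lam rel ((j, k), b) = 0" for j k b
  proof (cases "\<forall>p q. rel = p @ q \<longrightarrow> free (k + psum \<sigma> \<chi> q j)")
    case True
    then show ?thesis using free_bit[of rel k j] free_lam[of rel k j b] \<chi>rel by simp
  next
    case False
    then obtain p0 q0 where q0: "rel = p0 @ q0" "\<not> free (k + psum \<sigma> \<chi> q0 j)" by blast
    define l0 where "l0 = k + psum \<sigma> \<chi> q0 j"
    define m where "m = l0 div N"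
    have l0: "m * N + H \<le> l0" "l0 < m * N + H + int L"
      using q0(2) minus_div_mult_eq_mod[of l0 N] unfolding free_def l0_def[symmetric] m_def by auto
    have "(k + psum \<sigma> \<chi> q j) div N = m" if "rel = p @ q" for p q
    proof (rule div_mod_block(1))
      have "\<bar>k + psum \<sigma> \<chi> q j - l0\<bar> \<le> 2 * B"
        using near[OF q0(1), of j] near[OF that, of j] B(1) unfolding l0_def by linarith
      then show "m * N \<le> k + psum \<sigma> \<chi> q j" "k + psum \<sigma> \<chi> q j < (m + 1) * N"
        using l0 N B1 unfolding H_def by (auto simp: distrib_right)
    qed
    then show ?thesis using block_\<xi>'[of rel k j m] block_lam[of rel k j m b] \<xi>rel by simp
  qed
  have act_rel: "act \<Sigma> rel x = x" for x
  proof -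
    obtain j k b where x: "x = ((j, k), b)" by (metis prod.collapse)
    show ?thesis using rel_both[of j k b] by (simp add: x a\<Sigma> aY \<chi>rel relator[folded rel_def])
  qed
  have psum_rel: "psum \<Sigma> lam rel x = 0" for x
    using rel_both[of "fst (fst x)" "snd (fst x)" "snd x"] by simp
  define \<tau> where "\<tau> m = (shift (m * N) :: (nat \<times> int) \<times> bit \<Rightarrow> _)" for m
  note \<tau>_shift = \<tau>_def
  have \<tau>_def: "\<tau> m x = ((fst (fst x), snd (fst x) + m * N), snd x)" for m x
    by (simp add: \<tau>_shift shift_def)
  have \<tau>\<Sigma>: "\<tau> m (\<Sigma> s x) = \<Sigma> s (\<tau> m x)" for m s x
    by (cases x) (simp add: \<tau>_def \<Sigma>_def cover_def \<xi>'_def)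
  have \<tau>lam: "lam s (\<tau> m x) = lam s x" for m s x
    using Npos by (simp add: \<tau>_def lam_def cover_def add.assoc[symmetric])
  have act_\<tau>: "act \<Sigma> w (\<tau> m x) = \<tau> m (act \<Sigma> w x)" for w m x
    by (rule act_commute[of \<Sigma> "\<tau> m", OF p\<Sigma> \<tau>\<Sigma>])
  have psum_\<tau>: "psum \<Sigma> lam w (\<tau> m x) = psum \<Sigma> lam w x" for w m x
    using psum_translate[of \<Sigma> "\<tau> m" lam w x, OF p\<Sigma> \<tau>\<Sigma>] by (simp add: \<tau>lam)
  define a0 where "a0 = k1 + H"
  define z where "z = ((jx, a0), 0 :: bit)"
  have w\<xi>_blk: "(a0 + psum \<sigma> \<chi> q jx) div N = 0" if "w\<xi> = p @ q" for p q
    by (rule div_mod_block(1))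
      (use near[OF that, of jx] B(2) N B1 in \<open>auto simp: a0_def H_def abs_le_iff\<close>)
  have w\<xi>_lam: "psum \<Sigma> lam w\<xi> ((jx, a0), b) = 0" for b by (rule block_lam[OF w\<xi>_blk])
  have "psum ?Y \<xi>' w\<xi> (jx, a0) = psum ?Y \<xi> w\<xi> (jx, a0 - 0 * N - H)" by (rule block_\<xi>'[OF w\<xi>_blk])
  then have "psum ?Y \<xi>' w\<xi> (jx, a0) \<noteq> 0" using w\<xi>(2) by (simp add: a0_def y1)
  \<comment> \<open>The loop \<open>w\<xi>\<close> interchanges the sheets over its base point and,
    staying within one block, picks up no label.\<close>
  then have w\<xi>_act: "act \<Sigma> w\<xi> ((jx, a0), b) = ((jx, a0), 1 + b)" for b
    using w\<xi>' by (simp add: a\<Sigma> aY)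
  have lev: "a - Ew \<le> a + psum \<sigma> \<chi> q jx \<and> a + psum \<sigma> \<chi> q jx \<le> a + int t * c + Ew" if "wpow w' t = p @ q" for a t p q
    using psum_suffix_wpow[of w' jx \<chi> D, OF w'(1) _ D that] w'(2) unfolding c_def Ew_def by linarith
  have loop_act: "act \<Sigma> (wpow w' t) ((jx, a), b) = ((jx, a + int t * c), psum ?Y \<xi>' (wpow w' t) (jx, a) + b)" for t a b
    by (simp add: a\<Sigma> aY psum_wpow[OF w'(1)] c_def)
  have loop_block: "psum \<Sigma> lam (wpow w' t) ((jx, a), b) = 0"
    if "m * N \<le> a - Ew" "a + int t * c + Ew < (m + 1) * N" for a t m b
    by (rule block_lam[of _ _ _ m], rule div_mod_block(1)) (use that lev in \<open>force+\<close>)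
  \<comment> \<open>The \<open>T\<close> turns are cut into three stretches: up to a height
    \<open>a1\<close> shortly below \<open>N - B\<close>, across the cut to \<open>a2\<close>
    shortly above \<open>N + B\<close>, and on to \<open>a0 + N\<close>. The middle stretch avoids
    the copies of \<open>\<xi>\<close> and so keeps its sheet; the outer two may change sheets, by
    \<open>e1\<close> and \<open>e3\<close>, but meet no cut.\<close>
  define r1 where "r1 = (N - B - 1 - a0) div c"
  define a1 where "a1 = a0 + r1 * c"
  have "r1 \<ge> 0" unfolding r1_def using N B B1 w'(2) by (intro pos_imp_zdiv_nonneg_iff[THEN iffD2]) (auto simp: a0_def H_def)
  have a1: "N - B - 1 - c < a1" "a1 \<le> N - B - 1"
    using minus_div_mult_eq_mod[of "N - B - 1 - a0" c] pos_mod_bound[OF w'(2), of "N - B - 1 - a0"]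
      pos_mod_sign[OF w'(2), of "N - B - 1 - a0"] unfolding a1_def r1_def by linarith+
  define r2 where "r2 = (N + B - a1) div c + 1"
  define a2 where "a2 = a1 + r2 * c"
  have "r2 \<ge> 0" unfolding r2_def using a1 B1 w'(2)
    by (intro add_nonneg_nonneg pos_imp_zdiv_nonneg_iff[THEN iffD2]) auto
  have a2: "N + B < a2" "a2 \<le> N + B + c"
    using minus_div_mult_eq_mod[of "N + B - a1" c] pos_mod_bound[OF w'(2), of "N + B - a1"]
      pos_mod_sign[OF w'(2), of "N + B - a1"] unfolding a2_def r2_def by (simp_all add: distrib_right)
  define r3 where "r3 = T - r1 - r2"
  have a3: "a2 + r3 * c = a0 + N" unfolding a2_def a1_def r3_def N_def by (simp add: algebra_simps)
  have "r3 * c \<ge> 0" using a3 a2 B(3) Ew0 B1 by (simp add: a0_def H_def)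
  then have "r3 \<ge> 0" using w'(2) by (simp add: zero_le_mult_iff)
  have rr: "int (nat r1) = r1" "int (nat r2) = r2" "int (nat r3) = r3"
    using \<open>r1 \<ge> 0\<close> \<open>r2 \<ge> 0\<close> \<open>r3 \<ge> 0\<close> by simp_all
  define W1 where "W1 = wpow w' (nat r1)"
  define W2 where "W2 = wpow w' (nat r2)"
  define W3 where "W3 = wpow w' (nat r3)"
  define e1 where "e1 = psum ?Y \<xi>' W1 (jx, a0)"
  define e3 where "e3 = psum ?Y \<xi>' W3 (jx, a2)"
  have N1: "0 * N = 0" "(0 + 1) * N = N" "1 * N = N" "(1 + 1) * N = N + N" by simp_all
  have W1: "act \<Sigma> W1 ((jx, a0), b) = ((jx, a1), e1 + b)" "psum \<Sigma> lam W1 ((jx, a0), b) = 0" for b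
  proof -
    show "act \<Sigma> W1 ((jx, a0), b) = ((jx, a1), e1 + b)"
      using loop_act[of "nat r1" a0 b] by (simp only: W1_def e1_def a1_def rr)
    show "psum \<Sigma> lam W1 ((jx, a0), b) = 0"
      unfolding W1_def
    proof (rule loop_block[where m = 0])
      have "a0 + int (nat r1) * c = a1" by (simp only: rr a1_def)
      then show "0 * N \<le> a0 - Ew" "a0 + int (nat r1) * c + Ew < (0 + 1) * N"
        using a1 B B1 N w'(2) N1 a0_def H_def by linarith+
    qed
  qed
  have W2_free: "free (a1 + psum \<sigma> \<chi> q jx)" if "W2 = p @ q" for p q
  proof -
    define l where "l = a1 + psum \<sigma> \<chi> q jx"
    have l: "N - 3 * B \<le> l" "l < N + 3 * B"
      using lev[of "nat r2" p q a1] that a1 a2 B(3) unfolding l_def W2_def rr a2_def by auto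
    show ?thesis unfolding l_def[symmetric]
    proof (cases "l < N")
      case True
      then have "l mod N = l" using l N B1 by (intro mod_pos_pos_trivial) auto
      then show "free l" using l N by (auto simp: free_def H_def)
    next
      case False
      then have "l mod N = l - 1 * N" using l N B1 by (intro div_mod_block(2)) auto
      then show "free l" using l N by (auto simp: free_def H_def)
    qed
  qed
  have d1: "a1 div N = 0" using a1 N B B1 Ew0 w'(2) by (intro div_pos_pos_trivial) auto
  have d2: "a2 div N = 1" using a2 N B B1 Ew0 w'(2) by (intro div_mod_block(1)) auto
  have W2: "act \<Sigma> W2 ((jx, a1), b) = ((jx, a2), b)" "psum \<Sigma> lam W2 ((jx, a1), b) = P b" for b
  proof -
    have "a1 + psum \<sigma> \<chi> W2 jx = a2" using \<open>r2 \<ge> 0\<close> by (simp add: W2_def psum_wpow[OF w'(1)] a2_def c_def)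
    then show "psum \<Sigma> lam W2 ((jx, a1), b) = P b" using free_lam[of W2 a1 jx b, OF W2_free] by (simp add: d1 d2)
    show "act \<Sigma> W2 ((jx, a1), b) = ((jx, a2), b)"
      using loop_act[of "nat r2" a1 b] free_bit[of W2 a1 jx, OF W2_free] \<open>r2 \<ge> 0\<close> by (simp add: W2_def[symmetric] a2_def)
  qed
  have W3: "act \<Sigma> W3 ((jx, a2), b) = ((jx, a0 + N), e3 + b)" "psum \<Sigma> lam W3 ((jx, a2), b) = 0" for b
  proof -
    show "act \<Sigma> W3 ((jx, a2), b) = ((jx, a0 + N), e3 + b)"
      using loop_act[of "nat r3" a2 b] by (simp only: W3_def e3_def a3 rr)
    show "psum \<Sigma> lam W3 ((jx, a2), b) = 0"
      unfolding W3_def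
    proof (rule loop_block[where m = 1])
      have "a2 + int (nat r3) * c = a0 + N" by (simp only: rr a3)
      then show "1 * N \<le> a2 - Ew" "a2 + int (nat r3) * c + Ew < (1 + 1) * N"
        using a2 B B1 N Ew0 w'(2) N1(4) a0_def H_def by linarith+
    qed
  qed
  define W where "W = W3 @ W2 @ W1"
  have W: "act \<Sigma> W ((jx, a0), b) = ((jx, a0 + N), e3 + e1 + b)" "psum \<Sigma> lam W ((jx, a0), b) = P (e1 + b)" for b
    by (simp_all only: W_def act_append psum_append W1 W2 W3 add.assoc add_0_left add_0_right)
  have fix1: "\<exists>w. act \<Sigma> w ((jx, a0), b) = ((jx, a0), b') \<and> psum \<Sigma> lam w ((jx, a0), b) = 0" for b b'
  proof (cases "b = b'")
    case True
    then show ?thesis by (intro exI[of _ "[]"]) simp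
  next
    case False
    then have "1 + b = b'" using bit_not_zero_iff[of b] bit_not_zero_iff[of b'] by auto
    then show ?thesis by (intro exI[of _ w\<xi>]) (simp add: w\<xi>_act w\<xi>_lam)
  qed
  have gens: "\<exists>w m. act \<Sigma> w z = \<tau> m z \<and> psum \<Sigma> lam w z = fgrp_of [(s, True)]" for s
  proof -
    \<comment> \<open>The sheet on which the cut must be crossed to pick up the generator
      \<open>s\<close>. The word \<open>w1\<close> prepares it, compensating for \<open>e1\<close>,
      and \<open>w3\<close> restores sheet 0 afterwards.\<close>
    define \<beta> :: bit where "\<beta> = (if s = Gen_a then 0 else 1)"
    have \<beta>: "P \<beta> = fgrp_of [(s, True)]" by (cases s) (simp_all add: \<beta>_def P_def)
    obtain w1 where w1: "act \<Sigma> w1 ((jx, a0), 0) = ((jx, a0), \<beta> - e1)" "psum \<Sigma> lam w1 ((jx, a0), 0) = 0"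
      using fix1 by blast
    obtain w3 where w3: "act \<Sigma> w3 ((jx, a0), e3 + \<beta>) = ((jx, a0), 0)" "psum \<Sigma> lam w3 ((jx, a0), e3 + \<beta>) = 0"
      using fix1 by blast
    have "((jx, a0 + N), e3 + \<beta>) = \<tau> 1 ((jx, a0), e3 + \<beta>)" by (simp add: \<tau>_def)
    then have w3': "act \<Sigma> w3 ((jx, a0 + N), e3 + \<beta>) = \<tau> 1 z" "psum \<Sigma> lam w3 ((jx, a0 + N), e3 + \<beta>) = 0"
      using act_\<tau>[of w3 1 "((jx, a0), e3 + \<beta>)"] psum_\<tau>[of w3 1 "((jx, a0), e3 + \<beta>)"] w3
      by (simp_all add: z_def)
    have e: "e3 + e1 + (\<beta> - e1) = e3 + \<beta>" "e1 + (\<beta> - e1) = \<beta>" by (simp_all only: algebra_simps)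
    have "act \<Sigma> (w3 @ W @ w1) z = \<tau> 1 z" "psum \<Sigma> lam (w3 @ W @ w1) z = P \<beta>"
      unfolding act_append psum_append z_def w1 W e w3' by (simp_all add: z_def)
    then show ?thesis using \<beta> by metis
  qed
  have "fst (fst (act \<Sigma> w z)) < n" for w using jx by (simp add: z_def a\<Sigma> aY act_range)
  then have "virtual_surjection rel n N \<Sigma> lam z"
    unfolding virtual_surjection_def \<tau>_shift[symmetric]
    using Npos p\<Sigma> act_rel psum_rel act_\<tau> psum_\<tau> gens by blast
  then show ?thesis by blast
qed

end

section \<open>The one-relator group as a quotient of the free group\<close>

lemma (in group) finite_rcosets_criterion:
  assumes H: "subgroup H G" and fin: "finite (f ` carrier G)"
    and f: "\<And>x y. x \<in> carrier G \<Longrightarrow> y \<in> carrier G \<Longrightarrow> f x = f y \<Longrightarrow> x \<otimes> inv y \<in> H"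
  shows "finite (rcosets H)"
proof -
  define g where "g t = (SOME x. x \<in> carrier G \<and> f x = t)" for t
  have "H #> x = H #> g (f x)" if x: "x \<in> carrier G" for x
  proof -
    have g: "g (f x) \<in> carrier G" "f (g (f x)) = f x"
      using someI[of "\<lambda>y. y \<in> carrier G \<and> f y = f x" x] x by (auto simp: g_def)
    then have "x \<otimes> inv g (f x) \<in> H" using f x by metis
    then have "x \<in> H #> g (f x)" using subgroup.rcos_module_rev[OF H is_group g(1) x] by simp
    then show ?thesis using repr_independence[OF _ g(1) H] by simp
  qed
  then have "rcosets H \<subseteq> (\<lambda>t. H #> g t) ` (f ` carrier G)" by (auto simp: RCOSETS_def)
  then show ?thesis using fin by (meson finite_imageI finite_subset)
qed

locale one_relator =
  fixes r :: "gen2 word"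
  assumes r: "r \<in> carrier F2"
begin

definition N :: "gen2 word set" where "N = normal_closure F2 {r}"
definition G :: "gen2 word set monoid" where "G = presented_group UNIV {r}"
definition proj :: "gen2 word \<Rightarrow> gen2 word set" where "proj w = N #>\<^bsub>F2\<^esub> reduce w"

lemma normal_N: "N \<lhd> F2"
  unfolding N_def by (rule group.normal_closure_normal[OF group_free_group]) (use r in simp)

lemma G_Mod: "G = F2 Mod N"
  by (simp add: G_def presented_group_def N_def)

lemma reduce_carrier [simp]: "reduce w \<in> carrier F2"
  by (simp add: carrier_free_group)

sublocale F: group F2 by (rule group_free_group)
sublocale N: normal N F2 by (rule normal_N)
sublocale group G unfolding G_Mod by (rule N.factorgroup_is_group)

lemma proj_append: "proj (w @ w') = proj w \<otimes>\<^bsub>G\<^esub> proj w'"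
  using N.rcos_sum[of "reduce w" "reduce w'"]
  by (simp add: proj_def G_Mod mult_free_group reduce_append_reduce reduce_append_reduce')

lemma proj_Nil: "proj [] = \<one>\<^bsub>G\<^esub>"
  using F.coset_mult_one[of N] N.subset by (simp add: proj_def G_Mod reduce_def one_free_group)

lemma proj_carrier [simp]: "proj w \<in> carrier G"
  by (auto simp: proj_def G_Mod carrier_FactGroup)

lemma proj_reduce [simp]: "proj (reduce w) = proj w"
  by (simp add: proj_def reduce_id)

lemma proj_inv: "proj (inv_word w) = inv\<^bsub>G\<^esub> proj w"
proof -
  have "proj (inv_word w) \<otimes>\<^bsub>G\<^esub> proj w = proj (reduce (inv_word w @ w))"
    by (simp only: proj_append proj_reduce)
  then have "proj (inv_word w) \<otimes>\<^bsub>G\<^esub> proj w = \<one>\<^bsub>G\<^esub>" by (simp only: reduce_inv_word proj_Nil)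
  then show ?thesis by (simp add: inv_equality)
qed

lemma proj_surj:
  assumes "C \<in> carrier G"
  obtains w where "C = proj w"
  using assms by (auto simp: G_Mod carrier_FactGroup carrier_free_group proj_def) (metis reduce_id)

lemma proj_eq:
  assumes "proj w = proj w'"
  obtains m where "m \<in> N" "reduce w = reduce (m @ w')"
proof -
  have "reduce w \<in> proj w'"
    using F.rcos_self[of "reduce w" N] N.subgroup_axioms assms unfolding proj_def by simp
  then obtain m where "m \<in> N" "reduce w = m \<otimes>\<^bsub>F2\<^esub> reduce w'"
    by (auto simp: proj_def r_coset_def)
  then show thesis using that by (simp add: mult_free_group reduce_append_reduce')
qed

text \<open>An action and its label sums descend from the free group to \<open>G\<close> once they
  are trivial on the relator.\<close>

lemma proj_eq_act:
  assumes "proj w = proj w'" and \<sigma>: "perms \<sigma>" and "\<And>x. act \<sigma> r x = x" and "\<And>x. psum \<sigma> c r x = 0"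
  shows "act \<sigma> w x = act \<sigma> w' x" and "psum \<sigma> c w x = psum \<sigma> c w' x"
proof -
  obtain m where m: "m \<in> N" "reduce w = reduce (m @ w')" using proj_eq[OF assms(1)] by blast
  have triv: "act \<sigma> m y = y" "psum \<sigma> c m y = 0" for y
    using closure_trivial[OF \<sigma> r assms(3,4)] m(1) by (auto simp: N_def)
  show "act \<sigma> w x = act \<sigma> w' x"
    using act_reduce[OF \<sigma>, of w x] act_reduce[OF \<sigma>, of "m @ w'" x] m(2) triv by (simp add: act_append)
  show "psum \<sigma> c w x = psum \<sigma> c w' x"
    using psum_reduce[OF \<sigma>, of c w x] psum_reduce[OF \<sigma>, of c "m @ w'" x] m(2) triv by (simp add: psum_append)
qed

lemma proj_relator: "proj r = \<one>\<^bsub>G\<^esub>"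
proof -
  have "r \<in> N" by (auto simp: N_def normal_closure_def)
  moreover have "reduce r = r" using r by (simp add: carrier_free_group reduce_id)
  ultimately show ?thesis using F.coset_join2[OF r N.subgroup_axioms] by (simp add: proj_def G_Mod)
qed

lemma proj_eq_one_iff: "proj w = \<one>\<^bsub>G\<^esub> \<longleftrightarrow> reduce w \<in> N"
  using F.coset_join1[of N "reduce w"] F.coset_join2[of "reduce w" N] N.subgroup_axioms
  by (auto simp: proj_def G_Mod)

lemma finitely_generated_G: "finitely_generated G"
proof -
  let ?S = "{proj [(Gen_a, True)], proj [(Gen_b, True)]}"
  have gen: "proj [(s, e)] \<in> generate G ?S" for s e
  proof -
    have 1: "proj [(s, True)] \<in> ?S" by (cases s) simp_all
    have "proj [(s, False)] = inv\<^bsub>G\<^esub> proj [(s, True)]"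
      using proj_inv[of "[(s, True)]"] by (simp add: inv_word_def inv_letter_def)
    then show ?thesis
      using generate.incl[OF 1, of G] generate.inv[OF 1, of G] by (cases e) simp_all
  qed
  have "proj w \<in> generate G ?S" for w
  proof (induction w)
    case Nil
    then show ?case by (simp only: proj_Nil generate.one)
  next
    case (Cons l w)
    have "proj (l # w) = proj [l] \<otimes>\<^bsub>G\<^esub> proj w" using proj_append[of "[l]" w] by simp
    then show ?case using gen[of "fst l" "snd l"] Cons by (simp add: generate.eng)
  qed
  then have "carrier G \<subseteq> generate G ?S" using proj_surj by (metis subsetI)
  moreover have "generate G ?S \<subseteq> carrier G" by (intro generate_incl) simp
  ultimately have "generate G ?S = carrier G" by blast
  moreover have "finite ?S" "?S \<subseteq> carrier G" by simp_all
  ultimately show ?thesis unfolding finitely_generated_def using is_group by blast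
qed

lemma map_reduce:
  fixes f :: "'b \<Rightarrow> 'c"
  assumes "inj f"
  shows "map (map_prod f id) (reduce w) = reduce (map (map_prod f id) w)"
proof (induction w)
  case (Cons l w)
  have "reduce (l # w) = cons_reduce l (reduce w)" for l :: "'c letter" and w by (simp add: reduce_def)
  moreover have "reduce (l # w) = cons_reduce l (reduce w)" for l :: "'b letter" and w by (simp add: reduce_def)
  ultimately show ?case using Cons by (simp only: list.map map_cons_reduce[OF assms])
qed (simp add: reduce_def)

text \<open>Periodicity makes \<open>ps\<close> at \<open>z\<close> additive on \<open>H\<close>:
  the right factor moves \<open>z\<close> by a period, which the label sum of the left factor does
  not notice. The index is finite because modulo periods there are only \<open>n\<close> vertices,
  \<open>M\<close> heights and two sheets. Surjectivity holds since each free generator is the label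
  sum of some word in the stabilizer.\<close>

lemma large_of_virtual_surjection:
  assumes "virtual_surjection r n M \<Sigma> lam z"
  shows "large G"
proof -
  have M: "M > 0" and \<Sigma>: "perms \<Sigma>" and rel: "\<And>x. act \<Sigma> r x = x" "\<And>x. psum \<Sigma> lam r x = 0"
    and bound: "\<And>w. fst (fst (act \<Sigma> w z)) < n"
    using assms unfolding virtual_surjection_def by blast+
  define \<tau> where "\<tau> m = (shift (m * M) :: (nat \<times> int) \<times> bit \<Rightarrow> _)" for m
  have act_\<tau>: "act \<Sigma> w (\<tau> m x) = \<tau> m (act \<Sigma> w x)" and psum_\<tau>: "psum \<Sigma> lam w (\<tau> m x) = psum \<Sigma> lam w x"
    and gens: "\<exists>w m. act \<Sigma> w z = \<tau> m z \<and> psum \<Sigma> lam w z = fgrp_of [(s, True)]" for w m x s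
    using assms unfolding virtual_surjection_def \<tau>_def by blast+
  have \<tau>_def: "\<tau> m x = ((fst (fst x), snd (fst x) + m * M), snd x)" for m x
    by (simp add: \<tau>_def shift_def)
  have \<tau>_add: "\<tau> m (\<tau> m' x) = \<tau> (m + m') x" and \<tau>_0: "\<tau> 0 x = x" for m m' x
    by (simp_all add: \<tau>_def algebra_simps)
  define rep where "rep C = (SOME w. proj w = C)" for C
  define mv where "mv C = act \<Sigma> (rep C)" for C
  define ps where "ps C = psum \<Sigma> lam (rep C)" for C
  have rep: "proj (rep (proj w)) = proj w" for w unfolding rep_def by (rule someI) (rule refl)
  have mv_proj: "mv (proj w) x = act \<Sigma> w x" and ps_proj: "ps (proj w) x = psum \<Sigma> lam w x" for w x
    using proj_eq_act[OF rep \<Sigma> rel] by (simp_all add: mv_def ps_def)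
  have mv_mult: "mv (C \<otimes>\<^bsub>G\<^esub> D) x = mv C (mv D x)" and ps_mult: "ps (C \<otimes>\<^bsub>G\<^esub> D) x = ps C (mv D x) + ps D x"
    if "C \<in> carrier G" "D \<in> carrier G" for C D x
  proof -
    from that obtain w w' where "C = proj w" "D = proj w'" by (metis proj_surj)
    then show "mv (C \<otimes>\<^bsub>G\<^esub> D) x = mv C (mv D x)" "ps (C \<otimes>\<^bsub>G\<^esub> D) x = ps C (mv D x) + ps D x"
      by (simp_all only: proj_append[symmetric] mv_proj ps_proj act_append psum_append)
  qed
  have mv_one: "mv \<one>\<^bsub>G\<^esub> x = x" and ps_one: "ps \<one>\<^bsub>G\<^esub> x = 0" for x
    using mv_proj[of "[]"] ps_proj[of "[]"] by (simp_all add: proj_Nil)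
  have mv_\<tau>: "mv C (\<tau> m x) = \<tau> m (mv C x)" and ps_\<tau>: "ps C (\<tau> m x) = ps C x" for C m x
    by (simp_all add: mv_def ps_def act_\<tau> psum_\<tau>)
  have mv_inv: "mv C (mv (inv\<^bsub>G\<^esub> C) x) = x" "mv (inv\<^bsub>G\<^esub> C) (mv C x) = x" if "C \<in> carrier G" for C x
    using that mv_mult[of C "inv\<^bsub>G\<^esub> C" x] mv_mult[of "inv\<^bsub>G\<^esub> C" C x] by (simp_all add: mv_one)
  define H where "H = {C \<in> carrier G. \<exists>m. mv C z = \<tau> m z}"
  have inv_H: "inv\<^bsub>G\<^esub> C \<in> H" if "C \<in> H" for C
  proof -
    from that obtain m where C: "C \<in> carrier G" and m: "mv C z = \<tau> m z" by (auto simp: H_def)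
    have "mv (inv\<^bsub>G\<^esub> C) z = mv (inv\<^bsub>G\<^esub> C) (\<tau> (- m) (\<tau> m z))" by (simp add: \<tau>_add \<tau>_0)
    also have "\<dots> = \<tau> (- m) z" by (simp only: mv_\<tau>[of _ "- m"] m[symmetric] mv_inv(2)[OF C])
    finally show ?thesis using C by (auto simp: H_def)
  qed
  have H: "subgroup H G"
  proof (rule subgroupI)
    have "mv \<one>\<^bsub>G\<^esub> z = \<tau> 0 z" by (simp only: mv_one \<tau>_0)
    then have "\<one>\<^bsub>G\<^esub> \<in> H" unfolding H_def by blast
    then show "H \<noteq> {}" by blast
    show "C \<otimes>\<^bsub>G\<^esub> D \<in> H" if "C \<in> H" "D \<in> H" for C D
      using that by (auto simp: H_def mv_mult mv_\<tau> \<tau>_add)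
  qed (use inv_H in \<open>auto simp: H_def\<close>)
  \<comment> \<open>Right cosets of the stabilizer \<open>H\<close> are told apart by the images of
    \<open>z\<close> under inverses, taken modulo the period.\<close>
  define f where "f C = (let x = mv (inv\<^bsub>G\<^esub> C) z in (fst (fst x), snd (fst x) mod M, snd x))" for C
  have "finite (rcosets\<^bsub>G\<^esub> H)"
  proof (rule finite_rcosets_criterion[OF H, of f])
    have "f C \<in> {..<n} \<times> {0..<M} \<times> {0, 1}" for C
      using bound M bit_not_zero_iff by (auto simp: f_def Let_def mv_def)
    then have "f ` carrier G \<subseteq> {..<n} \<times> {0..<M} \<times> {0, 1}" by blast
    then show "finite (f ` carrier G)" by (rule finite_subset) simp
    fix C D assume C: "C \<in> carrier G" "D \<in> carrier G" and eq: "f C = f D"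
    define x y where "x = mv (inv\<^bsub>G\<^esub> C) z" and "y = mv (inv\<^bsub>G\<^esub> D) z"
    have "snd (fst x) mod M = snd (fst y) mod M" using eq by (simp add: f_def x_def y_def Let_def)
    then obtain m where "snd (fst y) = snd (fst x) + m * M"
      by (metis mod_eqE mult.commute diff_add_cancel add.commute diff_eq_eq mod_eq_dvd_iff dvdE)
    then have "y = \<tau> m x"
      using eq by (simp add: f_def x_def[symmetric] y_def[symmetric] Let_def \<tau>_def prod_eq_iff)
    then have "mv (C \<otimes>\<^bsub>G\<^esub> inv\<^bsub>G\<^esub> D) z = mv C (\<tau> m x)" using C by (simp add: mv_mult y_def)
    also have "\<dots> = \<tau> m z" using C by (simp add: mv_\<tau> x_def mv_inv)
    finally show "C \<otimes>\<^bsub>G\<^esub> inv\<^bsub>G\<^esub> D \<in> H" using C by (auto simp: H_def)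
  qed
  then have fi: "finite_index G H" using H by (simp add: finite_index_def)
  \<comment> \<open>\<open>large\<close> asks for a free basis of numbers, so the two generators are
    renamed 0 and 1.\<close>
  define g :: "gen2 \<Rightarrow> nat" where "g s = (if s = Gen_a then 0 else 1)" for s
  have g: "inj g" "range g = {0, 1}"
  proof -
    show "inj g"
    proof (rule injI)
      fix s t assume "g s = g t"
      then show "s = t" by (cases s; cases t) (simp_all add: g_def)
    qed
    have UNIV: "UNIV = {Gen_a, Gen_b}" using gen2.exhaust by auto
    show "range g = {0, 1}" unfolding UNIV by (auto simp: g_def)
  qed
  define h where "h C = map (map_prod g id) (Rep_fgrp (ps C z))" for C
  let ?F = "free_group {0, 1 :: nat}"
  have words: "bij_betw (map (map_prod g id)) (words_over UNIV) (words_over {0, 1})"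
    using words_over_image[OF g(1), of UNIV] g(2) by simp
  have red: "Rep_fgrp y \<in> words_over UNIV" for y using Rep_fgrp[of y] by (simp add: words_over_def)
  have carrier_F: "carrier ?F = words_over {0, 1}"
    by (simp add: set_eq_iff words_over_def carrier_free_group)
  have h_carrier: "h C \<in> carrier ?F" for C
    unfolding carrier_F h_def using words red by (auto simp: bij_betw_def)
  have h_hom: "h \<in> hom (G\<lparr>carrier := H\<rparr>) ?F"
  proof (rule homI)
    fix C D assume "C \<in> carrier (G\<lparr>carrier := H\<rparr>)" "D \<in> carrier (G\<lparr>carrier := H\<rparr>)"
    then have C: "C \<in> carrier G" "D \<in> carrier G" and D: "D \<in> H" by (auto simp: H_def)
    have "ps (C \<otimes>\<^bsub>G\<^esub> D) z = ps C z + ps D z" using D C by (auto simp: ps_mult H_def ps_\<tau>)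
    then show "h (C \<otimes>\<^bsub>G\<lparr>carrier := H\<rparr>\<^esub> D) = h C \<otimes>\<^bsub>?F\<^esub> h D"
      by (simp add: h_def plus_fgrp.rep_eq mult_free_group map_reduce[OF g(1)])
  qed (rule h_carrier)
  have onto: "\<exists>C\<in>H. ps C z = fgrp_of w" for w
  proof (induction w)
    case Nil
    show ?case by (rule bexI[OF _ subgroup.one_closed[OF H]]) (simp only: ps_one fgrp_of_Nil)
  next
    case (Cons l w)
    obtain w' m where w': "act \<Sigma> w' z = \<tau> m z" "psum \<Sigma> lam w' z = fgrp_of [(fst l, True)]"
      using gens by blast
    have "proj w' \<in> H" using w' by (auto simp: H_def mv_proj)
    define D where "D = (if snd l then proj w' else inv\<^bsub>G\<^esub> proj w')"
    have D: "D \<in> H" using \<open>proj w' \<in> H\<close> inv_H by (simp add: D_def)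
    have psD: "ps D z = fgrp_of [l]"
    proof (cases "snd l")
      case True
      then have "(fst l, True) = l" by (simp add: prod_eq_iff)
      then show ?thesis using True w'(2) by (simp add: D_def ps_proj)
    next
      case False
      have "ps (inv\<^bsub>G\<^esub> proj w') (\<tau> m z) + ps (proj w') z = 0"
        using ps_mult[of "inv\<^bsub>G\<^esub> proj w'" "proj w'" z] w'(1) by (simp add: ps_one mv_proj)
      then have "ps (inv\<^bsub>G\<^esub> proj w') z = - fgrp_of [(fst l, True)]"
        by (simp add: ps_\<tau> ps_proj w'(2) eq_neg_iff_add_eq_0)
      also have "\<dots> = fgrp_of (inv_word [(fst l, True)])" by (simp only: fgrp_of_inv)
      also have "inv_word [(fst l, True)] = [l]"
        using False by (simp add: inv_word_def inv_letter_def prod_eq_iff)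
      finally show ?thesis using False by (simp add: D_def)
    qed
    obtain C where C: "C \<in> H" "ps C z = fgrp_of w" using Cons by blast
    have "ps (D \<otimes>\<^bsub>G\<^esub> C) z = fgrp_of [l] + fgrp_of w"
      using C D psD by (auto simp: ps_mult H_def ps_\<tau>)
    also have "\<dots> = fgrp_of (l # w)" using fgrp_of_append[of "[l]" w] by simp
    finally show ?case using subgroup.m_closed[OF H D C(1)] by blast
  qed
  have "h ` H = carrier ?F"
  proof
    show "h ` H \<subseteq> carrier ?F" using h_carrier by blast
    show "carrier ?F \<subseteq> h ` H"
    proof
      fix x assume "x \<in> carrier ?F"
      then have "x \<in> map (map_prod g id) ` words_over UNIV"
        using words by (simp only: carrier_F bij_betw_def)
      then obtain v where v: "x = map (map_prod g id) v" "reduced v"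
        by (auto simp: words_over_def)
      obtain C where "C \<in> H" "ps C z = fgrp_of v" using onto by blast
      then show "x \<in> h ` H" using v by (auto simp: h_def fgrp_of.rep_eq reduce_id intro!: image_eqI)
    qed
  qed
  moreover have "\<not> comm_group ?F"
  proof
    assume "comm_group ?F"
    then have "[(0, True)] \<otimes>\<^bsub>?F\<^esub> [(1, True)] = [(1, True)] \<otimes>\<^bsub>?F\<^esub> [(0, True)]"
      by (intro comm_monoid.m_comm) (auto simp: comm_group_def carrier_free_group)
    then show False by (simp add: mult_free_group reduce_def inv_letter_def)
  qed
  ultimately show ?thesis
    unfolding large_def using finitely_generated_G fi h_hom by blast
qed

end

text \<open>The centralizer of \<open>x\<close> and \<open>y\<close> serves if it is proper.
  Otherwise both are central, and the centre of a non-abelian group is proper. For the images of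
  \<open>u\<close> and \<open>v\<close> in a finite quotient this subgroup becomes the invariant set
  \<open>A\<close>.\<close>

lemma (in group) noncentral_subgroup:
  assumes x: "x \<in> carrier G" "y \<in> carrier G" "x \<otimes> y = y \<otimes> x" and "\<not> comm_group G"
  obtains A where "subgroup A G" "x \<in> A" "y \<in> A" "A \<noteq> carrier G"
proof -
  define Z where "Z S = {g \<in> carrier G. \<forall>s\<in>S. g \<otimes> s = s \<otimes> g}" for S
  have Z: "subgroup (Z S) G" if S: "S \<subseteq> carrier G" for S
  proof (rule subgroupI)
    show "Z S \<noteq> {}" using S by (auto simp: Z_def intro!: exI[of _ "\<one>"])
    show "inv g \<in> Z S" if "g \<in> Z S" for g
    proof -
      have "inv g \<otimes> s = s \<otimes> inv g" if s: "s \<in> S" for s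
      proof -
        have g: "g \<in> carrier G" "g \<otimes> s = s \<otimes> g" "s \<in> carrier G"
          using \<open>g \<in> Z S\<close> s S by (auto simp: Z_def)
        have "inv g \<otimes> s = inv g \<otimes> (s \<otimes> g) \<otimes> inv g" using g by (simp add: m_assoc)
        also have "\<dots> = s \<otimes> inv g" using g by (simp add: g(2)[symmetric] m_assoc[symmetric])
        finally show ?thesis .
      qed
      then show ?thesis using that by (auto simp: Z_def)
    qed
    show "g \<otimes> h \<in> Z S" if gh: "g \<in> Z S" "h \<in> Z S" for g h
    proof -
      have "g \<otimes> h \<otimes> s = s \<otimes> (g \<otimes> h)" if s: "s \<in> S" for s
      proof -
        have c: "g \<in> carrier G" "h \<in> carrier G" "s \<in> carrier G" "g \<otimes> s = s \<otimes> g" "h \<otimes> s = s \<otimes> h"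
          using gh s S by (auto simp: Z_def)
        have "g \<otimes> h \<otimes> s = g \<otimes> (h \<otimes> s)" using c(1-3) by (simp only: m_assoc)
        also have "\<dots> = (g \<otimes> s) \<otimes> h" unfolding c(5) using c(1-3) by (simp only: m_assoc)
        also have "\<dots> = s \<otimes> (g \<otimes> h)" unfolding c(4) using c(1-3) by (simp only: m_assoc)
        finally show ?thesis .
      qed
      then show ?thesis using gh by (auto simp: Z_def)
    qed
  qed (auto simp: Z_def)
  show thesis
  proof (cases "Z {x, y} = carrier G")
    case False
    have "x \<in> Z {x, y}" "y \<in> Z {x, y}" using x by (simp_all add: Z_def)
    moreover have "subgroup (Z {x, y}) G" using Z x by simp
    ultimately show ?thesis using False by (intro that[of "Z {x, y}"])
  next
    case True
    then have c: "g \<otimes> x = x \<otimes> g" "g \<otimes> y = y \<otimes> g" if "g \<in> carrier G" for g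
      using that by (auto simp: Z_def)
    have "Z (carrier G) \<noteq> carrier G"
    proof
      assume "Z (carrier G) = carrier G"
      then have "g \<otimes> h = h \<otimes> g" if "g \<in> carrier G" "h \<in> carrier G" for g h
        using that unfolding Z_def by blast
      then have "comm_group G" by (rule group_comm_groupI)
      with assms(4) show False by contradiction
    qed
    moreover have "x \<in> Z (carrier G)" unfolding Z_def using x(1) c(1)[symmetric] by blast
    moreover have "y \<in> Z (carrier G)" unfolding Z_def using x(2) c(2)[symmetric] by blast
    ultimately show ?thesis by (intro that[of "Z (carrier G)"] Z subset_refl)
  qed
qed

text \<open>The left regular representation of the finite quotient provides the permutations.\<close>

lemma finite_quotient_of_hom:
  fixes Q :: "('b, 'c) monoid_scheme" and \<phi> :: "gen2 word \<Rightarrow> 'b"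
  assumes "group Q" and fin: "finite (carrier Q)" and nc: "\<not> comm_group Q"
    and app: "\<And>w w'. \<phi> (w @ w') = \<phi> w \<otimes>\<^bsub>Q\<^esub> \<phi> w'" and red: "\<And>w. \<phi> (reduce w) = \<phi> w"
    and onto: "range \<phi> = carrier Q"
    and rel: "\<phi> (u @ v @ inv_word u @ inv_word v) = \<one>\<^bsub>Q\<^esub>"
  obtains \<sigma> n A j1 j2 where "finite_quotient \<sigma> n u v A j1 j2"
proof -
  interpret group Q by fact
  have car: "\<phi> w \<in> carrier Q" for w using onto by blast
  have \<phi>_Nil: "\<phi> [] = \<one>\<^bsub>Q\<^esub>"
    using app[of "[]" "[]"] car[of "[]"] by (metis append_Nil r_cancel_one)
  have inv: "\<phi> (inv_word w) \<otimes>\<^bsub>Q\<^esub> \<phi> w = \<one>\<^bsub>Q\<^esub>" for w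
    using red[of "inv_word w @ w"] by (simp add: reduce_inv_word \<phi>_Nil app)
  have inv_eq: "inv\<^bsub>Q\<^esub> \<phi> w = \<phi> (inv_word w)" for w
    using inv[of w] by (intro inv_equality) (simp_all add: car)
  have uv: "\<phi> u \<otimes>\<^bsub>Q\<^esub> \<phi> v = \<phi> v \<otimes>\<^bsub>Q\<^esub> \<phi> u"
  proof -
    have "\<phi> u \<otimes>\<^bsub>Q\<^esub> \<phi> v \<otimes>\<^bsub>Q\<^esub> inv\<^bsub>Q\<^esub> (\<phi> v \<otimes>\<^bsub>Q\<^esub> \<phi> u) = \<one>\<^bsub>Q\<^esub>"
      using rel by (simp add: app inv_mult_group inv_eq car m_assoc)
    then show ?thesis by (metis car inv_equality inv_inv inv_closed m_closed)
  qed
  obtain A' where A': "subgroup A' Q" "\<phi> u \<in> A'" "\<phi> v \<in> A'" "A' \<noteq> carrier Q"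
    using noncentral_subgroup[OF car car uv nc] by blast
  define n where "n = card (carrier Q)"
  obtain e where e: "bij_betw e (carrier Q) {..<n}"
    using ex_bij_betw_finite_nat[OF fin] by (auto simp: n_def atLeast0LessThan)
  define d where "d = inv_into (carrier Q) e"
  have ed: "e (d j) = j" "d j \<in> carrier Q" if "j < n" for j
    using that e unfolding d_def by (auto simp: bij_betw_def f_inv_into_f inv_into_into)
  have de: "d (e x) = x" "e x < n" if "x \<in> carrier Q" for x
    using that e unfolding d_def by (auto simp: bij_betw_def)
  define \<sigma> where "\<sigma> s j = (if j < n then e (\<phi> [(s, True)] \<otimes>\<^bsub>Q\<^esub> d j) else j)" for s j
  have "\<phi> [(s, False)] \<otimes>\<^bsub>Q\<^esub> \<phi> [(s, True)] = \<one>\<^bsub>Q\<^esub>" for s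
    using inv[of "[(s, True)]"] by (simp add: inv_word_def inv_letter_def)
  moreover have "\<phi> [(s, True)] \<otimes>\<^bsub>Q\<^esub> \<phi> [(s, False)] = \<one>\<^bsub>Q\<^esub>" for s
    using inv[of "[(s, False)]"] by (simp add: inv_word_def inv_letter_def)
  ultimately have cancel: "\<phi> [(s, False)] \<otimes>\<^bsub>Q\<^esub> (\<phi> [(s, True)] \<otimes>\<^bsub>Q\<^esub> x) = x"
    "\<phi> [(s, True)] \<otimes>\<^bsub>Q\<^esub> (\<phi> [(s, False)] \<otimes>\<^bsub>Q\<^esub> x) = x" if "x \<in> carrier Q" for s x
    using that by (simp_all add: m_assoc[symmetric] car)
  define \<sigma>' where "\<sigma>' s j = (if j < n then e (\<phi> [(s, False)] \<otimes>\<^bsub>Q\<^esub> d j) else j)" for s j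
  have c1: "\<sigma>' s (\<sigma> s j) = j" and c2: "\<sigma> s (\<sigma>' s j) = j" for s j
    by (simp_all add: \<sigma>_def \<sigma>'_def de ed car cancel)
  have \<sigma>: "perms \<sigma>" by (rule permsI[OF c1 c2])
  have inv_\<sigma>: "inv_into UNIV (\<sigma> s) j = \<sigma>' s j" for s j
    by (rule inv_f_eq) (use \<sigma> c2 in \<open>auto simp: perms_def bij_def\<close>)
  have act: "act \<sigma> w j = (if j < n then e (\<phi> w \<otimes>\<^bsub>Q\<^esub> d j) else j)" for w j
  proof (induction w)
    case Nil
    then show ?case by (simp add: \<phi>_Nil ed)
  next
    case (Cons l w)
    obtain s b where l: "l = (s, b)" by (cases l)
    have "\<phi> (l # w) = \<phi> [(s, b)] \<otimes>\<^bsub>Q\<^esub> \<phi> w" using app[of "[l]" w] by (simp add: l)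
    then show ?case
      using Cons by (cases b) (simp_all add: l inv_\<sigma>, simp_all add: \<sigma>_def \<sigma>'_def de ed car m_assoc)
  qed
  \<comment> \<open>Left translations by the images of \<open>u\<close> and \<open>v\<close>
    preserve the subgroup \<open>A'\<close>. The identity and an element outside \<open>A'\<close>
    supply \<open>j1\<close> and \<open>j2\<close>.\<close>
  define A where "A = e ` A'"
  have A'_sub: "A' \<subseteq> carrier Q" using A'(1) by (rule subgroup.subset)
  have inv_A: "act \<sigma> w ` A = A" if w: "\<phi> w \<in> A'" for w
  proof (rule endo_inj_surj)
    show "finite A" using fin A'_sub finite_subset by (auto simp: A_def)
    show "act \<sigma> w ` A \<subseteq> A"
      using w A'_sub subgroup.m_closed[OF A'(1)] by (auto simp: A_def act de subset_iff)
    show "inj_on (act \<sigma> w) A" by (auto simp: inj_on_def act_inj[OF \<sigma>])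
  qed
  obtain x where x: "x \<in> carrier Q" "x \<notin> A'" using A'(4) A'_sub by blast
  have "finite_quotient \<sigma> n u v A (e \<one>\<^bsub>Q\<^esub>) (e x)"
  proof
    show "perms \<sigma>" by fact
    show "(j < n) = (\<sigma> s j < n)" for s j by (simp add: \<sigma>_def de ed car)
    show "\<exists>w. act \<sigma> w j = k" if "j < n" "k < n" for j k
    proof -
      have "d k \<otimes>\<^bsub>Q\<^esub> inv\<^bsub>Q\<^esub> d j \<in> range \<phi>" unfolding onto using ed that by simp
      then obtain w where "\<phi> w = d k \<otimes>\<^bsub>Q\<^esub> inv\<^bsub>Q\<^esub> d j" by auto
      then show ?thesis using that by (intro exI[of _ w]) (simp add: act m_assoc ed)
    qed
    show "act \<sigma> (u @ v @ inv_word u @ inv_word v) j = j" for j by (simp add: act rel ed)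
    show "act \<sigma> u ` A = A" "act \<sigma> v ` A = A" by (rule inv_A, fact)+
    show "A \<subseteq> {..<n}" using A'_sub de(2) by (auto simp: A_def)
    show "e \<one>\<^bsub>Q\<^esub> \<in> A" using subgroup.one_closed[OF A'(1)] by (simp add: A_def)
    show "e x < n" using de x by simp
    show "e x \<notin> A"
    proof
      assume "e x \<in> A"
      then obtain y where "y \<in> A'" "e x = e y" by (auto simp: A_def)
      then show False using de(1)[OF x(1)] de(1)[of y] A'_sub x(2) by auto
    qed
  qed
  then show thesis by (rule that)
qed

section \<open>Finite index subgroups and the commutator subgroup\<close>

context one_relator
begin

text \<open>\<open>K\<close> is replaced by its normal core, whose quotient is finite as it permutes
  the finitely many cosets of \<open>K\<close> faithfully. Were that quotient abelian, all
  commutators would lie in \<open>K\<close>.\<close>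

lemma core_quotient:
  assumes K: "finite_index G K" and D: "\<not> derived G (carrier G) \<subseteq> K"
    and rr: "r = reduce (u @ v @ inv_word u @ inv_word v)"
  obtains \<sigma> n A j1 j2 where "finite_quotient \<sigma> n u v A j1 j2"
proof -
  have Ks: "subgroup K G" and Kfin: "finite (rcosets\<^bsub>G\<^esub> K)" using K by (auto simp: finite_index_def)
  have Kc: "K \<subseteq> carrier G" using Ks by (rule subgroup.subset)
  \<comment> \<open>The preimage in \<open>F2\<close> of the core of \<open>K\<close>, that is the
    kernel of the action on right cosets by right multiplication.\<close>
  define L where "L = {w \<in> carrier F2. \<forall>a\<in>carrier G. K #>\<^bsub>G\<^esub> (a \<otimes>\<^bsub>G\<^esub> proj w) = K #>\<^bsub>G\<^esub> a}"
  have assoc: "K #>\<^bsub>G\<^esub> (a \<otimes>\<^bsub>G\<^esub> b) = (K #>\<^bsub>G\<^esub> a) #>\<^bsub>G\<^esub> b" if "a \<in> carrier G" "b \<in> carrier G" for a b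
    using coset_mult_assoc[OF Kc that] by simp
  have proj_mult: "proj (w \<otimes>\<^bsub>F2\<^esub> w') = proj w \<otimes>\<^bsub>G\<^esub> proj w'" for w w'
    by (simp add: mult_free_group proj_append)
  have proj_inv': "proj (inv\<^bsub>F2\<^esub> w) = inv\<^bsub>G\<^esub> proj w" if "w \<in> carrier F2" for w
    using that by (simp add: inv_free_group proj_inv)
  have Lmult: "K #>\<^bsub>G\<^esub> (a \<otimes>\<^bsub>G\<^esub> (proj w \<otimes>\<^bsub>G\<^esub> b)) = K #>\<^bsub>G\<^esub> (a \<otimes>\<^bsub>G\<^esub> b)"
    if "w \<in> L" "a \<in> carrier G" "b \<in> carrier G" for w a b
  proof -
    have "K #>\<^bsub>G\<^esub> (a \<otimes>\<^bsub>G\<^esub> (proj w \<otimes>\<^bsub>G\<^esub> b)) = (K #>\<^bsub>G\<^esub> (a \<otimes>\<^bsub>G\<^esub> proj w)) #>\<^bsub>G\<^esub> b"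
      using that by (simp add: assoc[symmetric] m_assoc)
    also have "\<dots> = (K #>\<^bsub>G\<^esub> a) #>\<^bsub>G\<^esub> b" using that by (simp add: L_def)
    finally show ?thesis using that by (simp add: assoc)
  qed
  have sub: "subgroup L F2"
  proof (rule F.subgroupI)
    show "L \<noteq> {}" using F.one_closed by (auto simp: L_def one_free_group proj_Nil intro!: exI[of _ "[]"])
    show "inv\<^bsub>F2\<^esub> w \<in> L" if w: "w \<in> L" for w
    proof -
      have wc: "w \<in> carrier F2" using w by (simp add: L_def)
      have "K #>\<^bsub>G\<^esub> (a \<otimes>\<^bsub>G\<^esub> inv\<^bsub>G\<^esub> proj w) = K #>\<^bsub>G\<^esub> a" if "a \<in> carrier G" for a
      proof -
        have "K #>\<^bsub>G\<^esub> (a \<otimes>\<^bsub>G\<^esub> inv\<^bsub>G\<^esub> proj w \<otimes>\<^bsub>G\<^esub> proj w) = K #>\<^bsub>G\<^esub> (a \<otimes>\<^bsub>G\<^esub> inv\<^bsub>G\<^esub> proj w)"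
          using w that by (simp add: L_def)
        then show ?thesis using that by (simp add: m_assoc)
      qed
      then show ?thesis using wc F.inv_closed[OF wc] by (simp add: L_def proj_inv')
    qed
    show "w \<otimes>\<^bsub>F2\<^esub> w' \<in> L" if w: "w \<in> L" "w' \<in> L" for w w'
    proof -
      have "w \<otimes>\<^bsub>F2\<^esub> w' \<in> carrier F2" using w by (simp add: L_def)
      moreover have "K #>\<^bsub>G\<^esub> (a \<otimes>\<^bsub>G\<^esub> (proj w \<otimes>\<^bsub>G\<^esub> proj w')) = K #>\<^bsub>G\<^esub> a" if "a \<in> carrier G" for a
        using Lmult[OF w(1) that, of "proj w'"] w(2) that by (simp add: L_def)
      ultimately show ?thesis by (simp add: L_def proj_mult)
    qed
  qed (auto simp: L_def)
  have "L \<lhd> F2"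
  proof -
    have "x \<otimes>\<^bsub>F2\<^esub> w \<otimes>\<^bsub>F2\<^esub> inv\<^bsub>F2\<^esub> x \<in> L" if x: "x \<in> carrier F2" "w \<in> L" for x w
    proof -
      have wc: "w \<in> carrier F2" using x by (simp add: L_def)
      have "K #>\<^bsub>G\<^esub> (a \<otimes>\<^bsub>G\<^esub> (proj x \<otimes>\<^bsub>G\<^esub> proj w \<otimes>\<^bsub>G\<^esub> inv\<^bsub>G\<^esub> proj x)) = K #>\<^bsub>G\<^esub> a" if "a \<in> carrier G" for a
        using Lmult[OF x(2), of "a \<otimes>\<^bsub>G\<^esub> proj x" "inv\<^bsub>G\<^esub> proj x"] that by (simp add: m_assoc)
      then show ?thesis using x wc by (simp add: L_def proj_mult proj_inv')
    qed
    then show ?thesis using sub by (simp add: F.normal_inv_iff)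
  qed
  then interpret L: normal L F2 .
  define Q where "Q = F2 Mod L"
  interpret Q: group Q unfolding Q_def by (rule L.factorgroup_is_group)
  define \<phi> where "\<phi> w = L #>\<^bsub>F2\<^esub> reduce w" for w
  have \<phi>_car: "range \<phi> = carrier Q"
  proof -
    have "carrier F2 = range reduce"
      by (auto simp: carrier_free_group image_iff) (metis reduce_id)
    then show ?thesis by (auto simp: Q_def carrier_FactGroup \<phi>_def)
  qed
  have app: "\<phi> (w @ w') = \<phi> w \<otimes>\<^bsub>Q\<^esub> \<phi> w'" for w w'
    using L.rcos_sum[of "reduce w" "reduce w'"]
    by (simp add: \<phi>_def Q_def mult_free_group reduce_append_reduce reduce_append_reduce')
  have \<phi>_one: "\<phi> w = \<one>\<^bsub>Q\<^esub> \<longleftrightarrow> reduce w \<in> L" for w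
    using F.coset_join1[of L "reduce w"] F.coset_join2[of "reduce w" L] L.subgroup_axioms
    by (auto simp: \<phi>_def Q_def)
  have finQ: "finite (carrier Q)"
  proof -
    let ?f = "\<lambda>w. restrict (\<lambda>C. C #>\<^bsub>G\<^esub> proj w) (rcosets\<^bsub>G\<^esub> K)"
    have "finite (rcosets\<^bsub>F2\<^esub> L)"
    proof (rule F.finite_rcosets_criterion[OF sub, of ?f])
      have "C #>\<^bsub>G\<^esub> proj w \<in> rcosets\<^bsub>G\<^esub> K" if CK: "C \<in> rcosets\<^bsub>G\<^esub> K" for C w
      proof -
        obtain a where "a \<in> carrier G" "C = K #>\<^bsub>G\<^esub> a" using CK by (auto simp: RCOSETS_def)
        then show ?thesis using rcosetsI[OF Kc, of "a \<otimes>\<^bsub>G\<^esub> proj w"] by (simp add: assoc)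
      qed
      then have "?f w \<in> (rcosets\<^bsub>G\<^esub> K) \<rightarrow>\<^sub>E (rcosets\<^bsub>G\<^esub> K)" for w
        by (simp add: restrict_PiE_iff)
      then have "?f ` carrier F2 \<subseteq> (rcosets\<^bsub>G\<^esub> K) \<rightarrow>\<^sub>E (rcosets\<^bsub>G\<^esub> K)" by blast
      then show "finite (?f ` carrier F2)" by (rule finite_subset) (intro finite_PiE Kfin)
      fix w w' assume w: "w \<in> carrier F2" "w' \<in> carrier F2" and eq: "?f w = ?f w'"
      have kk: "K #>\<^bsub>G\<^esub> (a \<otimes>\<^bsub>G\<^esub> (proj w \<otimes>\<^bsub>G\<^esub> inv\<^bsub>G\<^esub> proj w')) = K #>\<^bsub>G\<^esub> a" if a: "a \<in> carrier G" for a
      proof -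
        have "K #>\<^bsub>G\<^esub> a \<in> rcosets\<^bsub>G\<^esub> K" using a Kc by (intro rcosetsI)
        then have "(K #>\<^bsub>G\<^esub> a) #>\<^bsub>G\<^esub> proj w = (K #>\<^bsub>G\<^esub> a) #>\<^bsub>G\<^esub> proj w'"
          using fun_cong[OF eq, of "K #>\<^bsub>G\<^esub> a"] by simp
        then have "(K #>\<^bsub>G\<^esub> (a \<otimes>\<^bsub>G\<^esub> proj w)) #>\<^bsub>G\<^esub> inv\<^bsub>G\<^esub> proj w' =
            (K #>\<^bsub>G\<^esub> (a \<otimes>\<^bsub>G\<^esub> proj w')) #>\<^bsub>G\<^esub> inv\<^bsub>G\<^esub> proj w'"
          using a by (simp only: assoc proj_carrier)
        then show ?thesis using a by (simp add: assoc[symmetric] m_assoc)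
      qed
      show "w \<otimes>\<^bsub>F2\<^esub> inv\<^bsub>F2\<^esub> w' \<in> L"
        unfolding L_def mem_Collect_eq proj_mult proj_inv'[OF w(2)]
        using w kk by (intro conjI ballI F.m_closed F.inv_closed)
    qed
    then show ?thesis by (simp add: Q_def FactGroup_def)
  qed
  have "\<not> comm_group Q"
  proof
    assume "comm_group Q"
    then interpret Q: comm_group Q .
    have "derived_set G (carrier G) \<subseteq> K"
    proof clarify
      fix x y assume xy: "x \<in> carrier G" "y \<in> carrier G"
      obtain w w' where w: "x = proj w" "y = proj w'" using xy proj_surj by metis
      let ?c = "w @ w' @ inv_word w @ inv_word w'"
      have inv\<phi>: "\<phi> (inv_word w) = inv\<^bsub>Q\<^esub> \<phi> w" for w
      proof -
        have "\<phi> (inv_word w) \<otimes>\<^bsub>Q\<^esub> \<phi> w = \<phi> (inv_word w @ w)" by (simp only: app)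
        also have "\<dots> = \<one>\<^bsub>Q\<^esub>"
          using \<phi>_one[of "inv_word w @ w"] L.one_closed by (simp add: reduce_inv_word one_free_group)
        finally show ?thesis using \<phi>_car Q.inv_equality by (metis rangeI)
      qed
      have c: "\<phi> w \<in> carrier Q" for w using \<phi>_car by blast
      have "\<phi> w \<otimes>\<^bsub>Q\<^esub> (\<phi> w' \<otimes>\<^bsub>Q\<^esub> (inv\<^bsub>Q\<^esub> \<phi> w \<otimes>\<^bsub>Q\<^esub> inv\<^bsub>Q\<^esub> \<phi> w')) =
          (\<phi> w \<otimes>\<^bsub>Q\<^esub> inv\<^bsub>Q\<^esub> \<phi> w) \<otimes>\<^bsub>Q\<^esub> (\<phi> w' \<otimes>\<^bsub>Q\<^esub> inv\<^bsub>Q\<^esub> \<phi> w')"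
        by (simp only: Q.m_ac c Q.inv_closed Q.m_closed)
      then have "\<phi> ?c = \<one>\<^bsub>Q\<^esub>" by (simp add: app inv\<phi> c)
      then have "reduce ?c \<in> L" by (simp only: \<phi>_one)
      then have "\<forall>a\<in>carrier G. K #>\<^bsub>G\<^esub> (a \<otimes>\<^bsub>G\<^esub> proj ?c) = K #>\<^bsub>G\<^esub> a"
        unfolding L_def mem_Collect_eq proj_reduce by (rule conjunct2)
      then have "K #>\<^bsub>G\<^esub> (\<one>\<^bsub>G\<^esub> \<otimes>\<^bsub>G\<^esub> proj ?c) = K #>\<^bsub>G\<^esub> \<one>\<^bsub>G\<^esub>"
        by (rule bspec) (rule one_closed)
      then have "K #>\<^bsub>G\<^esub> proj ?c = K" using Kc by simp
      then have "proj ?c \<in> K" using coset_join1[OF _ proj_carrier Ks] by blast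
      then show "x \<otimes>\<^bsub>G\<^esub> y \<otimes>\<^bsub>G\<^esub> inv\<^bsub>G\<^esub> x \<otimes>\<^bsub>G\<^esub> inv\<^bsub>G\<^esub> y \<in> K"
        by (simp add: w proj_append proj_inv m_assoc)
    qed
    then have "derived G (carrier G) \<subseteq> K"
      unfolding derived_def by (rule generate_subgroup_incl[OF _ Ks])
    with D show False by contradiction
  qed
  moreover have "\<phi> (u @ v @ inv_word u @ inv_word v) = \<one>\<^bsub>Q\<^esub>"
    unfolding \<phi>_one rr[symmetric] L_def using r proj_relator by simp
  moreover have "\<phi> (reduce w) = \<phi> w" for w by (simp add: \<phi>_def reduce_id)
  ultimately obtain \<sigma> n A j1 j2 where "finite_quotient \<sigma> n u v A j1 j2"
    using finite_quotient_of_hom[OF Q.is_group finQ _ app _ \<phi>_car] by metis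
  then show thesis by (rule that)
qed

lemma large_of_finite_quotient:
  assumes "finite_quotient \<sigma> n u v A j1 j2" and rr: "r = reduce (u @ v @ inv_word u @ inv_word v)"
  shows "large G"
proof -
  interpret finite_quotient \<sigma> n u v A j1 j2 by fact
  obtain M \<Sigma> c z where w: "virtual_surjection rel n M \<Sigma> c z"
    using virtual_surjection_exists by blast
  then have \<Sigma>: "perms \<Sigma>" by (simp add: virtual_surjection_def)
  have "r = reduce rel" by (simp add: rr rel_def)
  then have "virtual_surjection r n M \<Sigma> c z"
    using w by (simp add: virtual_surjection_def act_reduce[OF \<Sigma>] psum_reduce[OF \<Sigma>])
  then show ?thesis by (rule large_of_virtual_surjection)
qed

text \<open>Exponent sums are label sums for the trivial action, so the invariance results for
  \<open>psum\<close> apply to them.\<close>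

lemma weight_psum: "weight \<omega> w = psum (\<lambda>s. id) (\<lambda>s x. \<omega> s) w x"
  by (induction w) auto

lemma weight_reduce: "weight \<omega> (reduce w) = weight \<omega> w"
  using psum_reduce[OF perms_id, of "\<lambda>s x. \<omega> s" w "()"] by (simp add: weight_psum[of _ _ "()"])

lemma weight_proj:
  assumes "weight \<omega> r = 0" and "proj w = proj w'"
  shows "weight \<omega> w = weight \<omega> w'"
  using proj_eq_act(2)[OF assms(2) perms_id, of "\<lambda>s x. \<omega> s" "()"] assms(1)
  by (simp add: weight_psum[symmetric])

text \<open>A relator with exponent sums zero leaves exponent sums well defined on \<open>G\<close>,
  and reducing them modulo an integer yields finite index subgroups. An element of all of these has
  exponent sums zero, hence is trivial in the abelianization, where it is a product of powers of the
  two generators with these exponents.\<close>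

lemma derived_subset_finite_index:
  assumes w0: "\<And>s. weight (expo s) r = 0" and C: "C \<in> carrier G"
    and int: "\<And>H. finite_index G H \<Longrightarrow> C \<in> H"
  shows "C \<in> derived G (carrier G)"
proof -
  obtain w where w: "C = proj w" using C proj_surj by metis
  have ww: "weight (expo s) w = 0" for s
  proof -
    \<comment> \<open>A modulus larger than the absolute value of the exponent sum: divisibility by
      \<open>M\<close> then forces it to be zero.\<close>
    define M where "M = \<bar>weight (expo s) w\<bar> + 1"
    define f where "f C = weight (expo s) (SOME w. proj w = C) mod M" for C
    have f: "f (proj v) = weight (expo s) v mod M" for v
      using weight_proj[OF w0, of "SOME u. proj u = proj v" v s] someI[of "\<lambda>u. proj u = proj v" v]
      by (simp add: f_def)
    have M: "M > 0" by (simp add: M_def)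
    define H where "H = {C \<in> carrier G. f C = 0}"
    have "subgroup H G"
    proof (rule subgroupI)
      have "f (proj []) = 0" by (simp only: f) simp
      then have "proj [] \<in> H" by (simp add: H_def)
      then show "H \<noteq> {}" by blast
      show "inv\<^bsub>G\<^esub> x \<in> H" if x: "x \<in> H" for x
      proof -
        obtain v where v: "x = proj v" using x proj_surj by (auto simp: H_def)
        have "M dvd weight (expo s) v" using x by (simp add: H_def v f mod_eq_0_iff_dvd)
        then have "f (proj (inv_word v)) = 0" by (simp add: f weight_inv_word mod_eq_0_iff_dvd)
        then show ?thesis by (simp add: H_def v proj_inv)
      qed
      show "x \<otimes>\<^bsub>G\<^esub> y \<in> H" if x: "x \<in> H" "y \<in> H" for x y
      proof -
        obtain v v' where v: "x = proj v" "y = proj v'" using x proj_surj by (auto simp: H_def) metis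
        have "M dvd weight (expo s) v" "M dvd weight (expo s) v'"
          using x by (simp_all add: H_def v f mod_eq_0_iff_dvd)
        then have "f (proj (v @ v')) = 0" by (simp add: f mod_eq_0_iff_dvd)
        then show ?thesis using x by (simp add: H_def v proj_append)
      qed
    qed (auto simp: H_def)
    moreover have "finite (rcosets\<^bsub>G\<^esub> H)"
    proof (rule finite_rcosets_criterion[OF \<open>subgroup H G\<close>, of f])
      have "f ` carrier G \<subseteq> {0..<M}" using M by (auto simp: f_def)
      then show "finite (f ` carrier G)" by (rule finite_subset) simp
      fix x y assume xy: "x \<in> carrier G" "y \<in> carrier G" "f x = f y"
      obtain v v' where v: "x = proj v" "y = proj v'" using xy proj_surj by metis
      have "M dvd weight (expo s) v - weight (expo s) v'"
        using xy(3) by (simp add: v f mod_eq_dvd_iff)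
      then have "f (proj (v @ inv_word v')) = 0" by (simp add: f weight_inv_word mod_eq_0_iff_dvd)
      then show "x \<otimes>\<^bsub>G\<^esub> inv\<^bsub>G\<^esub> y \<in> H" using xy by (simp add: H_def v proj_append proj_inv)
    qed
    ultimately have "C \<in> H" using int by (simp add: finite_index_def)
    then have "M dvd weight (expo s) w" by (simp add: H_def w f mod_eq_0_iff_dvd)
    then show ?thesis using zdvd_imp_le[of M "\<bar>weight (expo s) w\<bar>"] by (auto simp: M_def)
  qed
  let ?D = "derived G (carrier G)"
  have D: "?D \<lhd> G" by (rule derived_is_normal[OF normal_self])
  interpret D: normal ?D G by (rule D)
  interpret Q: comm_group "G Mod ?D" by (rule derived_quot_is_comm_group)
  define \<psi> where "\<psi> w = ?D #>\<^bsub>G\<^esub> proj w" for w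
  have \<psi>c: "\<psi> w \<in> carrier (G Mod ?D)" for w by (auto simp: \<psi>_def carrier_FactGroup)
  have app: "\<psi> (w @ w') = \<psi> w \<otimes>\<^bsub>G Mod ?D\<^esub> \<psi> w'" for w w'
    using D.rcos_sum[of "proj w" "proj w'"] by (simp add: \<psi>_def proj_append)
  have \<psi>_Nil: "\<psi> [] = \<one>\<^bsub>G Mod ?D\<^esub>"
    using coset_mult_one[OF D.subset] by (simp add: \<psi>_def proj_Nil)
  have neg: "\<psi> [(s, False)] = inv\<^bsub>G Mod ?D\<^esub> \<psi> [(s, True)]" for s
  proof -
    have "\<psi> ([(s, False)] @ [(s, True)]) = \<psi> (reduce ([(s, False)] @ [(s, True)]))"
      by (simp only: \<psi>_def proj_reduce)
    then have "\<psi> [(s, False)] \<otimes>\<^bsub>G Mod ?D\<^esub> \<psi> [(s, True)] = \<one>\<^bsub>G Mod ?D\<^esub>"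
      by (simp only: app) (simp add: reduce_def inv_letter_def \<psi>_Nil)
    then show ?thesis using Q.inv_equality \<psi>c by metis
  qed
  define p where "p s k = \<psi> [(s, True)] [^]\<^bsub>G Mod ?D\<^esub> (k :: int)" for s k
  have pc: "p s k \<in> carrier (G Mod ?D)" for s k by (simp add: p_def \<psi>c)
  have p0: "p s 0 = \<one>\<^bsub>G Mod ?D\<^esub>" for s unfolding p_def by (rule int_pow_0)
  have p_add: "p s (k + l) = p s k \<otimes>\<^bsub>G Mod ?D\<^esub> p s l" for s k l
    by (simp add: p_def \<psi>c Q.int_pow_mult)
  have p1: "\<psi> [(s, b)] = p s (if b then 1 else - 1)" for s b
    using neg[of s] \<psi>c by (simp add: p_def Q.int_pow_1 Q.int_pow_neg)
  have "\<psi> v = p Gen_a (weight (expo Gen_a) v) \<otimes>\<^bsub>G Mod ?D\<^esub> p Gen_b (weight (expo Gen_b) v)" for v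
  proof (induction v)
    case Nil
    show ?case by (simp only: \<psi>_Nil weight_simps p0 Q.l_one Q.one_closed)
  next
    case (Cons l v)
    obtain s b where l: "l = (s, b)" by (cases l)
    define k where "k = (if b then 1 else - 1 :: int)"
    have wt: "weight (expo t) (l # v) = (if s = t then k else 0) + weight (expo t) v" for t
      by (auto simp: l k_def expo_def)
    have hd: "\<psi> (l # v) = p s k \<otimes>\<^bsub>G Mod ?D\<^esub> \<psi> v"
      using app[of "[l]" v] p1[of s b] by (simp add: l k_def)
    show ?case
    proof (cases s)
      case Gen_a
      have "\<psi> (l # v) = (p Gen_a k \<otimes>\<^bsub>G Mod ?D\<^esub> p Gen_a (weight (expo Gen_a) v)) \<otimes>\<^bsub>G Mod ?D\<^esub>
          p Gen_b (weight (expo Gen_b) v)"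
        unfolding hd Cons Gen_a by (rule Q.m_assoc[OF pc pc pc, symmetric])
      then show ?thesis by (simp only: wt Gen_a gen2.distinct if_True if_False p_add add_0_left refl)
    next
      case Gen_b
      have "\<psi> (l # v) = p Gen_a (weight (expo Gen_a) v) \<otimes>\<^bsub>G Mod ?D\<^esub>
          (p Gen_b k \<otimes>\<^bsub>G Mod ?D\<^esub> p Gen_b (weight (expo Gen_b) v))"
        unfolding hd Cons Gen_b by (rule Q.m_lcomm[OF pc pc pc])
      then show ?thesis by (simp only: wt Gen_b gen2.distinct if_True if_False p_add add_0_left refl)
    qed
  qed
  then have "\<psi> w = \<one>\<^bsub>G Mod ?D\<^esub>" by (simp only: ww p0 Q.l_one Q.one_closed)
  then have "?D #>\<^bsub>G\<^esub> C = ?D" by (simp add: \<psi>_def w)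
  then show ?thesis using coset_join1[OF _ C D.subgroup_axioms] by blast
qed

text \<open>In an abelian \<open>G\<close> the commutator \<open>aba'b'\<close> of the generators
  lies in the normal closure of \<open>r\<close>, which \<open>relator_of_abelian_quotient\<close>
  permits only for the relators excluded here.\<close>

lemma not_commutative:
  assumes "\<And>s. weight (expo s) r = 0"
    and "cyc_reduce r \<notin> cyclic_conjugates aba'b' \<union> cyclic_conjugates bab'a'"
  shows "\<not> comm_group G"
proof
  assume "comm_group G"
  then interpret C: comm_group G .
  have "proj aba'b' = proj [(Gen_a, True)] \<otimes>\<^bsub>G\<^esub> (proj [(Gen_b, True)] \<otimes>\<^bsub>G\<^esub>
      (proj (inv_word [(Gen_a, True)]) \<otimes>\<^bsub>G\<^esub> proj (inv_word [(Gen_b, True)])))"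
    by (simp add: aba'b'_def inv_word_def inv_letter_def flip: proj_append)
  also have "\<dots> = (proj [(Gen_a, True)] \<otimes>\<^bsub>G\<^esub> inv\<^bsub>G\<^esub> proj [(Gen_a, True)]) \<otimes>\<^bsub>G\<^esub>
      (proj [(Gen_b, True)] \<otimes>\<^bsub>G\<^esub> inv\<^bsub>G\<^esub> proj [(Gen_b, True)])"
    by (simp only: proj_inv C.m_ac proj_carrier inv_closed m_closed)
  also have "\<dots> = \<one>\<^bsub>G\<^esub>" by simp
  finally have "reduce aba'b' \<in> N" by (simp only: proj_eq_one_iff)
  moreover have "reduce aba'b' = aba'b'" by (rule reduce_id) (simp add: aba'b'_def inv_letter_def)
  ultimately show False
    using relator_of_abelian_quotient[OF r] assms by (simp add: N_def)
qed

end

theorem corollary5p7: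
  fixes u v :: "gen2 word"
  assumes "u \<in> carrier F2" and "v \<in> carrier F2"
    and "cyc_reduce (commutator F2 u v) \<notin> cyclic_conjugates aba'b' \<union> cyclic_conjugates bab'a'"
  shows "large (presented_group UNIV {commutator F2 u v}) \<or>
         residually_useless (presented_group UNIV {commutator F2 u v})"
proof -
  have rr: "commutator F2 u v = reduce (u @ v @ inv_word u @ inv_word v)"
    by (rule commutator_free_group[OF assms(1,2)])
  interpret one_relator "commutator F2 u v"
    by unfold_locales (simp add: rr carrier_free_group)
  have w0: "weight (expo s) (commutator F2 u v) = 0" for s
    unfolding rr by (simp add: weight_reduce weight_inv_word)
  show ?thesis
  proof (cases "\<forall>H. finite_index G H \<longrightarrow> derived G (carrier G) \<subseteq> H")
    case True
    \<comment> \<open>The whole group takes part in the intersection, so the latter consists of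
      elements of \<open>G\<close>.\<close>
    have "finite_index G (carrier G)"
      unfolding finite_index_def
      using finite_rcosets_criterion[OF subgroup_self, of "\<lambda>_. ()"] subgroup_self by simp
    then have "derived G (carrier G) = \<Inter>{H. finite_index G H}"
      using True derived_subset_finite_index[OF w0] by blast
    then have "residually_useless G"
      unfolding residually_useless_def
      using finitely_generated_G not_commutative[OF w0 assms(3)] by blast
    then show ?thesis by (simp add: G_def)
  next
    case False
    then obtain H where "finite_index G H" "\<not> derived G (carrier G) \<subseteq> H" by blast
    then obtain \<sigma> n A j1 j2 where "finite_quotient \<sigma> n u v A j1 j2"
      using core_quotient[OF _ _ rr] by blast
    then have "large G" by (rule large_of_finite_quotient[OF _ rr])
    then show ?thesis by (simp add: G_def)
  qed
qed

end
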